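(* Let $n\ge 2$ and $V\in\Omega_n$. (1) If $V\in\mathcal C_n$, then $g_{\Omega_n}(V,M)=g_{\mathbb G_n}(\sigma(V),\sigma(M))$ for every $M\in\Omega_n$. (2) If $V\notin\mathcal C_n$, then there exist an eigenvalue $\lambda$ of $V$ with $m(\lambda)<n(\lambda)$ and a matrix $X\in\mathcal M_n\setminus\{0\}$ such that, as $\zeta\to 0$ in $\mathbb C$, $$g_{\Omega_n}(V,V+\zeta X)\ \ge\ m(\lambda)\log|\zeta|+O(1),\qquad g_{\mathbb G_n}(\sigma(V),\sigma(V+\zeta X))\ \le\ n(\lambda)\log|\zeta|+O(1).$$
   Context: $\mathcal M_n$ is the space of complex $n\times n$ matrices with a fixed operator norm $\|\cdot\|$; $\rho(A)$ is the spectral radius and $\Omega_n=\{A\in\mathcal M_n:\rho(A)<1\}$ is the spectral ball. Write $\det(tI-A)=t^n+\sum_{j=1}^n(-1)^j\sigma_j(A)t^{n-j}$, $\sigma=(\sigma_1,\dots,\sigma_n):\mathcal M_n\to\mathbb C^n$, and $\mathbb G_n=\sigma(\Omega_n)$ (the symmetrized polydisk). $\mathcal C_n$ is the set of cyclic (non-derogatory) matrices, i.e. those admitting a cyclic vector. For a domain $D\subset\mathbb C^N$ and $p\in D$, the Green function is $g_D(p,z)=\sup\{u(z): u$ negative plurisubharmonic on $D$, $u(w)\le\log\|w-p\|+O(1)$ as $w\to p\}$. For an eigenvalue $\lambda$ of $V$, $V_\lambda$ denotes the restriction of $V$ to $\ker(V-\lambda I_n)^n$, $n(\lambda)=\dim\ker(V-\lambda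 I_n)^n$, and $m(\lambda)=\min\{k:(V_\lambda-\lambda I_{n(\lambda)})^k=0\}$. (For $\zeta$ small, $V+\zeta X\in\Omega_n$.) *)

theory Defs
  imports "HOL-Analysis.Analysis" "HOL-Computational_Algebra.Polynomial"
begin

section \<open>Matrices: scalar multiplication, powers, spectrum\<close>

text \<open>Complex scalar multiplication on matrices (the componentwise ring
  multiplication of the vec type is NOT the matrix product, so we avoid it).\<close>
definition mscale :: "complex \<Rightarrow> complex^'n^'n \<Rightarrow> complex^'n^'n" where
  "mscale c A = (\<chi> i j. c * A$i$j)"

text \<open>Action of the k-th matrix power of A on a vector.\<close>
definition mpow_apply :: "complex^'n^'n \<Rightarrow> nat \<Rightarrow> complex^'n \<Rightarrow> complex^'n" where
  "mpow_apply A k x = (((*v) A) ^^ k) x"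

definition is_eigenvalue :: "complex^'n^'n \<Rightarrow> complex \<Rightarrow> bool" where
  "is_eigenvalue A \<mu> \<longleftrightarrow> det (mat \<mu> - A) = 0"

definition spectral_radius :: "complex^'n^'n \<Rightarrow> real" where
  "spectral_radius A = Max (cmod ` {\<mu>. is_eigenvalue A \<mu>})"

text \<open>The spectral ball \<Omega>_n.\<close>
definition spectral_ball :: "(complex^'n^'n) set" where
  "spectral_ball = {A. spectral_radius A < 1}"

text \<open>Cyclic (non-derogatory) matrices: those admitting a cyclic vector.\<close>
definition cyclic_matrix :: "complex^'n^'n \<Rightarrow> bool" where
  "cyclic_matrix A \<longleftrightarrow> (\<exists>v. vec.span (range (\<lambda>k. mpow_apply A k v)) = UNIV)"

section \<open>Characteristic polynomial and the map sigma\<close>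

definition charpoly :: "complex^'n^'n \<Rightarrow> complex poly" where
  "charpoly A = det ((\<chi> i j. (if i = j then [:0, 1:] else 0) - [:A$i$j:]) :: complex poly^'n^'n)"

text \<open>sigma_j(A), j = 1..n, defined by
  det(tI - A) = t^n + sum_j (-1)^j sigma_j(A) t^(n-j).\<close>
definition sigma_coeff :: "complex^'n^'n \<Rightarrow> nat \<Rightarrow> complex" where
  "sigma_coeff A j = (-1)^j * coeff (charpoly A) (CARD('n) - j)"

text \<open>A fixed enumeration of the index type by {1..n}, used to regard
  (sigma_1,...,sigma_n) as a point of complex^'n.\<close>
definition idx_enum :: "'n::finite \<Rightarrow> nat" where
  "idx_enum = (SOME f. bij_betw f (UNIV::'n set) {1..CARD('n)})"

definition sigma :: "complex^'n^'n \<Rightarrow> complex^'n" where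
  "sigma A = (\<chi> i. sigma_coeff A (idx_enum i))"

text \<open>The symmetrized polydisk G_n = sigma(Omega_n).\<close>
definition symm_polydisk :: "(complex^'n) set" where
  "symm_polydisk = sigma ` spectral_ball"

section \<open>Negative plurisubharmonic functions and the pluricomplex Green function\<close>

text \<open>The ambient space is a finite-dimensional real euclidean space with a
  complex scalar multiplication sc. u takes values in [-\<infinity>, 0).
  u is negative plurisubharmonic on D iff it is negative, upper semicontinuous,
  and satisfies the sub-mean-value inequality on every closed complex disc
  {a + sc z b : |z| \<le> r} contained in D (written for -u \<ge> 0).\<close>
definition neg_psh :: "(complex \<Rightarrow> 'a \<Rightarrow> 'a) \<Rightarrow> 'a::euclidean_space set \<Rightarrow> ('a \<Rightarrow> ereal) \<Rightarrow> bool" where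
  "neg_psh sc D u \<longleftrightarrow>
     (\<forall>x\<in>D. u x < 0) \<and>
     (\<forall>c::ereal. openin (top_of_set D) {x\<in>D. u x < c}) \<and>
     (\<forall>a b r. r > 0 \<longrightarrow> (\<forall>z. cmod z \<le> r \<longrightarrow> a + sc z b \<in> D) \<longrightarrow>
        (\<integral>\<^sup>+ t\<in>{0..2*pi}. e2ennreal (- u (a + sc (complex_of_real r * cis t) b)) \<partial>lborel)
          \<le> ennreal (2*pi) * e2ennreal (- u a))"

definition green :: "(complex \<Rightarrow> 'a \<Rightarrow> 'a) \<Rightarrow> 'a::euclidean_space set \<Rightarrow> 'a \<Rightarrow> 'a \<Rightarrow> ereal" where
  "green sc D p z = Sup {u z | u. neg_psh sc D u \<and>
      (\<exists>C::real. \<forall>\<^sub>F w in at p. u w \<le> ereal (ln (norm (w - p)) + C))}"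

section \<open>Generalized eigenspaces\<close>

definition gen_eigenspace :: "complex^'n^'n \<Rightarrow> complex \<Rightarrow> (complex^'n) set" where
  "gen_eigenspace V \<mu> = {x. mpow_apply (V - mat \<mu>) CARD('n) x = 0}"

text \<open>n(\<mu>) = dim_C ker (V - \<mu> I)^n\<close>
definition alg_mult :: "complex^'n^'n \<Rightarrow> complex \<Rightarrow> nat" where
  "alg_mult V \<mu> = vec.dim (gen_eigenspace V \<mu>)"

text \<open>m(\<mu>) = min{k : (V_\<mu> - \<mu> I)^k = 0}, V_\<mu> the restriction to the generalized eigenspace.\<close>
definition nil_index :: "complex^'n^'n \<Rightarrow> complex \<Rightarrow> nat" where
  "nil_index V \<mu> = (LEAST k. \<forall>x\<in>gen_eigenspace V \<mu>. mpow_apply (V - mat \<mu>) k x = 0)"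

end

theory Submission
  imports Defs "HOL-Complex_Analysis.Complex_Analysis" "HOL-Probability.Probability"
    "HOL-Computational_Algebra.Polynomial_Factorial"
    "HOL-Computational_Algebra.Fundamental_Theorem_Algebra"
    "HOL-Computational_Algebra.Field_as_Ring"
begin

text \<open>
  Pulling back along sigma always yields competitors on the spectral ball; this needs that a function
  which is subharmonic on complex lines is subharmonic along polynomial discs. Conversely, two
  matrices with the same characteristic polynomial are joined by affine complex lines inside their
  fibre, so by Liouville's theorem a negative plurisubharmonic function on the spectral ball is
  constant on the fibres. If V is cyclic, V = P C P^-1 with C the companion matrix of sigma(V), and
  s \<mapsto> P C(s) P^-1 is an affine section of sigma through V which turns competitors on the spectral
  ball into competitors on the symmetrized polydisk.

  If V is not cyclic, then its minimal polynomial has smaller degree than its characteristic polynomial,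
  so m < n for some eigenvalue. Triangularise V with this eigenvalue in the first n diagonal
  places and let X have the n-th roots of unity in these places. Then the characteristic
  polynomial moves by O(\<zeta>^n), and the Schwarz lemma gives the upper bound. For the lower bound
  let q(t) = (t - \<lambda>)^m g(t) annihilate V with g(\<lambda>) nonzero; the function log |tr q(M)^n| / n is plurisubharmonic with
  a logarithmic pole at V, and it is m log |\<zeta>| + O(1) at V + \<zeta> X.
\<close>

text \<open>Plurisubharmonicity is tested on affine discs only, while sigma turns an affine disc
  into a curve of degree up to n; a competitor is merely upper semicontinuous and may take the value
  -\<infinity>. Mean values are therefore compared for the real truncations max(u, -N), and
  continuity is gained by sup-convolution. The pole condition is silent at the pole itself. That a
  competitor equals -\<infinity> there must be derived, since sigma is not injective: matrices near
  V with sigma(M) = sigma(V) are seen by u only at the pole. The roots of unity serve twice. The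
  product of s - \<zeta> \<omega> over all n-th roots \<omega> is s^n - \<zeta>^n, so no lower power
  of \<zeta> enters the characteristic polynomial. In tr q(M)^n the exponent n turns each factor
  \<omega>^m into \<omega>^(mn) = 1, so the leading terms of the n summands agree instead of
  cancelling. A trace is chosen rather than a spectral radius because it is a polynomial on every
  complex line, where the logarithm of its modulus is subharmonic by an elementary argument.\<close>

lemma idx_enum_bij: "bij_betw idx_enum (UNIV::'n::finite set) {1..CARD('n)}"
proof -
  have "\<exists>f. bij_betw f (UNIV::'n set) {1..CARD('n)}"
    by (rule finite_same_card_bij) auto
  then show ?thesis
    unfolding idx_enum_def by (rule someI_ex)
qed

lemma idx_enum_inj: "inj idx_enum"
  using idx_enum_bij by (auto simp: bij_betw_def)

lemma idx_enum_range: "1 \<le> idx_enum i" "idx_enum (i::'n::finite) \<le> CARD('n)"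
  using bij_betwE[OF idx_enum_bij, of ] by auto

lemma idx_enum_surj:
  assumes "1 \<le> k" "k \<le> CARD('n)"
  obtains i :: "'n::finite" where "idx_enum i = k"
proof -
  have "k \<in> idx_enum ` (UNIV :: 'n set)"
    using bij_betw_imp_surj_on[OF idx_enum_bij] assms by auto
  then show ?thesis using that by auto
qed

lemma card_idx_enum_le:
  assumes "m \<le> CARD('n)"
  shows "card {i::'n::finite. idx_enum i \<le> m} = m"
proof -
  have "idx_enum ` {i::'n. idx_enum i \<le> m} = {1..m}"
  proof safe
    fix k assume "k \<in> {1..m}"
    then have "1 \<le> k" "k \<le> CARD('n)" using assms by auto
    then obtain i :: 'n where "idx_enum i = k"
      by (rule idx_enum_surj)
    then show "k \<in> idx_enum ` {i::'n. idx_enum i \<le> m}"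
      using \<open>k \<in> {1..m}\<close> by auto
  qed (use idx_enum_range in auto)
  moreover have "inj_on idx_enum {i::'n. idx_enum i \<le> m}"
    using idx_enum_inj by (meson inj_on_subset subset_UNIV)
  ultimately show ?thesis
    by (metis card_image card_atLeastAtMost diff_Suc_1)
qed

text \<open>The library version needs a well-ordered index type.\<close>
lemma det_triangular:
  fixes A :: "'a::comm_ring_1^'n^'n" and e :: "'n \<Rightarrow> nat"
  assumes e: "inj e" and A: "\<And>i j. e i > e j \<Longrightarrow> A$i$j = 0"
  shows "det A = (\<Prod>i\<in>UNIV. A$i$i)"
proof -
  have zero: "of_int (sign p) * (\<Prod>i\<in>UNIV. A$i$p i) = 0"
    if p: "p permutes (UNIV::'n set)" "p \<noteq> id" for p
  proof -
    \<comment> \<open>A permutation with \<open>e i \<le> e (p i)\<close> everywhere preserves the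
      sum of \<open>e\<close>, so all these inequalities are equalities and injectivity gives p =
      id. Every other p meets an entry below the diagonal.\<close>
    have "\<exists>i. e i > e (p i)"
    proof (rule ccontr)
      assume "\<nexists>i. e i > e (p i)"
      then have le: "\<And>i. e i \<le> e (p i)" by (simp add: not_less)
      have "(\<Sum>i\<in>UNIV. e (p i)) = (\<Sum>i\<in>UNIV. e i)"
        using sum.permute[OF p(1), of e] by (simp add: o_def)
      then have "e i = e (p i)" for i
        using sum_strict_mono_ex1[of UNIV e "\<lambda>i. e (p i)"] le
        by (metis UNIV_I finite less_irrefl_nat order_le_imp_less_or_eq)
      then show False
        using p(2) e by (metis injD eq_id_iff)
    qed
    then have "\<exists>i\<in>UNIV. A$i$p i = 0" using A by blast
    then have "(\<Prod>i\<in>UNIV. A$i$p i) = 0" by (intro prod_zero) auto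
    then show ?thesis by simp
  qed
  have "det A = (\<Sum>p\<in>{id}. of_int (sign p) * (\<Prod>i\<in>UNIV. A$i$p i))"
    unfolding det_def
    by (rule sum.mono_neutral_right) (use zero in \<open>auto simp: permutes_id finite_permutations\<close>)
  then show ?thesis by (simp add: sign_id)
qed

section \<open>Arithmetic of matrices and scalar matrices\<close>

lemma mat_mult_left: "mat c ** (A::complex^'n^'n) = mscale c A"
  by (simp add: vec_eq_iff matrix_matrix_mult_def mat_def mscale_def if_distrib if_distribR cong: if_cong)

lemma mat_mult_commute: "mat c ** (A::complex^'n^'n) = A ** mat c"
  by (simp add: vec_eq_iff matrix_matrix_mult_def mat_def mult.commute if_distrib if_distribR sum.delta cong: if_cong)

lemma mat_add: "(mat (a + b) :: 'a::comm_ring_1^'n^'n) = mat a + mat b"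
  by (simp add: vec_eq_iff mat_def)

lemma mat_mult: "(mat (a * b) :: complex^'n^'n) = mat a ** mat b"
  by (simp add: mat_mult_left) (simp add: vec_eq_iff mat_def mscale_def)

lemma mat_0: "(mat 0 :: 'a::zero^'n^'n) = 0"
  by (simp add: vec_eq_iff mat_def)

lemma mat_uminus: "(mat (- a) :: 'a::comm_ring_1^'n^'n) = - mat a"
  by (simp add: vec_eq_iff mat_def)

lemma mat_vec: "mat c *v (x::complex^'n) = c *s x"
  by (simp add: vec_eq_iff matrix_vector_mult_def mat_def if_distrib if_distribR sum.delta cong: if_cong)

lemma matrix_add_rdistrib: "((B + C) ** A) = (B ** A) + (C ** A)"
  by (simp add: vec_eq_iff matrix_matrix_mult_def algebra_simps sum.distrib)

lemma matrix_diff_ldistrib: "(A ** (B - C)) = (A ** B) - (A ** (C::complex^'n^'n))"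
  by (simp add: vec_eq_iff matrix_matrix_mult_def algebra_simps sum_subtractf)

lemma matrix_diff_rdistrib: "((B - C) ** A) = (B ** A) - (C ** (A::complex^'n^'n))"
  by (simp add: vec_eq_iff matrix_matrix_mult_def algebra_simps sum_subtractf)

lemma mult_zero_matrix [simp]: "(A::complex^'n^'n) ** 0 = 0" "0 ** A = 0"
  by (simp_all add: vec_eq_iff matrix_matrix_mult_def)

lemma mscale_mult: "mscale c A ** B = mscale c (A ** B)" "A ** mscale c B = mscale c (A ** B)"
  by (simp_all add: vec_eq_iff matrix_matrix_mult_def mscale_def sum_distrib_left mult_ac)

lemma mscale_1 [simp]: "mscale 1 A = (A :: complex^'n^'n)"
  by (simp add: mscale_def)

section \<open>Polynomials of matrices\<close>

text \<open>Horner evaluation of p at A with the matrix product; \<open>poly\<close> would use the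
  componentwise ring product of the type.\<close>

definition pm :: "complex^'n^'n \<Rightarrow> complex poly \<Rightarrow> complex^'n^'n" where
  "pm A p = fold_coeffs (\<lambda>a B. mat a + A ** B) p 0"

lemma pm_0 [simp]: "pm A 0 = 0"
  by (simp add: pm_def)

lemma pm_pCons [simp]: "pm A (pCons a p) = mat a + A ** pm A p"
proof (cases "p = 0 \<and> a = 0")
  case True
  then show ?thesis by (simp add: mat_def vec_eq_iff)
next
  case False
  then show ?thesis unfolding pm_def
    by (metis (no_types, lifting) comp_apply fold_coeffs_pCons_coeff_not_0_eq
        fold_coeffs_pCons_not_0_0_eq)
qed

lemma pm_add: "pm A (p + q) = pm A p + pm A q"
  by (induction p q rule: poly_induct2) (simp_all add: mat_add matrix_add_ldistrib algebra_simps)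

lemma pm_smult: "pm A (smult c p) = mat c ** pm A p"
proof (induction p)
  case (pCons a p)
  have "A ** (mat c ** pm A p) = mat c ** (A ** pm A p)"
    by (metis mat_mult_commute matrix_mul_assoc)
  with pCons show ?case by (simp add: mat_mult matrix_add_ldistrib)
qed simp

lemma pm_mult: "pm A (p * q) = pm A p ** pm A q"
proof (induction p)
  case (pCons a p)
  have "pm A (pCons a p * q) = mat a ** pm A q + A ** pm A (p * q)"
    using pm_pCons[of A 0 "p * q"] by (simp add: mult_pCons_left pm_add pm_smult mat_0)
  then show ?case using pCons by (simp add: matrix_add_rdistrib matrix_mul_assoc)
qed simp

lemma pm_1 [simp]: "pm A 1 = mat 1"
  by (simp add: one_pCons)

lemma pm_linear [simp]: "pm A [:- c, 1:] = A - mat c"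
  by (simp add: mat_uminus)

lemma pm_uminus: "pm A (- p) = - pm A p"
  by (metis add_eq_0_iff pm_0 pm_add right_minus)

lemma pm_diff: "pm A (p - q) = pm A p - pm A q"
  by (metis diff_conv_add_uminus pm_add pm_uminus)

lemma pm_mult_vec: "pm A (p * q) *v x = pm A p *v (pm A q *v x)"
  by (simp add: pm_mult matrix_vector_mul_assoc)

lemma pm_commute: "pm A p *v (pm A q *v x) = pm A q *v (pm A p *v x)"
  by (metis mult.commute pm_mult_vec)

lemma mpow_apply_0 [simp]: "mpow_apply A 0 x = x"
  by (simp add: mpow_apply_def)

lemma mpow_apply_Suc: "mpow_apply A (Suc k) x = A *v mpow_apply A k x"
  by (simp add: mpow_apply_def)

text \<open>Moves generalized eigenspaces and nilpotency indices into the calculus of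
  \<open>pm\<close>, where factors commute and divisibility arguments apply.\<close>

lemma mpow_apply_shift: "mpow_apply (V - mat \<mu>) k x = pm V ([:- \<mu>, 1:] ^ k) *v x"
proof (induction k)
  case (Suc k)
  have "pm V ([:- \<mu>, 1:] ^ Suc k) *v x = (V - mat \<mu>) *v (pm V ([:- \<mu>, 1:] ^ k) *v x)"
    by (metis pm_linear pm_mult_vec power_Suc)
  then show ?case using Suc by (simp only: mpow_apply_Suc)
qed simp

lemma mpow_apply_pm: "mpow_apply A k x = pm A (monom 1 k) *v x"
proof -
  have "A - mat 0 = A" by (simp add: mat_def vec_eq_iff)
  then show ?thesis
    using mpow_apply_shift[of A 0 k x] by (simp add: monom_altdef)
qed

lemma pm_sum: "pm A (\<Sum>i\<in>I. f i) = (\<Sum>i\<in>I. pm A (f i))"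
  by (induction I rule: infinite_finite_induct) (simp_all add: pm_add)

lemma sum_matrix_vec: "(\<Sum>i\<in>I. F i) *v x = (\<Sum>i\<in>I. (F i :: complex^'n^'n) *v x)"
  by (induction I rule: infinite_finite_induct) (simp_all add: matrix_vector_mult_add_rdistrib)

lemma pm_vec_sum:
  assumes "degree p \<le> n"
  shows "pm A p *v x = (\<Sum>k\<le>n. coeff p k *s mpow_apply A k x)"
proof -
  have "p = (\<Sum>k\<le>n. smult (coeff p k) (monom 1 k))"
    unfolding smult_monom mult_1_right by (rule poly_as_sum_of_monoms'[OF assms, symmetric])
  then have "pm A p = pm A (\<Sum>k\<le>n. smult (coeff p k) (monom 1 k))"
    by (rule arg_cong)
  also have "\<dots> = (\<Sum>k\<le>n. mat (coeff p k) ** pm A (monom 1 k))"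
    unfolding pm_sum pm_smult ..
  finally show ?thesis
    by (simp only: sum_matrix_vec mpow_apply_pm mat_vec matrix_vector_mul_assoc[symmetric])
qed

lemma similar_mat:
  fixes P Q :: "complex^'n^'n"
  assumes "P ** Q = mat 1"
  shows "P ** mat a ** Q = mat a"
proof -
  have "P ** mat a ** Q = mat a ** (P ** Q)"
    by (simp only: mat_mult_commute[of a P, symmetric] matrix_mul_assoc)
  then show ?thesis using assms by simp
qed

lemma similar_cancel:
  fixes P Q :: "complex^'n^'n"
  assumes "Q ** P = mat 1"
  shows "P ** A ** Q ** (P ** B ** Q) = P ** (A ** B) ** Q"
proof -
  have "P ** A ** Q ** (P ** B ** Q) = P ** A ** (Q ** P) ** B ** Q"
    by (simp only: matrix_mul_assoc)
  then show ?thesis using assms by (simp add: matrix_mul_assoc)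
qed

lemma pm_similar:
  fixes P Q :: "complex^'n^'n"
  assumes "Q ** P = mat 1" "P ** Q = mat 1"
  shows "pm (P ** A ** Q) p = P ** pm A p ** Q"
proof (induction p)
  case (pCons a p)
  show ?case
    using pCons similar_mat[OF assms(2), of a] similar_cancel[OF assms(1), of A "pm A p"]
    by (simp add: matrix_add_ldistrib matrix_add_rdistrib)
qed simp

section \<open>The characteristic polynomial\<close>

lemma poly_det: "poly (det (M :: 'a::comm_ring_1 poly^'n^'n)) t = det (\<chi> i j. poly (M$i$j) t)"
  by (simp add: det_def poly_sum poly_prod)

lemma poly_charpoly: "poly (charpoly A) t = det (mat t - A)"
  unfolding charpoly_def poly_det
  by (rule arg_cong[of _ _ det]) (auto simp: vec_eq_iff mat_def)

lemma is_eigenvalue_iff: "is_eigenvalue A \<mu> \<longleftrightarrow> poly (charpoly A) \<mu> = 0"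
  by (simp add: is_eigenvalue_def poly_charpoly)

lemma charpoly_similar:
  fixes P Q :: "complex^'n^'n"
  assumes "Q ** P = mat 1" "P ** Q = mat 1"
  shows "charpoly (P ** A ** Q) = charpoly A"
proof -
  have "poly (charpoly (P ** A ** Q)) t = poly (charpoly A) t" for t
  proof -
    have "mat t - P ** A ** Q = P ** (mat t - A) ** Q"
      using similar_mat[OF assms(2), of t] by (simp add: matrix_diff_ldistrib matrix_diff_rdistrib)
    moreover have "det P * det Q = 1"
      by (metis assms(2) det_I det_mul)
    ultimately show ?thesis by (simp add: poly_charpoly det_mul)
  qed
  then show ?thesis by (simp add: poly_eq_poly_eq_iff[symmetric] fun_eq_iff)
qed

lemma charpoly_triangular:
  fixes e :: "'n::finite \<Rightarrow> nat"
  assumes e: "inj e" and A: "\<And>i j. e i > e j \<Longrightarrow> A$i$j = 0"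
  shows "charpoly A = (\<Prod>i\<in>UNIV. [:- A$i$i, 1:])"
proof -
  have "poly (charpoly A) t = poly (\<Prod>i\<in>UNIV. [:- A$i$i, 1:]) t" for t
    unfolding poly_charpoly
    by (subst det_triangular[OF e]) (auto simp: A mat_def poly_prod)
  then show ?thesis by (simp add: poly_eq_poly_eq_iff[symmetric] fun_eq_iff)
qed

section \<open>Triangularisation\<close>

lemma vec_dim_le: "vec.dim (S :: (complex^'n) set) \<le> CARD('n)"
  using vec.dim_subset[of S UNIV] by (simp only: vec_dim_card subset_UNIV)

lemma mat_vec_span_invariant:
  assumes "\<And>x. x \<in> B \<Longrightarrow> A *v x \<in> vec.span B" "x \<in> vec.span B"
  shows "(A::complex^'n^'n) *v x \<in> vec.span B"
  using assms(2)
proof (induction rule: vec.span_induct_alt)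
  case base
  then show ?case by (simp add: vec.span_zero)
next
  case (step c y z)
  then show ?case
    by (simp add: matrix_vector_right_distrib vec.scale vector_scalar_commute vec.span_add vec.span_scale assms(1))
qed

text \<open>Split p into linear factors and apply them to x one after the other: the last vector
  still outside S is an eigenvector modulo S, and its eigenvalue is a root of p. The form
  \<open>b = pm A r *v x\<close> keeps b inside every invariant subspace that contains x.\<close>

lemma invariant_extension:
  assumes S: "vec.subspace S" "\<And>x. x \<in> S \<Longrightarrow> A *v x \<in> S"
    and "x \<notin> S" "p \<noteq> 0" "pm A p *v x \<in> S"
  obtains b \<mu> r where "b \<notin> S" "A *v b - \<mu> *s b \<in> S" "b = pm A r *v x" "poly p \<mu> = 0"
proof -
  have "\<exists>b \<mu> r. b \<notin> S \<and> A *v b - \<mu> *s b \<in> S \<and> b = pm A r *v x \<and> poly p \<mu> = 0"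
    using assms(4,5)
  proof (induction "degree p" arbitrary: p rule: less_induct)
    case less
    show ?case
    proof (cases "degree p = 0")
      case True
      then obtain c where c: "p = [:c:]" by (auto elim: degree_eq_zeroE)
      then have "c \<noteq> 0" "c *s x \<in> S"
        using less.prems by (auto simp: mat_vec)
      then have "inverse c *s (c *s x) \<in> S"
        using S(1) by (simp only: vec.subspace_scale)
      then show ?thesis using \<open>c \<noteq> 0\<close> \<open>x \<notin> S\<close> by (simp add: vec.scale_scale)
    next
      case False
      then obtain \<mu> where \<mu>: "poly p \<mu> = 0"
        using fundamental_theorem_of_algebra constant_degree by metis
      then obtain q where q: "p = [:- \<mu>, 1:] * q"
        by (auto simp: poly_eq_0_iff_dvd)
      have [simp]: "q \<noteq> 0" using q less.prems by auto
      show ?thesis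
      proof (cases "pm A q *v x \<in> S")
        case True
        have "degree q < degree p" unfolding q by (subst degree_mult_eq) auto
        from less.hyps[OF this _ True] show ?thesis unfolding q by auto
      next
        case False
        have "A *v (pm A q *v x) - \<mu> *s (pm A q *v x) \<in> S"
          using less.prems(2) unfolding q pm_mult_vec pm_linear
          by (simp add: matrix_vector_mult_diff_rdistrib mat_vec)
        then show ?thesis using False \<mu> by blast
      qed
    qed
  qed
  then show ?thesis using that by blast
qed

text \<open>The n + 1 iterates of x are linearly dependent. Dependence is a property of sets, so the
  case of two equal iterates is treated apart, with a difference of two monomials.\<close>

lemma exists_vector_annihilator:
  fixes A :: "complex^'n^'n"
  obtains p where "p \<noteq> 0" "pm A p *v x = 0"
proof (cases "inj_on (\<lambda>k. mpow_apply A k x) {..CARD('n)}")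
  case False
  then obtain i j where ij: "i \<noteq> j" "mpow_apply A i x = mpow_apply A j x"
    by (auto simp: inj_on_def)
  then have "pm A (monom 1 i - monom 1 j) *v x = 0"
    by (simp add: pm_diff matrix_vector_mult_diff_rdistrib mpow_apply_pm)
  moreover have "(monom 1 i - monom 1 j :: complex poly) \<noteq> 0"
    using ij(1) by (auto simp: monom_eq_iff')
  ultimately show ?thesis using that by blast
next
  case True
  let ?T = "(\<lambda>k. mpow_apply A k x) ` {..CARD('n)}"
  have "card ?T = CARD('n) + 1"
    using card_image[OF True] by simp
  then have "vec.dependent ?T"
    using vec.dim_eq_card_independent[of ?T] vec_dim_le[of ?T] by auto
  then obtain u where u: "(\<Sum>v\<in>?T. u v *s v) = 0" "\<exists>v\<in>?T. u v \<noteq> 0"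
    by (subst (asm) vec.dependent_finite) auto
  define p where "p = (\<Sum>k\<le>CARD('n). monom (u (mpow_apply A k x)) k)"
  have c: "coeff p k = (if k \<le> CARD('n) then u (mpow_apply A k x) else 0)" for k
    by (auto simp: p_def coeff_sum)
  have "degree p \<le> CARD('n)"
    by (rule degree_le) (simp add: c)
  then have "pm A p *v x = (\<Sum>v\<in>?T. u v *s v)"
    by (simp add: pm_vec_sum c sum.reindex[OF True])
  moreover from u(2) obtain k where "k \<le> CARD('n)" "u (mpow_apply A k x) \<noteq> 0" by auto
  then have "p \<noteq> 0" using c[of k] by auto
  ultimately show ?thesis using that u(1) by auto
qed

lemma subspace_ker_mat: "vec.subspace {x. (A::complex^'n^'n) *v x = 0}"
  by (auto simp: vec.subspace_def matrix_vector_right_distrib vector_scalar_commute)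

lemma gen_eigenspace_alt:
  "gen_eigenspace V \<mu> = {x. pm V ([:- \<mu>, 1:] ^ CARD('n)) *v x = 0}" for V :: "complex^'n^'n"
  by (simp add: gen_eigenspace_def mpow_apply_shift)

lemma gen_eigenspace_subspace: "vec.subspace (gen_eigenspace V \<mu>)"
  unfolding gen_eigenspace_alt by (rule subspace_ker_mat)

lemma gen_eigenspace_pm:
  "x \<in> gen_eigenspace V \<mu> \<Longrightarrow> pm V p *v x \<in> gen_eigenspace V \<mu>"
  unfolding gen_eigenspace_alt mem_Collect_eq by (subst pm_commute) simp

lemma alg_mult_le: "alg_mult (V::complex^'n^'n) \<mu> \<le> CARD('n)"
  unfolding alg_mult_def by (rule vec_dim_le)

text \<open>The flag exhausts the generalized eigenspace first. As long as k is below its dimension,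
  it contains a vector outside the current span; \<open>invariant_extension\<close> stays inside it,
  and \<mu> is the only root of (t - \<mu>)^n, hence the diagonal entry. Afterwards any vector
  outside the span will do.\<close>

lemma exists_adapted_flag:
  fixes V :: "complex^'n^'n"
  assumes "k \<le> CARD('n)"
  shows "\<exists>b d. inj_on b {..<k} \<and> vec.independent (b ` {..<k}) \<and>
    (\<forall>i<k. V *v b i - d i *s b i \<in> vec.span (b ` {..<i}) \<and>
       (i < alg_mult V \<mu> \<longrightarrow> b i \<in> gen_eigenspace V \<mu> \<and> d i = \<mu>))"
  using assms
proof (induction k)
  case 0
  then show ?case by (simp add: vec.independent_empty)
next
  case (Suc k)
  then obtain b d where bd: "inj_on b {..<k}" "vec.independent (b ` {..<k})"
    "\<And>i. i < k \<Longrightarrow> V *v b i - d i *s b i \<in> vec.span (b ` {..<i})"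
    "\<And>i. i < k \<Longrightarrow> i < alg_mult V \<mu> \<Longrightarrow> b i \<in> gen_eigenspace V \<mu> \<and> d i = \<mu>"
    by auto
  let ?S = "vec.span (b ` {..<k})"
  have dimS: "vec.dim ?S = k"
    using bd(1,2) vec.dim_span_eq_card_independent[of "b ` {..<k}"] by (simp add: card_image)
  have inv: "V *v x \<in> ?S" if "x \<in> ?S" for x
  proof (rule mat_vec_span_invariant[OF _ that])
    fix y assume "y \<in> b ` {..<k}"
    then obtain i where i: "i < k" "y = b i" by auto
    have "V *v b i - d i *s b i \<in> ?S"
      using bd(3)[OF i(1)] vec.span_mono[of "b ` {..<i}" "b ` {..<k}"] i(1) by force
    moreover have "d i *s b i \<in> ?S"
      using i(1) by (intro vec.span_scale vec.span_base) auto
    ultimately have "(V *v b i - d i *s b i) + d i *s b i \<in> ?S"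
      by (rule vec.span_add)
    then show "V *v y \<in> ?S" using i(2) by simp
  qed
  have "\<exists>b' \<mu>'. b' \<notin> ?S \<and> V *v b' - \<mu>' *s b' \<in> ?S \<and>
      (k < alg_mult V \<mu> \<longrightarrow> b' \<in> gen_eigenspace V \<mu> \<and> \<mu>' = \<mu>)"
  proof (cases "k < alg_mult V \<mu>")
    case True
    then have "\<not> gen_eigenspace V \<mu> \<subseteq> ?S"
      using vec.dim_subset[of "gen_eigenspace V \<mu>" ?S] dimS by (auto simp: alg_mult_def)
    then obtain x where x: "x \<in> gen_eigenspace V \<mu>" "x \<notin> ?S" by auto
    have z: "pm V ([:- \<mu>, 1:] ^ CARD('n)) *v x \<in> ?S"
      using x(1) by (simp add: gen_eigenspace_alt vec.span_zero)
    have nz: "[:- \<mu>, 1:] ^ CARD('n) \<noteq> 0" by simp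
    obtain b' \<mu>' r where "b' \<notin> ?S" "V *v b' - \<mu>' *s b' \<in> ?S" "b' = pm V r *v x"
      "poly ([:- \<mu>, 1:] ^ CARD('n)) \<mu>' = 0"
      using invariant_extension[OF vec.subspace_span inv x(2) nz z] by blast
    then show ?thesis using gen_eigenspace_pm[OF x(1)] by auto
  next
    case False
    have "?S \<noteq> UNIV"
      using dimS Suc.prems by (metis vec_dim_card Suc_n_not_le_n)
    then obtain x where x: "x \<notin> ?S" by auto
    obtain p where p: "p \<noteq> 0" "pm V p *v x = 0" by (rule exists_vector_annihilator)
    then have z: "pm V p *v x \<in> ?S" by (simp add: vec.span_zero)
    show ?thesis
      using invariant_extension[OF vec.subspace_span inv x p(1) z] False by metis
  qed
  then obtain b' \<mu>' where b': "b' \<notin> ?S" "V *v b' - \<mu>' *s b' \<in> ?S"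
      "k < alg_mult V \<mu> \<longrightarrow> b' \<in> gen_eigenspace V \<mu> \<and> \<mu>' = \<mu>" by blast
  have im: "(b(k := b')) ` {..<i} = b ` {..<i}" if "i \<le> k" for i
    using that by (auto simp: image_def)
  have imS: "(b(k := b')) ` {..<Suc k} = insert b' (b ` {..<k})"
    by (auto simp: image_def less_Suc_eq)
  have "b' \<notin> b ` {..<k}" using b'(1) vec.span_base[of b' "b ` {..<k}"] by argo
  moreover have "inj_on (b(k := b')) {..<k}"
    using bd(1) by (rule inj_on_cong[THEN iffD1, rotated]) auto
  ultimately have "inj_on (b(k := b')) {..<Suc k}"
    using im[of k] by (simp add: lessThan_Suc)
  moreover have "vec.independent ((b(k := b')) ` {..<Suc k})"
    unfolding imS by (rule vec.independent_insertI[OF b'(1) bd(2)])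
  moreover have "V *v (b(k := b')) i - (d(k := \<mu>')) i *s (b(k := b')) i \<in> vec.span ((b(k := b')) ` {..<i}) \<and>
       (i < alg_mult V \<mu> \<longrightarrow> (b(k := b')) i \<in> gen_eigenspace V \<mu> \<and> (d(k := \<mu>')) i = \<mu>)"
    if "i < Suc k" for i
  proof (cases "i = k")
    case True
    then show ?thesis using b'(2,3) im[of k] by simp
  next
    case False
    then have "i < k" using that by simp
    then show ?thesis using bd(3,4)[of i] False im[of i] by simp
  qed
  ultimately show ?case
    by (intro exI[of _ "b(k := b')"] exI[of _ "d(k := \<mu>')"] conjI allI impI)
       (simp_all del: fun_upd_apply)
qed

lemma matrix_of_basis:
  fixes c :: "'n::finite \<Rightarrow> complex^'n"
  assumes "inj c" "vec.independent (range c)"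
  obtains P Q where "P ** Q = mat 1" "Q ** P = mat 1" "\<And>j. P *v axis j 1 = c j"
proof -
  define P :: "complex^'n^'n" where "P = (\<chi> i j. c j $ i)"
  have col: "P *v x = (\<Sum>j\<in>UNIV. x$j *s c j)" for x
    by (simp add: vec_eq_iff P_def matrix_vector_mult_def mult.commute)
  have "x = 0" if "P *v x = 0" for x
  proof -
    have "(\<Sum>v\<in>range c. x $ (inv c v) *s v) = 0"
      using that by (simp add: col sum.reindex assms(1))
    then have "x $ (inv c v) = 0" if "v \<in> range c" for v
      using that assms(2) vec.independentD[of "range c" "range c" "\<lambda>v. x $ (inv c v)" v] by auto
    then show ?thesis by (metis (no_types, opaque_lifting) assms(1) inv_f_f rangeI vec_eq_iff zero_index)
  qed
  then obtain Q where Q: "Q ** P = mat 1"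
    by (meson matrix_left_invertible_ker)
  then have "P ** Q = mat 1" by (simp add: matrix_left_right_inverse)
  moreover have "P *v axis j 1 = c j" for j
    by (simp add: col axis_def if_distrib if_distribR sum.delta cong: if_cong)
  ultimately show ?thesis using that Q by blast
qed

lemma mat_vec_axis: "(A *v axis j 1) $ i = (A::complex^'n^'n) $ i $ j"
  by (simp add: matrix_vector_mult_def axis_def if_distrib if_distribR sum.delta cong: if_cong)

text \<open>The adapted flag read as a change of basis. Having \<mu> in the first positions later
  allows exactly these diagonal entries to be perturbed.\<close>

theorem triangularisation:
  fixes V :: "complex^'n^'n"
  obtains P Q T :: "complex^'n^'n" where "P ** Q = mat 1" "Q ** P = mat 1" "V = P ** T ** Q"
    "\<And>i j. idx_enum i > idx_enum j \<Longrightarrow> T$i$j = 0"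
    "\<And>j. idx_enum j \<le> alg_mult V \<mu> \<Longrightarrow> T$j$j = \<mu>"
proof -
  obtain b d where bd: "inj_on b {..<CARD('n)}" "vec.independent (b ` {..<CARD('n)})"
    "\<And>i. i < CARD('n) \<Longrightarrow> V *v b i - d i *s b i \<in> vec.span (b ` {..<i})"
    "\<And>i. i < CARD('n) \<Longrightarrow> i < alg_mult V \<mu> \<Longrightarrow> d i = \<mu>"
    using exists_adapted_flag[of "CARD('n)" V \<mu>] by auto
  \<comment> \<open>The flag is numbered from 0, \<open>idx_enum\<close> from 1.\<close>
  define f where "f j = idx_enum j - 1" for j :: 'n
  have f_less: "f j < CARD('n)" for j
    using idx_enum_range[of j] by (simp add: f_def)
  have f_mono: "f i < f j \<longleftrightarrow> idx_enum i < idx_enum j" for i j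
    using idx_enum_range(1)[of i] idx_enum_range(1)[of j] by (auto simp: f_def)
  have f_inj: "f i = f j \<Longrightarrow> i = j" for i j
    using f_mono[of i j] f_mono[of j i] idx_enum_inj by (metis injD less_irrefl linorder_neqE_nat)
  have f_surj: "\<exists>j. f j = k" if "k < CARD('n)" for k
    using idx_enum_surj[of "Suc k"] that unfolding f_def
    by (metis Suc_leI diff_Suc_1 le_add1 plus_1_eq_Suc)
  define c where "c j = b (f j)" for j
  have rc: "range c = b ` {..<CARD('n)}"
    unfolding c_def using f_less f_surj by (auto simp: image_def)
  have "inj c"
    unfolding c_def using bd(1) f_less f_inj by (auto intro!: injI dest: inj_onD)
  then obtain P Q where PQ: "P ** Q = mat 1" "Q ** P = mat 1" "\<And>j. P *v axis j 1 = c j"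
    using matrix_of_basis[of c] bd(2) rc by metis
  have Qc: "Q *v c j = axis j 1" for j
    by (metis PQ(2,3) matrix_vector_mul_assoc matrix_vector_mul_lid)
  define T where "T = Q ** V ** P"
  have V: "V = P ** T ** Q"
    unfolding T_def by (metis PQ(1) matrix_mul_assoc matrix_mul_lid matrix_mul_rid)
  have Qspan: "(Q *v x) $ i = 0" if "x \<in> vec.span (b ` {..<f j})" "f i \<ge> f j" for x i j
    using that(1)
  proof (induction rule: vec.span_induct_alt)
    case base
    then show ?case by simp
  next
    case (step a y z)
    then obtain k where k: "k < f j" "y = b k" by auto
    then obtain l where l: "f l = k" using f_surj f_less[of j] by (meson less_trans)
    then have "Q *v y = axis l 1" using Qc[of l] k by (simp add: c_def)
    moreover have "l \<noteq> i" using l k that(2) by auto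
    ultimately show ?case using step
      by (simp add: matrix_vector_right_distrib vector_scalar_commute axis_def)
  qed
  have T: "T $ i $ j = (if i = j then d (f j) else 0)" if "f i \<ge> f j" for i j
  proof -
    have "T *v axis j 1 = Q *v (V *v c j)"
      by (simp add: T_def PQ(3) flip: matrix_vector_mul_assoc)
    also have "V *v c j = (V *v c j - d (f j) *s c j) + d (f j) *s c j" by simp
    finally have "T *v axis j 1 = Q *v (V *v c j - d (f j) *s c j) + d (f j) *s axis j 1"
      by (metis Qc matrix_vector_right_distrib vector_scalar_commute)
    then have "T $ i $ j = (Q *v (V *v c j - d (f j) *s c j)) $ i + d (f j) * axis j 1 $ i"
      by (metis mat_vec_axis vector_add_component vector_smult_component)
    also have "(Q *v (V *v c j - d (f j) *s c j)) $ i = 0"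
      using Qspan[OF _ that] bd(3)[OF f_less[of j]] by (simp add: c_def)
    finally show ?thesis by (simp add: axis_def)
  qed
  show ?thesis
  proof (rule that[OF PQ(1,2) V])
    show "T $ i $ j = 0" if "idx_enum i > idx_enum j" for i j
      using T[of j i] f_mono[of j i] that by auto
    show "T $ j $ j = \<mu>" if "idx_enum j \<le> alg_mult V \<mu>" for j
      using T[of j j] bd(4)[OF f_less[of j]] that idx_enum_range(1)[of j] by (auto simp: f_def)
  qed
qed

lemma charpoly_triangular_idx:
  fixes T :: "complex^'n^'n"
  assumes "\<And>i j. idx_enum i > idx_enum j \<Longrightarrow> T$i$j = 0"
  shows "charpoly T = (\<Prod>i\<in>UNIV. [:- T$i$i, 1:])"
  using charpoly_triangular[OF idx_enum_inj] assms by blast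

lemma charpoly_monic: "degree (charpoly (V::complex^'n^'n)) = CARD('n)" "lead_coeff (charpoly V) = 1"
proof -
  obtain P Q T :: "complex^'n^'n" where *: "P ** Q = mat 1" "Q ** P = mat 1" "V = P ** T ** Q"
    "\<And>i j. idx_enum i > idx_enum j \<Longrightarrow> T$i$j = 0"
    by (rule triangularisation[of V 0]) (rule that)
  have V: "charpoly V = (\<Prod>i\<in>UNIV. [:- T$i$i, 1:])"
    unfolding *(3) charpoly_similar[OF *(2,1)] by (rule charpoly_triangular_idx) (rule *(4))
  show "degree (charpoly V) = CARD('n)"
    unfolding V by (subst degree_prod_sum_eq) auto
  show "lead_coeff (charpoly V) = 1"
    unfolding V by (simp add: lead_coeff_prod)
qed

lemma charpoly_nz [simp]: "charpoly V \<noteq> 0"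
  using charpoly_monic(2)[of V] by auto

text \<open>For triangular T, the factor belonging to diagonal position k + 1 maps vectors supported
  on the first k + 1 coordinates to vectors supported on the first k. Applying the factors from the
  last position to the first thus annihilates everything.\<close>

theorem Cayley_Hamilton: "pm (V::complex^'n^'n) (charpoly V) = 0"
proof -
  obtain P Q T :: "complex^'n^'n" where *: "P ** Q = mat 1" "Q ** P = mat 1" "V = P ** T ** Q"
    and T: "\<And>i j. idx_enum i > idx_enum j \<Longrightarrow> T$i$j = 0"
    by (rule triangularisation[of V 0]) (rule that)
  have V: "charpoly V = (\<Prod>i\<in>UNIV. [:- T$i$i, 1:])"
    unfolding *(3) charpoly_similar[OF *(2,1)] by (rule charpoly_triangular_idx) (rule T)
  have kill: "pm T (\<Prod>i\<in>{i. idx_enum i \<le> k}. [:- T$i$i, 1:]) *v x = 0"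
    if "k \<le> CARD('n)" "\<And>i. idx_enum i > k \<Longrightarrow> x$i = 0" for k x
    using that
  proof (induction k arbitrary: x)
    case 0
    then have "x = 0" using idx_enum_range(1) by (auto simp: vec_eq_iff Suc_le_eq)
    then show ?case by simp
  next
    case (Suc k)
    have "1 \<le> Suc k" "Suc k \<le> CARD('n)" using Suc.prems by auto
    then obtain l :: 'n where l: "idx_enum l = Suc k" by (rule idx_enum_surj)
    have "idx_enum i = Suc k \<longleftrightarrow> i = l" for i
      using inj_eq[OF idx_enum_inj, of i l] l by simp
    then have set: "{i::'n. idx_enum i \<le> Suc k} = insert l {i. idx_enum i \<le> k}"
      by (auto simp: le_Suc_eq)
    have y: "((T - mat (T$l$l)) *v x) $ i = 0" if "idx_enum i > k" for i
    proof -
      have "T$i$j * x$j = (if j = i then T$i$i * x$i else 0)" for j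
      proof (cases "idx_enum j" "idx_enum i" rule: linorder_cases)
        case greater
        then show ?thesis using Suc.prems(2)[of j] that by auto
      qed (use T[of j i] idx_enum_inj in \<open>auto dest: injD\<close>)
      then have "(T *v x) $ i = (\<Sum>j\<in>UNIV. if j = i then T$i$i * x$i else 0)"
        unfolding matrix_vector_mult_def vec_lambda_beta by (rule sum.cong[OF refl])
      then have "(T *v x) $ i = T$i$i * x$i" by simp
      moreover have "i = l \<or> x$i = 0"
        using that l Suc.prems(2)[of i] injD[OF idx_enum_inj, of i l] by (cases "idx_enum i = Suc k") auto
      ultimately show ?thesis
        by (auto simp: matrix_vector_mult_diff_rdistrib mat_vec)
    qed
    have "pm T (\<Prod>i\<in>{i. idx_enum i \<le> Suc k}. [:- T$i$i, 1:]) *v x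
        = pm T (\<Prod>i\<in>{i. idx_enum i \<le> k}. [:- T$i$i, 1:]) *v ((T - mat (T$l$l)) *v x)"
      unfolding set using l
      by (subst prod.insert) (simp_all only: finite mem_Collect_eq l Suc_n_not_le_n not_False_eq_True
          mult.commute[of "[:- T$l$l, 1:]"] pm_mult_vec pm_linear)
    then show ?case using Suc.IH[OF _ y] Suc.prems(1) by simp
  qed
  have "{i::'n. idx_enum i \<le> CARD('n)} = UNIV"
    using idx_enum_range(2) by auto
  moreover have "\<not> idx_enum i > CARD('n)" for i :: 'n
    using idx_enum_range(2)[of i] by simp
  ultimately have "pm T (charpoly V) *v x = 0" for x
    using kill[of "CARD('n)" x] unfolding V by simp
  then have "pm T (charpoly V) = 0" by (simp add: matrix_eq)
  then show ?thesis using pm_similar[OF *(2,1), of T "charpoly V"] *(3) by simp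
qed

section \<open>The spectral ball\<close>

lemma spectral_ball_iff: "A \<in> spectral_ball \<longleftrightarrow> (\<forall>\<mu>. poly (charpoly A) \<mu> = 0 \<longrightarrow> cmod \<mu> < 1)"
  for A :: "complex^'n^'n"
proof -
  have fin: "finite {\<mu>. poly (charpoly A) \<mu> = 0}"
    by (rule poly_roots_finite) simp
  \<comment> \<open>\<open>Max\<close> is meaningful only on a nonempty set, so the existence of an
    eigenvalue is required.\<close>
  have "\<not> constant (poly (charpoly A))"
    using charpoly_monic(1)[of A] by (simp add: constant_degree)
  then obtain \<mu> where "poly (charpoly A) \<mu> = 0"
    using fundamental_theorem_of_algebra by blast
  then have ne: "{\<mu>. poly (charpoly A) \<mu> = 0} \<noteq> {}" by auto
  show ?thesis
    unfolding spectral_ball_def spectral_radius_def is_eigenvalue_iff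
    using fin ne by (auto simp: Max_less_iff)
qed

lemma spectral_ball_cong: "charpoly A = charpoly B \<Longrightarrow> A \<in> spectral_ball \<longleftrightarrow> B \<in> spectral_ball"
  by (simp add: spectral_ball_iff)

section \<open>Polynomials in triangular matrices and their traces\<close>

lemma pm_triangular:
  fixes T :: "complex^'n^'n"
  assumes T: "\<And>i j. idx_enum i > idx_enum j \<Longrightarrow> T$i$j = 0"
  shows "(idx_enum i > idx_enum j \<longrightarrow> pm T p $i$j = 0) \<and> pm T p $i$i = poly p (T$i$i)"
proof (induction p arbitrary: i j)
  case (pCons a p)
  have z: "T$i$k * pm T p $k$j = 0" if "idx_enum i > idx_enum j" for k
  proof (cases "idx_enum i > idx_enum k")
    case False
    then have "idx_enum k > idx_enum j" using that by simp
    then show ?thesis using pCons(2)[where i=k and j=j] by simp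
  qed (use T[of k i] in simp)
  have d: "T$i$k * pm T p $k$i = (if k = i then T$i$i * poly p (T$i$i) else 0)" for k
    using T[of k i] pCons(2)[where i=k and j=i] injD[OF idx_enum_inj, of k i]
    by (cases "idx_enum k" "idx_enum i" rule: linorder_cases) auto
  show ?case
  proof (intro conjI impI)
    assume "idx_enum j < idx_enum i"
    then show "pm T (pCons a p) $ i $ j = 0"
      using z by (auto simp: matrix_matrix_mult_def mat_def intro!: sum.neutral)
  qed (simp add: matrix_matrix_mult_def mat_def d)
qed simp

lemma trace_similar:
  fixes P Q A :: "complex^'n^'n"
  assumes "Q ** P = mat 1"
  shows "trace (P ** A ** Q) = trace A"
  using trace_mul_sym[of "P ** A" Q] assms by (simp add: matrix_mul_assoc)

lemma trace_pm:
  fixes P Q T :: "complex^'n^'n"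
  assumes "P ** Q = mat 1" "Q ** P = mat 1"
    "\<And>i j. idx_enum i > idx_enum j \<Longrightarrow> T$i$j = 0"
  shows "trace (pm (P ** T ** Q) p) = (\<Sum>i\<in>UNIV. poly p (T$i$i))"
  using assms pm_triangular[of T] by (simp add: pm_similar trace_similar) (simp add: trace_def)

section \<open>Non-derogatory matrices\<close>

text \<open>Primary decomposition by Bezout. From a f + b g = 1 the vector x splits into (a f) x,
  which g kills, so that the induction hypothesis applies, and (b g) x, which f kills, so that it
  lies in the generalized eigenspace of the new root.\<close>

lemma gen_eigenspace_coprime_sum:
  fixes V :: "complex^'n^'n"
  assumes "finite S" "pm V (\<Prod>\<mu>\<in>S. [:- \<mu>, 1:] ^ CARD('n)) *v x = 0"
  shows "x \<in> vec.span (\<Union>\<mu>\<in>S. gen_eigenspace V \<mu>)"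
  using assms
proof (induction S arbitrary: x rule: finite_induct)
  case empty
  then show ?case by (simp add: vec.span_zero)
next
  case (insert \<mu> S)
  let ?f = "[:- \<mu>, 1:] ^ CARD('n)" and ?g = "\<Prod>\<mu>\<in>S. [:- \<mu>, 1:] ^ CARD('n)"
  have cop: "coprime [:- \<mu>, 1:] [:- \<nu>, 1:]" if "\<nu> \<in> S" for \<nu>
  proof (rule coprimeI)
    fix c assume c: "c dvd [:- \<mu>, 1:]" "c dvd [:- \<nu>, 1:]"
    then have "c dvd [:- \<mu>, 1:] - [:- \<nu>, 1:]" by (rule dvd_diff)
    then have "c dvd [:\<nu> - \<mu>:]" by simp
    moreover have "\<nu> - \<mu> \<noteq> 0" using that insert.hyps by auto
    then have "is_unit [:\<nu> - \<mu>:]" by (simp add: is_unit_triv)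
    ultimately show "is_unit c" by (rule dvd_trans)
  qed
  have "coprime ?f ?g"
    by (rule prod_coprime_right) (simp add: cop)

  then obtain a b where ab: "a * ?f + b * ?g = 1"
    using bezout_coefficients_fst_snd[of ?f ?g] by (metis coprime_iff_gcd_eq_1)
  have "x = pm V (a * ?f + b * ?g) *v x" by (simp add: ab)
  then have x: "x = pm V (a * ?f) *v x + pm V (b * ?g) *v x"
    by (simp only: pm_add matrix_vector_mult_add_rdistrib)
  have k: "pm V (?f * ?g) *v x = 0"
    using insert by simp
  have "?g * (a * ?f) = a * (?f * ?g)" by (simp add: mult_ac)
  then have "pm V ?g *v (pm V (a * ?f) *v x) = pm V a *v (pm V (?f * ?g) *v x)"
    by (simp only: pm_mult_vec[symmetric])
  then have "pm V (a * ?f) *v x \<in> vec.span (\<Union>\<mu>\<in>S. gen_eigenspace V \<mu>)"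
    using insert.IH k by simp
  then have 1: "pm V (a * ?f) *v x \<in> vec.span (\<Union>\<mu>\<in>insert \<mu> S. gen_eigenspace V \<mu>)"
    using vec.span_mono[of "\<Union>\<mu>\<in>S. gen_eigenspace V \<mu>" "\<Union>\<mu>\<in>insert \<mu> S. gen_eigenspace V \<mu>"] by blast
  have "?f * (b * ?g) = b * (?f * ?g)" by (simp add: mult_ac)
  then have "pm V ?f *v (pm V (b * ?g) *v x) = pm V b *v (pm V (?f * ?g) *v x)"
    by (simp only: pm_mult_vec[symmetric])
  then have "pm V (b * ?g) *v x \<in> gen_eigenspace V \<mu>"
    using k by (simp add: gen_eigenspace_alt)
  then have 2: "pm V (b * ?g) *v x \<in> vec.span (\<Union>\<mu>\<in>insert \<mu> S. gen_eigenspace V \<mu>)"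
    by (intro vec.span_base) auto
  show ?case
    using vec.span_add[OF 1 2] x by simp
qed

abbreviation eigenvalues :: "complex^'n^'n \<Rightarrow> complex set" where
  "eigenvalues V \<equiv> {\<mu>. poly (charpoly V) \<mu> = 0}"

lemma finite_eigenvalues: "finite (eigenvalues V)"
  by (rule poly_roots_finite) simp

text \<open>Multiplicities are at most n, so the characteristic polynomial divides this product. The
  uniform exponent n matches the definition of \<open>gen_eigenspace\<close>.\<close>

lemma pm_all_eigenvalues: "pm V (\<Prod>\<mu>\<in>eigenvalues V. [:- \<mu>, 1:] ^ CARD('n)) = 0"
  for V :: "complex^'n^'n"
proof -
  have "charpoly V = (\<Prod>\<mu>\<in>eigenvalues V. [:- \<mu>, 1:] ^ order \<mu> (charpoly V))"
    using complex_poly_decompose[of "charpoly V"] unfolding charpoly_monic(2) smult_1_left by (rule sym)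
  also have "\<dots> dvd (\<Prod>\<mu>\<in>eigenvalues V. [:- \<mu>, 1:] ^ CARD('n))"
  proof (intro prod_dvd_prod le_imp_power_dvd)
    fix \<mu>
    show "order \<mu> (charpoly V) \<le> CARD('n)"
      using order_degree[of "charpoly V" \<mu>] charpoly_monic(1)[of V] by simp
  qed
  finally obtain r where "(\<Prod>\<mu>\<in>eigenvalues V. [:- \<mu>, 1:] ^ CARD('n)) = charpoly V * r" by auto
  then show ?thesis by (simp add: pm_mult Cayley_Hamilton)
qed

text \<open>The generalized eigenspaces span, so the union of their bases has at least n
  elements.\<close>

lemma sum_alg_mult_ge: "CARD('n) \<le> (\<Sum>\<mu>\<in>eigenvalues V. alg_mult V \<mu>)" for V :: "complex^'n^'n"
proof -
  have "\<exists>B. B \<subseteq> gen_eigenspace V \<mu> \<and> vec.independent B \<and> gen_eigenspace V \<mu> \<subseteq> vec.span B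
        \<and> card B = vec.dim (gen_eigenspace V \<mu>)" for \<mu>
    by (rule vec.basis_exists[of "gen_eigenspace V \<mu>"]) blast
  then obtain B where B: "\<And>\<mu>. vec.independent (B \<mu>)" "\<And>\<mu>. gen_eigenspace V \<mu> \<subseteq> vec.span (B \<mu>)"
    "\<And>\<mu>. card (B \<mu>) = alg_mult V \<mu>"
    unfolding alg_mult_def by metis
  have fB: "finite (B \<mu>)" for \<mu>
    using vec.finiteI_independent[OF B(1)] .
  let ?U = "\<Union>\<mu>\<in>eigenvalues V. B \<mu>"
  have "gen_eigenspace V \<mu> \<subseteq> vec.span ?U" if "\<mu> \<in> eigenvalues V" for \<mu>
    using B(2)[of \<mu>] vec.span_mono[of "B \<mu>" ?U] that by blast
  then have "vec.span (\<Union>\<mu>\<in>eigenvalues V. gen_eigenspace V \<mu>) \<subseteq> vec.span ?U"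
    by (intro vec.span_minimal vec.subspace_span) blast
  moreover have "x \<in> vec.span (\<Union>\<mu>\<in>eigenvalues V. gen_eigenspace V \<mu>)" for x
    by (rule gen_eigenspace_coprime_sum[OF finite_eigenvalues]) (simp add: pm_all_eigenvalues)
  ultimately have "UNIV \<subseteq> vec.span ?U" by blast
  then have "vec.dim (UNIV :: (complex^'n) set) \<le> card ?U"
    by (rule vec.dim_le_card) (simp add: finite_eigenvalues fB)
  also have "\<dots> \<le> (\<Sum>\<mu>\<in>eigenvalues V. card (B \<mu>))"
    by (rule card_UN_le[OF finite_eigenvalues])
  finally show ?thesis by (simp only: B(3) vec_dim_card)
qed

lemma nil_index_kills:
  assumes "x \<in> gen_eigenspace V \<mu>"
  shows "pm V ([:- \<mu>, 1:] ^ nil_index V \<mu>) *v x = 0"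
proof -
  have "\<forall>x\<in>gen_eigenspace V \<mu>. mpow_apply (V - mat \<mu>) (nil_index V \<mu>) x = 0"
    unfolding nil_index_def by (rule LeastI[of _ "CARD('a)"]) (simp add: gen_eigenspace_def)
  then show ?thesis using assms by (simp add: mpow_apply_shift)
qed

lemma nil_index_witness:
  assumes "k < nil_index V \<mu>"
  obtains x where "x \<in> gen_eigenspace V \<mu>" "pm V ([:- \<mu>, 1:] ^ k) *v x \<noteq> 0"
  using not_less_Least[OF assms[unfolded nil_index_def]] that by (auto simp: mpow_apply_shift)

lemma pm_eigenvector:
  assumes "(V - mat \<mu>) *v y = 0"
  shows "pm V s *v y = poly s \<mu> *s y"
proof (induction s)
  case (pCons a s)
  have "V *v y = \<mu> *s y" using assms by (simp add: matrix_vector_mult_diff_rdistrib mat_vec)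
  with pCons show ?case
    by (simp add: matrix_vector_mult_add_rdistrib mat_vec matrix_vector_mul_assoc[symmetric]
        vector_scalar_commute vector_sadd_rdistrib vec.scale_scale mult.commute)
qed (simp add: vec_eq_iff)

text \<open>Let i > k be the least exponent with (V - \<mu>)^i x = 0; then y = (V - \<mu>)^(i-1) x
  is an eigenvector. If the order of r at \<mu> were at most k, a multiple of r would equal s (t -
  \<mu>)^(i-1) with s(\<mu>) nonzero; it kills x, yet it sends x to s(\<mu>) y.\<close>

lemma order_annihilator_ge:
  fixes V :: "complex^'n^'n"
  assumes x: "x \<in> gen_eigenspace V \<mu>" "pm V ([:- \<mu>, 1:] ^ k) *v x \<noteq> 0"
    and r: "pm V r *v x = 0" "r \<noteq> 0"
  shows "k < order \<mu> r"
proof (rule ccontr)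
  assume "\<not> k < order \<mu> r"
  then have jk: "order \<mu> r \<le> k" by simp
  define i where "i = (LEAST i. pm V ([:- \<mu>, 1:] ^ i) *v x = 0)"
  have ex: "pm V ([:- \<mu>, 1:] ^ CARD('n)) *v x = 0" using x(1) by (simp add: gen_eigenspace_alt)
  have i0: "pm V ([:- \<mu>, 1:] ^ i) *v x = 0" unfolding i_def by (rule LeastI[of _ "CARD('n)"]) fact
  have imin: "pm V ([:- \<mu>, 1:] ^ j) *v x \<noteq> 0" if "j < i" for j
    using not_less_Least that unfolding i_def by blast
  have "k < i"
  proof (rule ccontr)
    assume "\<not> k < i"
    then have "[:- \<mu>, 1:] ^ k = [:- \<mu>, 1:] ^ (k - i) * [:- \<mu>, 1:] ^ i"
      by (simp flip: power_add)
    then show False using x(2) i0 by (simp add: pm_mult_vec)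
  qed
  define y where "y = pm V ([:- \<mu>, 1:] ^ (i - 1)) *v x"
  have "y \<noteq> 0" unfolding y_def using \<open>k < i\<close> by (intro imin) auto
  have "[:- \<mu>, 1:] ^ i = [:- \<mu>, 1:] * [:- \<mu>, 1:] ^ (i - 1)"
    using \<open>k < i\<close> by (metis gr_implies_not0 power_eq_if)
  then have y: "(V - mat \<mu>) *v y = 0"
    using i0 unfolding y_def by (metis pm_linear pm_mult_vec)
  obtain s where s: "r = [:- \<mu>, 1:] ^ order \<mu> r * s" "\<not> [:- \<mu>, 1:] dvd s"
    using order_decomp[OF r(2), of \<mu>] by blast
  then have "poly s \<mu> \<noteq> 0" by (simp add: poly_eq_0_iff_dvd)
  have "[:- \<mu>, 1:] ^ (i - 1 - order \<mu> r) * r = s * [:- \<mu>, 1:] ^ (i - 1)"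
  proof -
    have "i - 1 = (i - 1 - order \<mu> r) + order \<mu> r" using jk \<open>k < i\<close> by simp
    then have "[:- \<mu>, 1:] ^ (i - 1) = [:- \<mu>, 1:] ^ (i - 1 - order \<mu> r) * [:- \<mu>, 1:] ^ order \<mu> r"
      by (metis power_add)
    then show ?thesis by (subst s(1)) (simp add: mult_ac)
  qed
  then have "pm V s *v y = pm V ([:- \<mu>, 1:] ^ (i - 1 - order \<mu> r)) *v (pm V r *v x)"
    unfolding y_def by (simp only: pm_mult_vec[symmetric])
  also have "\<dots> = 0" using r(1) by simp
  finally show False
    using pm_eigenvector[OF y, of s] \<open>poly s \<mu> \<noteq> 0\<close> \<open>y \<noteq> 0\<close> by simp
qed

lemma order_prod_nonroot:
  assumes "finite S" "\<mu> \<notin> S"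
  shows "order \<mu> (\<Prod>\<nu>\<in>S. [:- \<nu>, 1:] ^ k :: complex poly) = 0"
  using assms by (intro order_0I) (auto simp: poly_prod)

text \<open>A linear relation among the first n iterates of v is an annihilating polynomial of
  degree below n. Without such polynomials these iterates are n independent vectors, hence a
  basis.\<close>

lemma cyclic_vector_of_annihilator:
  fixes V :: "complex^'n^'n"
  assumes "\<And>p. pm V p *v v = 0 \<Longrightarrow> p \<noteq> 0 \<Longrightarrow> CARD('n) \<le> degree p"
  shows "cyclic_matrix V"
proof -
  let ?f = "\<lambda>k. mpow_apply V k v"
  have small: "p = 0" if "pm V p *v v = 0" "\<And>k. k \<ge> CARD('n) \<Longrightarrow> coeff p k = 0" for p
    using assms[OF that(1)] that(2) by (metis leading_coeff_0_iff)
  have inj: "inj_on ?f {..<CARD('n)}"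
  proof (rule inj_onI)
    fix i j assume ij: "i \<in> {..<CARD('n)}" "j \<in> {..<CARD('n)}" "?f i = ?f j"
    then have "(monom 1 i - monom 1 j :: complex poly) = 0"
      by (intro small) (auto simp: pm_diff matrix_vector_mult_diff_rdistrib mpow_apply_pm)
    then show "i = j" by (simp add: monom_eq_iff')
  qed
  have "vec.independent (?f ` {..<CARD('n)})"
  proof (rule vec.independent_if_scalars_zero)
    fix u y assume u: "(\<Sum>y\<in>?f ` {..<CARD('n)}. u y *s y) = 0" "y \<in> ?f ` {..<CARD('n)}"
    define p where "p = (\<Sum>k<CARD('n). monom (u (?f k)) k)"
    have c: "coeff p k = (if k < CARD('n) then u (?f k) else 0)" for k
      by (auto simp: p_def coeff_sum)
    have "degree p \<le> CARD('n)" by (rule degree_le) (simp add: c)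
    then have "pm V p *v v = (\<Sum>k\<le>CARD('n). coeff p k *s ?f k)" by (rule pm_vec_sum)
    also have "\<dots> = (\<Sum>k<CARD('n). u (?f k) *s ?f k)"
      by (simp add: c lessThan_Suc_atMost[symmetric])
    also have "\<dots> = 0" using u(1) by (simp add: sum.reindex[OF inj])
    finally have "p = 0" by (rule small) (simp add: c)
    obtain k where k: "k < CARD('n)" "y = ?f k" using u(2) by blast
    then show "u y = 0" using c[of k] \<open>p = 0\<close> by simp
  qed simp
  moreover have "card (?f ` {..<CARD('n)}) = CARD('n)" using card_image[OF inj] by simp
  ultimately have "UNIV \<subseteq> vec.span (?f ` {..<CARD('n)})"
    by (intro vec.card_ge_dim_independent[OF subset_UNIV]) (assumption, simp only: vec_dim_le)
  then have "vec.span (range ?f) = UNIV"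
    using vec.span_mono[of "?f ` {..<CARD('n)}" "range ?f"] by blast
  then show ?thesis unfolding cyclic_matrix_def by blast
qed

text \<open>If m \<ge> n held at every eigenvalue, choose in each generalized eigenspace a vector of
  maximal height and let v be their sum. A nonzero annihilator of v then has order at least m at
  each eigenvalue, so its degree is at least the dimension of the space, and v is cyclic.\<close>

theorem noncyclic_eigenvalue:
  fixes V :: "complex^'n^'n"
  assumes "\<not> cyclic_matrix V"
  obtains \<mu> where "is_eigenvalue V \<mu>" "nil_index V \<mu> < alg_mult V \<mu>"
proof -
  have "\<exists>\<mu>\<in>eigenvalues V. nil_index V \<mu> < alg_mult V \<mu>"
  proof (rule ccontr)
    assume "\<not> ?thesis"
    then have ge: "\<And>\<mu>. \<mu> \<in> eigenvalues V \<Longrightarrow> alg_mult V \<mu> \<le> nil_index V \<mu>" by (auto simp: not_less)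
    \<comment> \<open>The guard keeps the natural subtraction \<open>nil_index V \<mu> - 1\<close>
      honest.\<close>
    have "\<exists>x. x \<in> gen_eigenspace V \<mu> \<and> (nil_index V \<mu> > 0 \<longrightarrow>
        pm V ([:- \<mu>, 1:] ^ (nil_index V \<mu> - 1)) *v x \<noteq> 0)" for \<mu>
    proof (cases "nil_index V \<mu> > 0")
      case True
      then show ?thesis using nil_index_witness[of "nil_index V \<mu> - 1" V \<mu>] by auto
    next
      case False
      then show ?thesis using vec.subspace_0[OF gen_eigenspace_subspace[of V \<mu>]] by auto
    qed
    then have "\<exists>x. \<forall>\<mu>. x \<mu> \<in> gen_eigenspace V \<mu> \<and> (nil_index V \<mu> > 0 \<longrightarrow>
        pm V ([:- \<mu>, 1:] ^ (nil_index V \<mu> - 1)) *v x \<mu> \<noteq> 0)"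
      by (rule choice[OF allI])
    then obtain x where x: "\<And>\<mu>. x \<mu> \<in> gen_eigenspace V \<mu>"
      "\<And>\<mu>. nil_index V \<mu> > 0 \<Longrightarrow> pm V ([:- \<mu>, 1:] ^ (nil_index V \<mu> - 1)) *v x \<mu> \<noteq> 0"
      by auto
    define v where "v = (\<Sum>\<mu>\<in>eigenvalues V. x \<mu>)"
    have "cyclic_matrix V"
    proof (rule cyclic_vector_of_annihilator)
      fix p assume p: "pm V p *v v = 0" "p \<noteq> 0"
      have "nil_index V \<mu> \<le> order \<mu> p" if \<mu>: "\<mu> \<in> eigenvalues V" for \<mu>
      proof (cases "nil_index V \<mu> > 0")
        case True
        \<comment> \<open>h kills every component of v except the one at \<mu>, and since h(\<mu>)
          is nonzero, multiplying p by h leaves the order at \<mu> unchanged.\<close>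
        define h where "h = (\<Prod>\<nu>\<in>eigenvalues V - {\<mu>}. [:- \<nu>, 1:] ^ CARD('n))"
        have "h \<noteq> 0" unfolding h_def by (simp add: finite_eigenvalues)
        have hx: "pm V h *v x \<nu> = 0" if \<nu>: "\<nu> \<in> eigenvalues V - {\<mu>}" for \<nu>
        proof -
          have "h = (\<Prod>\<nu>\<in>eigenvalues V - {\<mu>} - {\<nu>}. [:- \<nu>, 1:] ^ CARD('n)) * [:- \<nu>, 1:] ^ CARD('n)"
            unfolding h_def using \<nu> finite_eigenvalues[of V] by (subst prod.remove[of _ \<nu>]) (auto simp: mult.commute)
          then show ?thesis using x(1)[of \<nu>] by (simp add: pm_mult_vec gen_eigenspace_alt)
        qed
        have "pm V h *v v = (\<Sum>\<nu>\<in>eigenvalues V. pm V h *v x \<nu>)"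
          unfolding v_def by (simp add: vec.linear_sum[OF matrix_vector_mul_linear_gen])
        also have "\<dots> = pm V h *v x \<mu>"
          using \<mu> hx by (subst sum.remove[OF finite_eigenvalues \<mu>]) simp
        finally have "pm V (p * h) *v x \<mu> = pm V h *v (pm V p *v v)"
          by (metis pm_commute pm_mult_vec)
        then have "pm V (p * h) *v x \<mu> = 0" using p(1) by simp
        from order_annihilator_ge[OF x(1) x(2)[OF True] this]
        have "nil_index V \<mu> - 1 < order \<mu> (p * h)" using p(2) \<open>h \<noteq> 0\<close> by simp
        moreover have "order \<mu> (p * h) = order \<mu> p"
          using p(2) \<open>h \<noteq> 0\<close> order_prod_nonroot[of "eigenvalues V - {\<mu>}" \<mu> "CARD('n)"] finite_eigenvalues[of V]
          by (subst order_mult) (auto simp: h_def)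
        ultimately show ?thesis by simp
      qed simp
      then have "(\<Sum>\<mu>\<in>eigenvalues V. alg_mult V \<mu>) \<le> (\<Sum>\<mu>\<in>eigenvalues V. order \<mu> p)"
        using ge by (intro sum_mono) (meson le_trans)
      also have "\<dots> = (\<Sum>\<mu>\<in>eigenvalues V \<inter> {\<mu>. poly p \<mu> = 0}. order \<mu> p)"
        using finite_eigenvalues[of V] by (intro sum.mono_neutral_right) (auto simp: order_root)
      also have "\<dots> \<le> (\<Sum>\<mu> | poly p \<mu> = 0. order \<mu> p)"
        using poly_roots_finite[OF p(2)] by (intro sum_mono2) auto
      also have "\<dots> \<le> degree p" by (rule sum_order_le_degree[OF p(2)])
      finally show "CARD('n) \<le> degree p" using sum_alg_mult_ge[of V] by linarith
    qed
    then show False using assms by simp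
  qed
  then show ?thesis using that by (auto simp: is_eigenvalue_iff)
qed

section \<open>Affine sections of sigma\<close>

text \<open>The common characteristic polynomial of all matrices in the fibre of sigma over
  s.\<close>

definition sympoly :: "complex^'n \<Rightarrow> complex poly" where
  "sympoly s = monom 1 CARD('n) + (\<Sum>j\<in>UNIV. monom ((-1) ^ idx_enum j * s$j) (CARD('n) - idx_enum j))"

lemma coeff_sympoly_below:
  fixes s :: "complex^'n"
  shows "coeff (sympoly s) (CARD('n) - idx_enum i) = (-1) ^ idx_enum i * s$i"
proof -
  have "CARD('n) - idx_enum j = CARD('n) - idx_enum i \<longleftrightarrow> j = i" for j
    using idx_enum_range[of i] idx_enum_range[of j] injD[OF idx_enum_inj, of j i] by auto
  moreover have "CARD('n) - idx_enum i \<noteq> CARD('n)"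
    using idx_enum_range[of i] by linarith
  ultimately show ?thesis
    by (simp add: sympoly_def coeff_sum)
qed

lemma coeff_sympoly_top: "coeff (sympoly (s::complex^'n)) CARD('n) = 1"
proof -
  have "CARD('n) - idx_enum (j::'n) \<noteq> CARD('n)" for j
    using idx_enum_range[of j] by linarith
  then show ?thesis by (simp add: sympoly_def coeff_sum)
qed

lemma coeff_sympoly_above: "k > CARD('n) \<Longrightarrow> coeff (sympoly (s::complex^'n)) k = 0"
proof -
  assume "k > CARD('n)"
  then have "CARD('n) - idx_enum (j::'n) \<noteq> k" for j by linarith
  then show ?thesis using \<open>k > CARD('n)\<close> by (simp add: sympoly_def coeff_sum)
qed

lemma monic_poly_eqI:
  assumes "coeff p N = 1" "coeff q N = 1" "\<And>k. k > N \<Longrightarrow> coeff p k = 0" "\<And>k. k > N \<Longrightarrow> coeff q k = 0"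
    and "\<And>k. k < N \<Longrightarrow> coeff p k = coeff q k"
  shows "p = q"
  using assms by (intro poly_eqI) (metis linorder_neqE_nat)

lemma charpoly_coeffs: "coeff (charpoly (V::complex^'n^'n)) CARD('n) = 1"
  "k > CARD('n) \<Longrightarrow> coeff (charpoly V) k = 0"
  using charpoly_monic[of V] by (auto intro: coeff_eq_0)

lemma below_index:
  assumes "k < CARD('n)"
  obtains i :: "'n::finite" where "k = CARD('n) - idx_enum i"
proof -
  have "1 \<le> CARD('n) - k" "CARD('n) - k \<le> CARD('n)" using assms by auto
  then obtain i :: 'n where "idx_enum i = CARD('n) - k" by (rule idx_enum_surj)
  then show ?thesis using that[of i] assms by simp
qed

lemma sympoly_sigma: "sympoly (sigma V) = charpoly (V::complex^'n^'n)"
proof (rule monic_poly_eqI[of _ "CARD('n)"])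
  fix k assume "k < CARD('n)"
  then obtain i :: 'n where i: "k = CARD('n) - idx_enum i" by (rule below_index)
  show "coeff (sympoly (sigma V)) k = coeff (charpoly V) k"
    unfolding i coeff_sympoly_below by (simp add: sigma_def sigma_coeff_def)
qed (simp_all add: coeff_sympoly_top coeff_sympoly_above charpoly_coeffs)

lemma sigma_eqI:
  fixes V :: "complex^'n^'n"
  assumes "charpoly V = sympoly s"
  shows "sigma V = s"
  unfolding vec_eq_iff
  by (simp add: sigma_def sigma_coeff_def assms coeff_sympoly_below)

text \<open>The companion matrix of \<open>sympoly s\<close> with the coefficients in its last
  column, so that its entries are affine in s. Row i carries the coefficient of degree
  \<open>idx_enum i - 1\<close> because rows are numbered from 1.\<close>

definition companion :: "complex^'n \<Rightarrow> complex^'n^'n" where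
  "companion s = (\<chi> i j. if idx_enum j = CARD('n) then - coeff (sympoly s) (idx_enum i - 1)
                         else of_bool (idx_enum i = idx_enum j + 1))"

lemma mat_vec_axis_col: "A *v axis j 1 = (\<chi> i. (A::complex^'n^'n) $ i $ j)"
  by (simp add: vec_eq_iff mat_vec_axis)

lemma companion_axis_step:
  assumes "idx_enum i = idx_enum j + 1"
  shows "companion s *v axis j 1 = axis (i::'n::finite) 1"
proof -
  have "idx_enum j \<noteq> CARD('n)" using assms idx_enum_range(2)[of i] by simp
  moreover have "idx_enum k = idx_enum j + 1 \<longleftrightarrow> k = i" for k
    using injD[OF idx_enum_inj, of k i] assms by auto
  ultimately show ?thesis
    by (simp add: vec_eq_iff mat_vec_axis companion_def) (simp add: axis_def)
qed

lemma companion_axis_last: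
  fixes j :: "'n::finite"
  assumes "idx_enum j = CARD('n)"
  shows "companion s *v axis j 1 = (\<chi> i. - coeff (sympoly s) (idx_enum i - 1))"
  unfolding mat_vec_axis_col companion_def using assms by (auto simp: vec_eq_iff)

lemma mpow_companion:
  fixes i j :: "'n::finite"
  assumes "idx_enum j = 1" "idx_enum i = k + 1"
  shows "mpow_apply (companion s) k (axis j 1) = axis i 1"
  using assms(2)
proof (induction k arbitrary: i)
  case 0
  then have "i = j" using injD[OF idx_enum_inj, of i j] assms(1) by simp
  then show ?case by simp
next
  case (Suc k)
  then have "1 \<le> k + 1" "k + 1 \<le> CARD('n)" using idx_enum_range(2)[of i] by auto
  then obtain i' :: 'n where i': "idx_enum i' = k + 1" by (rule idx_enum_surj)
  then show ?case
    using Suc by (simp add: mpow_apply_Suc companion_axis_step)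
qed

text \<open>No determinant is expanded. The companion matrix shifts e_1 through all unit vectors, so
  Cayley-Hamilton applied to e_1 displays, coordinate by coordinate, the coefficients of the
  characteristic polynomial against those in the last column.\<close>

lemma charpoly_companion: "charpoly (companion s) = sympoly (s :: complex^'n)"
proof -
  let ?C = "companion s" and ?p = "charpoly (companion s)"
  have "1 \<le> (1::nat)" "1 \<le> CARD('n)" by (auto simp: Suc_le_eq)
  then obtain j :: 'n where j: "idx_enum j = 1" by (rule idx_enum_surj)
  have "1 \<le> CARD('n)" "CARD('n) \<le> CARD('n)" by (auto simp: Suc_le_eq)
  then obtain l :: 'n where l: "idx_enum l = CARD('n)" by (rule idx_enum_surj)
  have comp: "mpow_apply ?C k (axis j 1) $ i = of_bool (idx_enum i = k + 1)" if "k < CARD('n)" for k i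
  proof -
    have "1 \<le> k + 1" "k + 1 \<le> CARD('n)" using that by auto
    then obtain i' :: 'n where i': "idx_enum i' = k + 1" by (rule idx_enum_surj)
    have "idx_enum i = k + 1 \<longleftrightarrow> i = i'" using injD[OF idx_enum_inj, of i i'] i' by auto
    then show ?thesis using mpow_companion[OF j i'] by (simp add: axis_def)
  qed
  have last: "mpow_apply ?C CARD('n) (axis j 1) $ i = - coeff (sympoly s) (idx_enum i - 1)" for i
  proof -
    have "idx_enum l = (CARD('n) - 1) + 1" using l by simp
    then have "mpow_apply ?C (CARD('n) - 1) (axis j 1) = axis l 1" by (rule mpow_companion[OF j])
    moreover have "CARD('n) = Suc (CARD('n) - 1)" by simp
    ultimately have "mpow_apply ?C CARD('n) (axis j 1) = ?C *v axis l 1"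
      by (metis mpow_apply_Suc)
    then show ?thesis by (simp add: companion_axis_last[OF l])
  qed
  have "coeff ?p (idx_enum i - 1) = coeff (sympoly s) (idx_enum i - 1)" for i :: 'n
  proof -
    have "0 = (pm ?C ?p *v axis j 1) $ i" by (simp add: Cayley_Hamilton)
    also have "\<dots> = (\<Sum>k\<le>CARD('n). coeff ?p k * mpow_apply ?C k (axis j 1) $ i)"
      by (subst pm_vec_sum[of _ "CARD('n)"]) (simp_all add: charpoly_monic)
    also have "\<dots> = (\<Sum>k<CARD('n). coeff ?p k * mpow_apply ?C k (axis j 1) $ i)
        - coeff (sympoly s) (idx_enum i - 1)"
      by (simp add: lessThan_Suc_atMost[symmetric] last charpoly_coeffs)
    also have "(\<Sum>k<CARD('n). coeff ?p k * mpow_apply ?C k (axis j 1) $ i)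
       = (\<Sum>k<CARD('n). if k = idx_enum i - 1 then coeff ?p k else 0)"
      using idx_enum_range[of i] by (intro sum.cong) (auto simp: comp)
    also have "\<dots> = coeff ?p (idx_enum i - 1)"
      using idx_enum_range[of i] by (simp add: Suc_le_eq less_imp_diff_less)
    finally show ?thesis by simp
  qed
  then have "coeff ?p k = coeff (sympoly s) k" if "k < CARD('n)" for k
  proof -
    have "1 \<le> k + 1" "k + 1 \<le> CARD('n)" using that by auto
    then obtain i' :: 'n where i': "idx_enum i' = k + 1" by (rule idx_enum_surj)
    then show ?thesis using \<open>\<And>i. coeff ?p (idx_enum i - 1) = coeff (sympoly s) (idx_enum i - 1)\<close>[of i'] by simp
  qed
  then show ?thesis
    by (intro monic_poly_eqI[of _ "CARD('n)"]) (simp_all add: charpoly_coeffs coeff_sympoly_top coeff_sympoly_above)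
qed

lemma sigma_companion: "sigma (companion s) = s"
  by (rule sigma_eqI) (rule charpoly_companion)

text \<open>Membership in the spectral ball depends on the characteristic polynomial only, so a
  fibre may be tested at its companion matrix. This exhibits the symmetrized polydisk as a preimage
  under a continuous map, hence as an open set.\<close>

lemma symm_polydisk_iff: "s \<in> symm_polydisk \<longleftrightarrow> companion s \<in> spectral_ball"
proof
  assume "s \<in> symm_polydisk"
  then obtain A where A: "A \<in> spectral_ball" "s = sigma A" by (auto simp: symm_polydisk_def)
  then have "charpoly A = charpoly (companion s)"
    by (simp add: sympoly_sigma charpoly_companion)
  then show "companion s \<in> spectral_ball" using spectral_ball_cong A(1) by blast
next
  assume "companion s \<in> spectral_ball"
  then show "s \<in> symm_polydisk"
    unfolding symm_polydisk_def using sigma_companion[of s] by (metis imageI)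
qed

text \<open>Affine discs go to affine discs; this is why competitors pass from the spectral ball to
  the polydisk without any argument about curves.\<close>

lemma companion_affine: "companion (a + z *s b) = companion a + mscale z (companion (a + b) - companion a)"
proof -
  have "companion (a + z *s b) $ i $ j = (companion a + mscale z (companion (a + b) - companion a)) $ i $ j" for i j
  proof (cases "idx_enum j = CARD('a)")
    case True
    have "idx_enum i - 1 < CARD('a)" using idx_enum_range[of i] by simp
    then obtain l :: 'a where l: "idx_enum i - 1 = CARD('a) - idx_enum l" by (rule below_index)
    show ?thesis
      using True l by (simp add: companion_def coeff_sympoly_below mscale_def algebra_simps)
  qed (simp add: companion_def mscale_def)
  then show ?thesis by (simp add: vec_eq_iff)
qed

text \<open>In the basis v, Vv, ..., V^(n-1) v the matrix V becomes a shift whose last column comes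
  from Cayley-Hamilton.\<close>

theorem cyclic_similar_companion:
  fixes V :: "complex^'n^'n"
  assumes "cyclic_matrix V"
  obtains P Q where "P ** Q = mat 1" "Q ** P = mat 1" "V = P ** companion (sigma V) ** Q"
proof -
  obtain v where v: "vec.span (range (\<lambda>k. mpow_apply V k v)) = UNIV"
    using assms by (auto simp: cyclic_matrix_def)
  define P :: "complex^'n^'n" where "P = (\<chi> i j. mpow_apply V (idx_enum j - 1) v $ i)"
  have P: "P *v x = (\<Sum>j\<in>UNIV. x$j *s mpow_apply V (idx_enum j - 1) v)" for x
    by (simp add: vec_eq_iff P_def matrix_vector_mult_def mult.commute)
  have Pax: "P *v axis j 1 = mpow_apply V (idx_enum j - 1) v" for j
    unfolding mat_vec_axis_col by (simp add: P_def vec_eq_iff)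
  have CH: "mpow_apply V CARD('n) v = (\<Sum>k<CARD('n). - coeff (charpoly V) k *s mpow_apply V k v)"
  proof -
    have "0 = pm V (charpoly V) *v v" by (simp add: Cayley_Hamilton)
    also have "\<dots> = (\<Sum>k<CARD('n). coeff (charpoly V) k *s mpow_apply V k v) + mpow_apply V CARD('n) v"
      by (subst pm_vec_sum[of _ "CARD('n)"]) (simp_all add: charpoly_monic charpoly_coeffs lessThan_Suc_atMost[symmetric])
    finally show ?thesis
      by (simp add: sum_negf eq_neg_iff_add_eq_0 add.commute vector_smult_lneg)
  qed
  have reindex: "(\<Sum>k<CARD('n). g k) = (\<Sum>j\<in>(UNIV::'n set). g (idx_enum j - 1))" for g :: "nat \<Rightarrow> complex^'n"
  proof (rule sum.reindex_bij_witness[of _ "\<lambda>j. idx_enum j - 1" "\<lambda>k. inv idx_enum (k + 1)"])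
    fix k assume "k \<in> {..<CARD('n)}"
    then have "1 \<le> k + 1" "k + 1 \<le> CARD('n)" by auto
    then obtain i' :: 'n where i': "idx_enum i' = k + 1" by (rule idx_enum_surj)
    then have inv: "inv idx_enum (k + 1) = i'" using inv_f_f[OF idx_enum_inj, of i'] by simp
    show "idx_enum (inv idx_enum (k + 1) :: 'n) - 1 = k" using inv i' by simp
    then show "g (idx_enum (inv idx_enum (k + 1) :: 'n) - 1) = g k" by simp
    show "inv idx_enum (k + 1) \<in> (UNIV::'n set)" by simp
  next
    fix j :: 'n assume "j \<in> UNIV"
    have "idx_enum j - 1 + 1 = idx_enum j" using idx_enum_range(1)[of j] by simp
    then show "inv idx_enum (idx_enum j - 1 + 1) = j" by (simp add: inv_f_f[OF idx_enum_inj])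
    show "idx_enum j - 1 \<in> {..<CARD('n)}" using idx_enum_range[of j] by auto
  qed
  have VP: "V ** P = P ** companion (sigma V)"
  proof -
    have "(V ** P) *v axis j 1 = (P ** companion (sigma V)) *v axis j 1" for j
    proof (cases "idx_enum j = CARD('n)")
      case True
      have "(V ** P) *v axis j 1 = V *v mpow_apply V (idx_enum j - 1) v"
        by (simp only: matrix_vector_mul_assoc[symmetric] Pax)
      also have "\<dots> = mpow_apply V CARD('n) v"
        using idx_enum_range(1)[of j] True by (simp flip: mpow_apply_Suc)
      also have "\<dots> = P *v (\<chi> i. - coeff (charpoly V) (idx_enum i - 1))"
        unfolding CH reindex P by simp
      also have "\<dots> = (P ** companion (sigma V)) *v axis j 1"
        by (simp only: matrix_vector_mul_assoc[symmetric] companion_axis_last[OF True] sympoly_sigma)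
      finally show ?thesis .
    next
      case False
      then have "1 \<le> idx_enum j + 1" "idx_enum j + 1 \<le> CARD('n)" using idx_enum_range(2)[of j] by auto
      then obtain i :: 'n where i: "idx_enum i = idx_enum j + 1" by (rule idx_enum_surj)
      have "(V ** P) *v axis j 1 = V *v mpow_apply V (idx_enum j - 1) v"
        by (simp only: matrix_vector_mul_assoc[symmetric] Pax)
      also have "\<dots> = mpow_apply V (idx_enum i - 1) v"
        using idx_enum_range(1)[of j] i by (simp flip: mpow_apply_Suc)
      also have "\<dots> = (P ** companion (sigma V)) *v axis j 1"
        by (simp only: matrix_vector_mul_assoc[symmetric] companion_axis_step[OF i] Pax)
      finally show ?thesis .
    qed
    then have "(V ** P) $ i $ j = (P ** companion (sigma V)) $ i $ j" for i j
      by (metis mat_vec_axis)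
    then show ?thesis by (simp add: vec_eq_iff)
  qed
  \<comment> \<open>The range of P contains v = P e_1, and V P = P C makes it invariant under V; so
    it contains the span of all iterates and P is onto.\<close>
  have ran: "mpow_apply V k v \<in> range ((*v) P)" for k
  proof (induction k)
    case 0
    have "1 \<le> (1::nat)" "1 \<le> CARD('n)" by (auto simp: Suc_le_eq)
    then obtain j :: 'n where "idx_enum j = 1" by (rule idx_enum_surj)
    then have "P *v axis j 1 = mpow_apply V 0 v" by (simp add: Pax)
    then show ?case by (metis rangeI)
  next
    case (Suc k)
    then obtain x where x: "mpow_apply V k v = P *v x" by auto
    have "mpow_apply V (Suc k) v = (V ** P) *v x"
      unfolding mpow_apply_Suc x by (rule matrix_vector_mul_assoc)
    also have "\<dots> = P *v (companion (sigma V) *v x)"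
      unfolding VP by (rule matrix_vector_mul_assoc[symmetric])
    finally show ?case by simp
  qed
  have "vec.subspace (range ((*v) P))"
    using vec.linear_subspace_image[OF matrix_vector_mul_linear_gen vec.subspace_UNIV] .
  then have "vec.span (range (\<lambda>k. mpow_apply V k v)) \<subseteq> range ((*v) P)"
    using ran by (intro vec.span_minimal) auto
  then have "surj ((*v) P)" using v by auto
  then obtain Q where "P ** Q = mat 1" by (auto simp: matrix_right_invertible_surjective[symmetric])
  moreover from this have "Q ** P = mat 1" by (simp add: matrix_left_right_inverse)
  moreover have "V = P ** companion (sigma V) ** Q"
  proof -
    have "P ** companion (sigma V) ** Q = V ** (P ** Q)"
      unfolding VP[symmetric] by (rule matrix_mul_assoc[symmetric])
    then show ?thesis using \<open>P ** Q = mat 1\<close> by simp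
  qed
  ultimately show ?thesis by (rule that)
qed

section \<open>Connecting the fibres of sigma by affine lines\<close>

definition conj_by :: "complex^'n^'n \<Rightarrow> complex^'n^'n \<Rightarrow> complex^'n^'n" where
  "conj_by P A = P ** A ** matrix_inv P"

definition diag_mat :: "('n \<Rightarrow> complex) \<Rightarrow> complex^'n^'n" where
  "diag_mat d = (\<chi> i j. if i = j then d i else 0)"

definition column_mat :: "'n \<Rightarrow> complex^'n \<Rightarrow> complex^'n^'n" where
  "column_mat k c = (\<chi> i j. if j = k then c$i else of_bool (i = j))"

lemma matrix_inv:
  fixes P :: "complex^'n^'n"
  assumes "invertible P"
  shows "matrix_inv P ** P = mat 1" "P ** matrix_inv P = mat 1"
  using assms unfolding invertible_def matrix_inv_def by (metis (mono_tags, lifting) someI_ex)+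

lemma conj_by_eqI:
  fixes P A B :: "complex^'n^'n"
  assumes "invertible P" "P ** A = B ** P"
  shows "conj_by P A = B"
  using assms matrix_inv[OF assms(1)] unfolding conj_by_def by (simp flip: matrix_mul_assoc)

lemma conj_by_eq:
  fixes P Q A :: "complex^'n^'n"
  assumes "P ** Q = mat 1" "Q ** P = mat 1"
  shows "P ** A ** Q = conj_by P A"
proof (rule conj_by_eqI[symmetric])
  show "invertible P" using assms unfolding invertible_def by blast
  show "P ** A = P ** A ** Q ** P" using assms(2) by (simp flip: matrix_mul_assoc)
qed

lemma conj_by_mult:
  fixes P R A :: "complex^'n^'n"
  assumes "invertible P" "invertible R"
  shows "conj_by (P ** R) A = conj_by P (conj_by R A)"
proof (rule conj_by_eqI)
  show "invertible (P ** R)" using assms by (rule invertible_mult)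
  have "conj_by P (conj_by R A) ** (P ** R) = P ** (R ** A ** matrix_inv R) ** (matrix_inv P ** P) ** R"
    unfolding conj_by_def by (simp only: matrix_mul_assoc)
  also have "\<dots> = P ** R ** A ** (matrix_inv R ** R)"
    using matrix_inv(1)[OF assms(1)] by (simp add: matrix_mul_assoc)
  finally show "P ** R ** A = conj_by P (conj_by R A) ** (P ** R)"
    using matrix_inv(1)[OF assms(2)] by simp
qed

lemma invertible_mat_1: "invertible (mat 1 :: complex^'n^'n)"
  unfolding invertible_def by (rule exI[of _ "mat 1"]) simp

lemma conj_by_1: "conj_by (mat 1) A = A"
  by (rule conj_by_eqI) (simp_all add: invertible_mat_1)

lemma charpoly_conj_by:
  assumes "invertible P"
  shows "charpoly (conj_by P A) = charpoly A"
  unfolding conj_by_def by (rule charpoly_similar[OF matrix_inv[OF assms]])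

lemma conj_by_add: "conj_by P (A + mscale z B) = conj_by P A + mscale z (conj_by P B)"
  by (simp add: conj_by_def matrix_add_ldistrib matrix_add_rdistrib mscale_mult)

text \<open>With k placed last in the order, every matrix whose nonzero off-diagonal entries all lie
  in column k is upper triangular.\<close>

lemma column_mat_triangular:
  fixes k :: "'n::finite"
  shows "\<exists>e :: 'n \<Rightarrow> nat. inj e \<and> (\<forall>i j. e i > e j \<longrightarrow> i \<noteq> j \<and> j \<noteq> k)"
proof -
  define e where "e i = (if i = k then CARD('n) + 1 else idx_enum i)" for i
  have "i = j" if "e i = e j" for i j
    using that idx_enum_range(2)[of i] idx_enum_range(2)[of j] injD[OF idx_enum_inj, of i j]
    by (auto simp: e_def split: if_splits)
  then have "inj e" by (rule injI)
  moreover have "i \<noteq> j \<and> j \<noteq> k" if "e i > e j" for i j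
    using that idx_enum_range(2)[of i] by (auto simp: e_def split: if_splits)
  ultimately show ?thesis by blast
qed

lemma column_mat_invertible:
  fixes c :: "complex^'n"
  assumes "c $ k \<noteq> 0"
  shows "invertible (column_mat k c)"
proof -
  obtain e :: "'n \<Rightarrow> nat" where e: "inj e" "\<And>i j. e i > e j \<Longrightarrow> i \<noteq> j \<and> j \<noteq> k"
    using column_mat_triangular[of k] by auto
  have "det (column_mat k c) = (\<Prod>i\<in>UNIV. column_mat k c $ i $ i)"
    by (rule det_triangular[OF e(1)]) (use e(2) in \<open>auto simp: column_mat_def\<close>)
  also have "\<dots> \<noteq> 0" using assms by (auto simp: column_mat_def)
  finally show ?thesis by (simp add: invertible_det_nz)
qed

lemma column_mat_axis: "column_mat k c *v axis j 1 = (if j = k then c else axis j 1)"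
  unfolding mat_vec_axis_col column_mat_def by (auto simp: vec_eq_iff axis_def)

text \<open>The assumption on f is constancy along complex lines that stay in one fibre of the
  characteristic polynomial. This separates the linear algebra from Liouville's theorem, which
  supplies the assumption later.\<close>

context
  fixes f :: "complex^'n^'n \<Rightarrow> 'b"
  assumes step: "\<And>A B. (\<And>z. charpoly (A + mscale z B) = charpoly A) \<Longrightarrow> f (A + B) = f A"
begin

text \<open>Conjugating a diagonal matrix D by a column matrix gives D + N with N in column k off
  the diagonal. All D + z N are triangular with the same diagonal, so the passage from D to D + N is
  one line inside the fibre.\<close>

lemma conj_column_mat:
  fixes c :: "complex^'n"
  assumes P: "invertible P" and c: "c $ k \<noteq> 0"
  shows "f (conj_by P (conj_by (column_mat k c) (diag_mat d))) = f (conj_by P (diag_mat d))"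
proof -
  \<comment> \<open>Solves E D = (D + N) E for the column matrix E: entry (i, k) reads c_i d_k = d_i
    c_i + N_ik c_k.\<close>
  define N :: "complex^'n^'n" where
    "N = (\<chi> i j. if j = k \<and> i \<noteq> k then c$i * (d k - d i) / c$k else 0)"
  have "(column_mat k c ** diag_mat d) $ i $ j = ((diag_mat d + N) ** column_mat k c) $ i $ j" for i j
  proof -
    have 1: "(column_mat k c ** diag_mat d) $ i $ j = column_mat k c $ i $ j * d j"
      by (simp add: matrix_matrix_mult_def diag_mat_def if_distrib cong: if_cong)
    have 2: "(diag_mat d ** column_mat k c) $ i $ j = d i * column_mat k c $ i $ j"
      by (simp add: matrix_matrix_mult_def diag_mat_def if_distrib if_distribR cong: if_cong)
    have "(N ** column_mat k c) $ i $ j = (\<Sum>l\<in>UNIV. if l = k then N $ i $ k * column_mat k c $ k $ j else 0)"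
      unfolding matrix_matrix_mult_def vec_lambda_beta by (rule sum.cong) (auto simp: N_def)
    then have 3: "(N ** column_mat k c) $ i $ j = N $ i $ k * column_mat k c $ k $ j" by simp
    show ?thesis
      unfolding matrix_add_rdistrib vector_add_component 1 2 3
      using c by (auto simp: N_def column_mat_def field_simps)
  qed
  then have D: "conj_by (column_mat k c) (diag_mat d) = diag_mat d + N"
    by (intro conj_by_eqI column_mat_invertible c) (simp add: vec_eq_iff)
  obtain e :: "'n \<Rightarrow> nat" where e: "inj e" "\<And>i j. e i > e j \<Longrightarrow> i \<noteq> j \<and> j \<noteq> k"
    using column_mat_triangular[of k] by auto
  have "charpoly (diag_mat d + mscale z N) = (\<Prod>i\<in>UNIV. [:- d i, 1:])" for z
    by (subst charpoly_triangular[OF e(1)])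
       (use e(2) in \<open>auto simp: N_def diag_mat_def mscale_def\<close>)
  from this[of 0] this
  have "charpoly (diag_mat d + mscale z N) = charpoly (diag_mat d)" for z
    by (simp add: mscale_def) (metis add.right_neutral zero_vec_def)
  then have "f (conj_by P (diag_mat d) + conj_by P N) = f (conj_by P (diag_mat d))"
    by (intro step) (simp add: conj_by_add[symmetric] charpoly_conj_by[OF P])
  then show ?thesis
    using conj_by_add[of P "diag_mat d" 1 N] by (simp add: D mscale_1)
qed

text \<open>Gaussian elimination: R is taken apart into column matrices, each of which is absorbed
  by \<open>conj_column_mat\<close>, and the induction counts the columns of R that are not yet the
  right unit vectors. P is arbitrary because the split-off factors accumulate in it.\<close>

lemma conj_invariant_diag:
  assumes "invertible P" "invertible R"
  shows "f (conj_by P (conj_by R (diag_mat d))) = f (conj_by P (diag_mat d))"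
  using assms
proof (induction "card {j. R *v axis j 1 \<noteq> axis j 1}" arbitrary: P R rule: less_induct)
  case less
  let ?bad = "\<lambda>R. {j. R *v axis j 1 \<noteq> axis j (1::complex)}"
  \<comment> \<open>One elimination at a nonzero pivot. \<open>R'\<close> is the matrix of the
    induction hypothesis; it may differ from \<open>R\<close> because a change of pivot replaces the
    matrix without lowering the count.\<close>
  have A: "f (conj_by P (conj_by R (diag_mat d))) = f (conj_by P (diag_mat d))"
    if P: "invertible P" and R: "invertible R" and k: "k \<in> ?bad R" "(R *v axis k 1) $ k \<noteq> 0"
      and c: "card (?bad R) \<le> card (?bad R')"
      and IH: "\<And>P R. card (?bad R) < card (?bad R') \<Longrightarrow> invertible P \<Longrightarrow> invertible R \<Longrightarrow>
        f (conj_by P (conj_by R (diag_mat d))) = f (conj_by P (diag_mat d))" for P R R' k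
  proof -
    define E where "E = column_mat k (R *v axis k 1)"
    have E: "invertible E" unfolding E_def by (rule column_mat_invertible[OF k(2)])
    define R1 where "R1 = matrix_inv E ** R"
    have iE: "invertible (matrix_inv E)" using matrix_inv[OF E] unfolding invertible_def by auto
    have R1: "invertible R1" unfolding R1_def by (rule invertible_mult[OF iE R])
    have RE: "R = E ** R1" unfolding R1_def using matrix_inv(2)[OF E] by (simp add: matrix_mul_assoc)
    have inv: "matrix_inv E *v (E *v x) = x" for x
      using matrix_inv(1)[OF E] by (simp add: matrix_vector_mul_assoc)
    have "R1 *v axis k 1 = axis k 1"
      using inv[of "axis k 1"] by (simp add: R1_def E_def column_mat_axis matrix_vector_mul_assoc[symmetric])
    moreover have "R1 *v axis j 1 = axis j 1" if "R *v axis j 1 = axis j 1" "j \<noteq> k" for j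
      using inv[of "axis j 1"] that by (simp add: R1_def E_def column_mat_axis matrix_vector_mul_assoc[symmetric])
    ultimately have "?bad R1 \<subset> ?bad R" using k(1) by blast
    then have "card (?bad R1) < card (?bad R)" by (intro psubset_card_mono) simp_all
    then have lt: "card (?bad R1) < card (?bad R')" using c by linarith
    have PE: "invertible (P ** E)" using P E by (rule invertible_mult)
    have "f (conj_by P (conj_by R (diag_mat d))) = f (conj_by (P ** E) (conj_by R1 (diag_mat d)))"
      unfolding RE conj_by_mult[OF E R1] conj_by_mult[OF P E] ..
    also have "\<dots> = f (conj_by (P ** E) (diag_mat d))" by (rule IH[OF lt PE R1])
    also have "\<dots> = f (conj_by P (diag_mat d))"
      unfolding conj_by_mult[OF P E] unfolding E_def by (rule conj_column_mat[OF P k(2)])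
    finally show ?thesis .
  qed
  show ?case
  proof (cases "?bad R = {}")
    case True
    then have "R *v axis j 1 = mat 1 *v axis j 1" for j by auto
    then have "R $ i $ j = mat 1 $ i $ j" for i j by (metis mat_vec_axis)
    then have "R = mat 1" by (simp add: vec_eq_iff)
    then show ?thesis by (simp add: conj_by_1)
  next
    case False
    then obtain k where k: "k \<in> ?bad R" by blast
    define c where "c = R *v axis k 1"
    show ?thesis
    proof (cases "c $ k = 0")
      case False
      then show ?thesis
        using A[OF less.prems k, of R] less.hyps unfolding c_def by blast
    next
      case True
      \<comment> \<open>If c vanished on all bad positions, it would be a combination y of unit
        vectors fixed by R. Then R y = c = R e_k with y$k = 0, which contradicts
        invertibility.\<close>
      have "\<exists>j. j \<in> ?bad R \<and> c $ j \<noteq> 0"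
      proof (rule ccontr)
        assume no: "\<not> ?thesis"
        define y where "y = (\<chi> j. if j \<in> ?bad R then 0 else c $ j)"
        have "(R *v y) $ i = c $ i" for i
        proof -
          have "(R *v y) $ i = (\<Sum>j\<in>UNIV. if j = i then y $ i else 0)"
            unfolding matrix_vector_mult_def vec_lambda_beta
          proof (rule sum.cong[OF refl])
            fix j
            show "R $ i $ j * y $ j = (if j = i then y $ i else 0)"
            proof (cases "j \<in> ?bad R")
              case False
              then have "R $ i $ j = axis j 1 $ i" using mat_vec_axis[of R j i] by simp
              then show ?thesis by (simp add: axis_def)
            qed (auto simp: y_def)
          qed
          then show ?thesis using no by (auto simp: y_def)
        qed
        then have "R *v y = R *v axis k 1" by (simp add: vec_eq_iff c_def)
        then have "matrix_inv R *v (R *v y) = matrix_inv R *v (R *v axis k 1)" by simp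
        then have "y = axis k 1"
          using matrix_inv(1)[OF less.prems(2)] by (simp add: matrix_vector_mul_assoc)
        then have "y $ k = 1" by (simp add: axis_def)
        then show False using k by (simp add: y_def)
      qed
      then obtain j where j: "j \<in> ?bad R" "c $ j \<noteq> 0" by blast
      then have jk: "j \<noteq> k" using True by auto
      \<comment> \<open>This column matrix adds coordinate j to coordinate k, so the pivot becomes
        c$j. It moves only the unit vector at j, a bad column anyway, so no new bad column
        arises.\<close>
      let ?w = "axis j 1 + axis k (1::complex)"
      define E where "E = column_mat j ?w"
      have wj: "?w $ j \<noteq> 0" using jk by (simp add: axis_def)
      have E: "invertible E" unfolding E_def by (rule column_mat_invertible[OF wj])
      have iE: "invertible (matrix_inv E)" using matrix_inv[OF E] unfolding invertible_def by auto
      define R1 where "R1 = E ** R"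
      have R1: "invertible R1" unfolding R1_def by (rule invertible_mult[OF E less.prems(2)])
      have RE: "R = matrix_inv E ** R1"
        unfolding R1_def using matrix_inv(1)[OF E] by (simp add: matrix_mul_assoc)
      have "?bad R1 \<subseteq> ?bad R"
      proof
        fix i assume i: "i \<in> ?bad R1"
        show "i \<in> ?bad R"
        proof (rule ccontr)
          assume "i \<notin> ?bad R"
          then have "R *v axis i 1 = axis i 1" "i \<noteq> j" using j by auto
          then have "R1 *v axis i 1 = axis i 1"
            by (simp add: R1_def E_def column_mat_axis matrix_vector_mul_assoc[symmetric])
          then show False using i by simp
        qed
      qed
      then have le: "card (?bad R1) \<le> card (?bad R)" by (intro card_mono) simp_all
      have "(R1 *v axis k 1) $ k = (E *v c) $ k"
        by (simp add: R1_def c_def matrix_vector_mul_assoc[symmetric])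
      also have "\<dots> = (\<Sum>l\<in>UNIV. if l = j then c $ j else 0)"
        unfolding matrix_vector_mult_def vec_lambda_beta
        using jk True by (intro sum.cong) (auto simp: E_def column_mat_def axis_def)
      finally have R1k: "(R1 *v axis k 1) $ k \<noteq> 0" using j(2) by simp
      have PE: "invertible (P ** matrix_inv E)" using less.prems(1) iE by (rule invertible_mult)
      have "f (conj_by (P ** matrix_inv E) (conj_by R1 (diag_mat d))) = f (conj_by (P ** matrix_inv E) (diag_mat d))"
      proof (cases "k \<in> ?bad R1")
        case True
        show ?thesis by (rule A[OF PE R1 True R1k, of R]) (use le less.hyps in blast)+
      next
        case False
        then have "?bad R1 \<subset> ?bad R" using \<open>?bad R1 \<subseteq> ?bad R\<close> k by blast
        then have "card (?bad R1) < card (?bad R)" by (intro psubset_card_mono) simp_all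
        then show ?thesis by (rule less.hyps[OF _ PE R1])
      qed
      also have "\<dots> = f (conj_by (P ** matrix_inv E) (conj_by E (diag_mat d)))"
        unfolding E_def by (rule conj_column_mat[OF PE[unfolded E_def] wj, symmetric])
      also have "\<dots> = f (conj_by P (diag_mat d))"
        unfolding conj_by_mult[OF PE E, symmetric]
        using matrix_inv(1)[OF E] by (simp flip: matrix_mul_assoc)
      finally show ?thesis
        unfolding RE conj_by_mult[OF iE R1] conj_by_mult[OF less.prems(1) iE] .
    qed
  qed
qed

text \<open>Scaling the off-diagonal part of a triangular form to zero follows a line in the fibre;
  the remaining conjugation is removed by \<open>conj_invariant_diag\<close>.\<close>

lemma fibre_diag:
  obtains d where "f A = f (diag_mat d)" "charpoly A = (\<Prod>i\<in>UNIV. [:- d i, 1:])"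
proof -
  obtain P Q T :: "complex^'n^'n" where *: "P ** Q = mat 1" "Q ** P = mat 1" "A = P ** T ** Q"
    and T: "\<And>i j. idx_enum i > idx_enum j \<Longrightarrow> T$i$j = 0"
    by (rule triangularisation[of A 0]) (rule that)
  define d where "d i = T $ i $ i" for i
  have P: "invertible P" using * unfolding invertible_def by blast
  have A: "A = conj_by P T" using *(3) conj_by_eq[OF *(1,2)] by simp
  have cp: "charpoly (diag_mat d + mscale z (T - diag_mat d)) = (\<Prod>i\<in>UNIV. [:- d i, 1:])" for z
    by (subst charpoly_triangular[OF idx_enum_inj]) (use T in \<open>auto simp: mscale_def diag_mat_def d_def\<close>)
  have "mscale 0 (T - diag_mat d) = 0" by (simp add: mscale_def vec_eq_iff)
  then have cp0: "charpoly (diag_mat d) = (\<Prod>i\<in>UNIV. [:- d i, 1:])" using cp[of 0] by simp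
  have "f (conj_by P (diag_mat d) + conj_by P (T - diag_mat d)) = f (conj_by P (diag_mat d))"
    by (intro step) (simp add: conj_by_add[symmetric] charpoly_conj_by[OF P] cp cp0)
  then have "f A = f (conj_by P (diag_mat d))"
    using conj_by_add[of P "diag_mat d" 1 "T - diag_mat d"] by (simp add: A mscale_1)
  also have "\<dots> = f (diag_mat d)"
    using conj_invariant_diag[OF invertible_mat_1 P, of d] by (simp add: conj_by_1)
  finally have "f A = f (diag_mat d)" .
  moreover have "charpoly A = (\<Prod>i\<in>UNIV. [:- d i, 1:])"
    using cp[of 1] by (simp add: A charpoly_conj_by[OF P] mscale_1)
  ultimately show ?thesis by (rule that)
qed

text \<open>The diagonal representatives of A and B have the same multiset of entries, hence are
  conjugate by a permutation matrix.\<close>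

theorem fibre_constant:
  assumes "charpoly A = charpoly B"
  shows "f A = f B"
proof -
  obtain a where a: "f A = f (diag_mat a)" "charpoly A = (\<Prod>i\<in>UNIV. [:- a i, 1:])" by (rule fibre_diag)
  obtain b where b: "f B = f (diag_mat b)" "charpoly B = (\<Prod>i\<in>UNIV. [:- b i, 1:])" by (rule fibre_diag)
  have pr: "proots (\<Prod>i\<in>UNIV. [:- d i, 1:]) = image_mset d (mset_set UNIV)" for d :: "'n \<Rightarrow> complex"
    by (subst proots_prod) (simp_all add: sum_unfold_sum_mset)
  have "image_mset a (mset_set UNIV) = image_mset b (mset_set UNIV)"
    using assms a(2) b(2) pr by metis
  then obtain p where p: "p permutes UNIV" "\<forall>x\<in>UNIV. a x = b (p x)"
    by (rule image_mset_eq_implies_permutes[rotated]) auto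
  define R :: "complex^'n^'n" where "R = (\<chi> i j. of_bool (i = p j))"
  have inj: "p i = p j \<longleftrightarrow> i = j" for i j using permutes_inj[OF p(1)] by (auto dest: injD)
  have "(transpose R ** R) $ i $ j = mat 1 $ i $ j" for i j
  proof -
    have "(transpose R ** R) $ i $ j = (\<Sum>k\<in>UNIV. if k = p i then of_bool (p i = p j) else 0)"
      unfolding matrix_matrix_mult_def transpose_def R_def vec_lambda_beta by (rule sum.cong) auto
    then show ?thesis by (simp add: mat_def inj)
  qed
  then have "transpose R ** R = mat 1" by (simp add: vec_eq_iff)
  moreover from this have "R ** transpose R = mat 1" by (simp add: matrix_left_right_inverse)
  ultimately have R: "invertible R" unfolding invertible_def by blast
  have "(R ** diag_mat a) $ i $ j = (diag_mat b ** R) $ i $ j" for i j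
  proof -
    have "(R ** diag_mat a) $ i $ j = R $ i $ j * a j"
      by (simp add: matrix_matrix_mult_def diag_mat_def if_distrib cong: if_cong)
    moreover have "(diag_mat b ** R) $ i $ j = b i * R $ i $ j"
      by (simp add: matrix_matrix_mult_def diag_mat_def if_distrib if_distribR cong: if_cong)
    ultimately show ?thesis using p(2) by (simp add: R_def)
  qed
  then have "conj_by R (diag_mat a) = diag_mat b"
    by (intro conj_by_eqI R) (simp add: vec_eq_iff)
  then have "f (diag_mat b) = f (diag_mat a)"
    using conj_invariant_diag[OF invertible_mat_1 R, of a] by (simp add: conj_by_1)
  then show ?thesis using a(1) b(1) by simp
qed

end

section \<open>Circular means\<close>

text \<open>Normalised to a probability measure, so that constants are their own means;
  \<open>nn_integral_circ\<close> restores the factor 2 pi that appears in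
  \<open>neg_psh\<close>.\<close>

definition circ :: "real measure" where
  "circ = density lborel (\<lambda>t. ennreal (indicator {0..2*pi} t / (2*pi)))"

lemma space_circ [simp]: "space circ = UNIV"
  by (simp add: circ_def)

lemma sets_circ [simp, measurable_cong]: "sets circ = sets borel"
  by (simp add: circ_def)

lemma nn_integral_circ:
  assumes [measurable]: "f \<in> borel_measurable borel"
  shows "(\<integral>\<^sup>+t\<in>{0..2*pi}. f t \<partial>lborel) = ennreal (2*pi) * (\<integral>\<^sup>+t. f t \<partial>circ)"
proof -
  have "ennreal (2*pi) * (\<integral>\<^sup>+t. f t \<partial>circ)
      = ennreal (2*pi) * (\<integral>\<^sup>+t. ennreal (indicator {0..2*pi} t / (2*pi)) * f t \<partial>lborel)"
    unfolding circ_def by (subst nn_integral_density) auto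
  also have "\<dots> = (\<integral>\<^sup>+t. ennreal (2*pi) * (ennreal (indicator {0..2*pi} t / (2*pi)) * f t) \<partial>lborel)"
    by (rule nn_integral_cmult[symmetric]) measurable
  also have "\<dots> = (\<integral>\<^sup>+t\<in>{0..2*pi}. f t \<partial>lborel)"
  proof (rule nn_integral_cong)
    fix t
    show "ennreal (2*pi) * (ennreal (indicator {0..2*pi} t / (2*pi)) * f t) = f t * indicator {0..2*pi} t"
      by (cases "t \<in> {0..2*pi}") (simp_all add: mult.assoc[symmetric] ennreal_mult[symmetric])
  qed
  finally show ?thesis ..
qed

interpretation circ: prob_space circ
proof
  have "ennreal (2*pi) * emeasure circ (space circ) = (\<integral>\<^sup>+t\<in>{0..2*pi}. 1 \<partial>lborel)"
    using nn_integral_circ[of "\<lambda>_. 1"] by simp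
  also have "\<dots> = ennreal (2*pi) * 1" by simp
  finally show "emeasure circ (space circ) = 1"
    by (subst (asm) ennreal_mult_cancel_left) auto
qed

definition mean :: "(real \<Rightarrow> 'a::{banach, second_countable_topology}) \<Rightarrow> 'a" where
  "mean g = integral\<^sup>L circ g"

lemma circ_integrable_bounded:
  fixes g :: "real \<Rightarrow> 'a::{banach, second_countable_topology}"
  assumes "g \<in> borel_measurable borel" "\<And>t. norm (g t) \<le> B"
  shows "integrable circ g"
  using assms by (intro circ.integrable_const_bound[of _ B]) auto

lemma circ_integrable_continuous:
  fixes f :: "complex \<Rightarrow> 'a::{banach, second_countable_topology}"
  assumes "continuous_on (sphere z \<rho>) f" "0 \<le> \<rho>"
  shows "integrable circ (\<lambda>t. f (z + of_real \<rho> * cis t))"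
proof -
  have mem: "z + of_real \<rho> * cis t \<in> sphere z \<rho>" for t
    using assms(2) by (simp add: dist_norm norm_mult)
  obtain B where "\<forall>y\<in>f ` sphere z \<rho>. norm y \<le> B"
    using compact_imp_bounded[OF compact_continuous_image[OF assms(1) compact_sphere]] unfolding bounded_iff by blast
  then have B: "\<And>w. w \<in> sphere z \<rho> \<Longrightarrow> norm (f w) \<le> B" by blast
  have "continuous_on UNIV (\<lambda>t. f (z + of_real \<rho> * cis t))"
    by (rule continuous_on_compose2[OF assms(1)]) (use mem in \<open>auto intro!: continuous_intros\<close>)
  then have "(\<lambda>t. f (z + of_real \<rho> * cis t)) \<in> borel_measurable borel"
    by (rule borel_measurable_continuous_onI)
  then show ?thesis using B[OF mem] by (rule circ_integrable_bounded)
qed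

lemma mean_const [simp]: "mean (\<lambda>t. c) = c"
  unfolding mean_def using circ.prob_space by simp

lemma mean_mono:
  fixes g h :: "real \<Rightarrow> real"
  assumes "integrable circ g" "integrable circ h" "\<And>t. g t \<le> h t"
  shows "mean g \<le> mean h"
  unfolding mean_def by (rule integral_mono) (use assms in auto)

lemma mean_holomorphic:
  assumes "f holomorphic_on cball z \<rho>" "\<rho> > 0"
  shows "mean (\<lambda>t. f (z + of_real \<rho> * cis t)) = f z"
proof -
  let ?g = "\<lambda>t. f (z + of_real \<rho> * cis t)"
  have "((\<lambda>u. f u / (u - z)) has_contour_integral (2 * of_real pi * \<i> * f z)) (part_circlepath z \<rho> 0 (2*pi))"
    using Cauchy_integral_circlepath_simple[OF assms(1), of z] assms(2) by (simp add: circlepath_def)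
  then have "((\<lambda>t. ?g t / (of_real \<rho> * cis t) * of_real \<rho> * \<i> * cis t) has_integral (2 * of_real pi * \<i> * f z)) {0..2*pi}"
    by (subst (asm) has_contour_integral_part_circlepath_iff) auto
  then have "((\<lambda>t. ?g t * \<i>) has_integral (2 * of_real pi * \<i> * f z)) {0..2*pi}"
    using assms(2) by (simp add: field_simps)
  from has_integral_mult_left[OF this, of "- \<i>"]
  have "((\<lambda>t. ?g t * (\<i> * - \<i>)) has_integral (2 * of_real pi * f z * (\<i> * - \<i>))) {0..2*pi}"
    by (simp only: mult_ac)
  then have hi: "(?g has_integral (2 * of_real pi * f z)) {0..2*pi}" by simp
  have cont: "continuous_on (sphere z \<rho>) f"
    by (rule continuous_on_subset[OF holomorphic_on_imp_continuous_on[OF assms(1)]]) auto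
  have int: "integrable circ ?g" using cont assms(2) by (intro circ_integrable_continuous) auto
  have mem: "z + of_real \<rho> * cis t \<in> sphere z \<rho>" for t
    using assms(2) by (simp add: dist_norm norm_mult)
  have contg: "continuous_on UNIV ?g"
    by (rule continuous_on_compose2[OF cont]) (use mem in \<open>auto intro!: continuous_intros\<close>)
  have "integral\<^sup>L circ ?g = (LINT t|lborel. (indicator {0..2*pi} t / (2*pi)) *\<^sub>R ?g t)"
    unfolding circ_def using borel_measurable_continuous_onI[OF contg]
    by (subst integral_density) auto
  also have "\<dots> = (LINT t|lborel. (1 / (2*pi)) *\<^sub>R (indicator {0..2*pi} t *\<^sub>R ?g t))"
    by (intro Bochner_Integration.integral_cong) auto
  also have "\<dots> = (1 / (2*pi)) *\<^sub>R (LINT t:{0..2*pi}|lborel. ?g t)"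
    unfolding set_lebesgue_integral_def by (rule integral_scaleR_right)
  also have "(LINT t:{0..2*pi}|lborel. ?g t) = integral {0..2*pi} ?g"
    by (intro set_borel_integral_eq_integral borel_integrable_atLeastAtMost' continuous_on_subset[OF contg]) auto
  also have "\<dots> = 2 * of_real pi * f z" using hi by (rule integral_unique)
  finally show ?thesis by (simp add: mean_def scaleR_conv_of_real)
qed

lemma mean_Re_holomorphic:
  assumes "f holomorphic_on cball z \<rho>" "\<rho> > 0"
  shows "integrable circ (\<lambda>t. Re (f (z + of_real \<rho> * cis t)))"
    "mean (\<lambda>t. Re (f (z + of_real \<rho> * cis t))) = Re (f z)"
proof -
  have cont: "continuous_on (sphere z \<rho>) f"
    by (rule continuous_on_subset[OF holomorphic_on_imp_continuous_on[OF assms(1)]]) auto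
  have int: "integrable circ (\<lambda>t. f (z + of_real \<rho> * cis t))"
    using cont assms(2) by (intro circ_integrable_continuous) auto
  then show "integrable circ (\<lambda>t. Re (f (z + of_real \<rho> * cis t)))" by simp
  show "mean (\<lambda>t. Re (f (z + of_real \<rho> * cis t))) = Re (f z)"
    using mean_holomorphic[OF assms] integral_Re[OF int] by (simp add: mean_def)
qed

lemma mean_affine:
  fixes g :: "real \<Rightarrow> real"
  assumes "integrable circ g"
  shows "integrable circ (\<lambda>t. c + d * g t)" "mean (\<lambda>t. c + d * g t) = c + d * mean g"
proof -
  have i: "integrable circ (\<lambda>t. d * g t)" using assms by simp
  show "integrable circ (\<lambda>t. c + d * g t)"
    by (rule Bochner_Integration.integrable_add[OF circ.integrable_const i])
  show "mean (\<lambda>t. c + d * g t) = c + d * mean g"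
    unfolding mean_def using circ.prob_space
    by (subst Bochner_Integration.integral_add[OF circ.integrable_const i]) simp
qed

text \<open>The gain \<rho>^2 over the value at the centre makes the squared modulus the strictly
  subharmonic perturbation in the maximum principles below.\<close>

lemma mean_norm_square:
  assumes "\<rho> > 0"
  shows "integrable circ (\<lambda>t. (cmod (z + of_real \<rho> * cis t))\<^sup>2)"
    "mean (\<lambda>t. (cmod (z + of_real \<rho> * cis t))\<^sup>2) = (cmod z)\<^sup>2 + \<rho>\<^sup>2"
proof -
  have eq: "(cmod (z + of_real \<rho> * cis t))\<^sup>2 = ((cmod z)\<^sup>2 + \<rho>\<^sup>2) + 2 * Re (cnj z * (0 + of_real \<rho> * cis t))" for t
  proof -
    have "\<rho>\<^sup>2 * (cos t)\<^sup>2 + \<rho>\<^sup>2 * (sin t)\<^sup>2 = \<rho>\<^sup>2"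
      by (simp flip: distrib_left)
    then show ?thesis
      by (simp add: cmod_power2 power2_sum power_mult_distrib algebra_simps)
  qed
  have h: "(\<lambda>w. cnj z * w) holomorphic_on cball 0 \<rho>" by (intro holomorphic_intros)
  note m = mean_Re_holomorphic[OF h assms]
  show "integrable circ (\<lambda>t. (cmod (z + of_real \<rho> * cis t))\<^sup>2)"
    unfolding eq by (rule mean_affine(1)[OF m(1)])
  show "mean (\<lambda>t. (cmod (z + of_real \<rho> * cis t))\<^sup>2) = (cmod z)\<^sup>2 + \<rho>\<^sup>2"
    unfolding eq mean_affine(2)[OF m(1)] m(2) by simp
qed

section \<open>Approximation by harmonic polynomials on a circle\<close>

text \<open>On the circle cnj z = r^2 / z, so a polynomial in Re z and Im z is a Laurent polynomial
  in z; the factor z^k clears the denominator.\<close>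

lemma real_polynomial_function_Laurent:
  assumes "real_polynomial_function g" "r > 0"
  shows "\<exists>p k. \<forall>z\<in>sphere 0 r. complex_of_real (g z) * z ^ k = poly p z"
  using assms(1)
proof (induction rule: real_polynomial_function.induct)
  case (linear f)
  interpret bounded_linear f by fact
  have "complex_of_real (f z) * z ^ 1 =
     poly [:of_real (r\<^sup>2 / 2) * (f 1 + \<i> * f \<i>), 0, (f 1 - \<i> * f \<i>) / 2:] z" if "z \<in> sphere 0 r" for z
  proof -
    have "z = Re z *\<^sub>R 1 + Im z *\<^sub>R \<i>" by (simp add: complex_eq_iff)
    then have fz: "f z = Re z * f 1 + Im z * f \<i>"
      by (metis add scaleR real_scaleR_def)
    have "complex_of_real (r\<^sup>2) = z * cnj z"
      using that complex_norm_square[of z] by simp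
    then have r2: "complex_of_real (r\<^sup>2 / 2) = z * cnj z / 2" by simp
    have xy: "complex_of_real (Re z) = (z + cnj z) / 2" "complex_of_real (Im z) = - (\<i> / 2) * (z - cnj z)"
      by (simp_all add: complex_eq_iff)
    have fz': "complex_of_real (f z) = (z + cnj z) / 2 * f 1 - (\<i> / 2) * (z - cnj z) * f \<i>"
      unfolding fz of_real_add of_real_mult xy by simp
    show ?thesis
      unfolding fz' r2 by (simp add: field_simps)
  qed
  then show ?case by blast
next
  case (const c)
  have "complex_of_real c * z ^ 0 = poly [:of_real c:] z" for z by simp
  then show ?case by blast
next
  case (add f g)
  then obtain p k q l where
    "\<forall>z\<in>sphere 0 r. complex_of_real (f z) * z ^ k = poly p z"
    "\<forall>z\<in>sphere 0 r. complex_of_real (g z) * z ^ l = poly q z" by blast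
  then have "\<forall>z\<in>sphere 0 r. complex_of_real (f z + g z) * z ^ (k + l) = poly (p * monom 1 l + q * monom 1 k) z"
    by (auto simp: poly_monom power_add algebra_simps)
  then show ?case by blast
next
  case (mult f g)
  then obtain p k q l where
    "\<forall>z\<in>sphere 0 r. complex_of_real (f z) * z ^ k = poly p z"
    "\<forall>z\<in>sphere 0 r. complex_of_real (g z) * z ^ l = poly q z" by blast
  then have "\<forall>z\<in>sphere 0 r. complex_of_real (f z * g z) * z ^ (k + l) = poly (p * q) z"
    by (auto simp: power_add algebra_simps)
  then show ?case by blast
qed

text \<open>On the circle, conjugation turns a negative power of z into a positive one.\<close>
lemma Laurent_Re_poly:
  assumes "r > 0"
  shows "\<exists>q. \<forall>z\<in>sphere 0 r. Re (poly p z / z ^ k) = Re (poly q z)"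
proof (induction k arbitrary: p)
  case 0
  then show ?case by (metis div_by_1 power_0)
next
  case (Suc k)
  obtain a p' where p: "p = pCons a p'" by (cases p)
  obtain q where q: "\<forall>z\<in>sphere 0 r. Re (poly p' z / z ^ k) = Re (poly q z)"
    using Suc by blast
  have "Re (poly p z / z ^ Suc k) = Re (poly (monom (cnj a / of_real (r ^ (2 * Suc k))) (Suc k) + q) z)"
    if z: "z \<in> sphere 0 r" for z
  proof -
    have "z \<noteq> 0" using z assms by auto
    then have "poly p z / z ^ Suc k = a / z ^ Suc k + poly p' z / z ^ k"
      by (simp add: p add_divide_distrib)
    moreover have "Re (a / z ^ Suc k) = Re (cnj a / of_real (r ^ (2 * Suc k)) * z ^ Suc k)"
    proof -
      have "complex_of_real (r\<^sup>2) = z * cnj z"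
        using z complex_norm_square[of z] by simp
      then have "of_real (r ^ (2 * Suc k)) = (z * cnj z) ^ Suc k"
        by (metis of_real_power power_mult)
      then have "cnj (a / z ^ Suc k) = cnj a / of_real (r ^ (2 * Suc k)) * z ^ Suc k"
        using \<open>z \<noteq> 0\<close> by (simp add: power_mult_distrib field_simps)
      then show ?thesis by (metis complex_cnj(1) cnj.sel(1))
    qed
    ultimately show ?thesis using q z by (simp add: poly_monom)
  qed
  then show ?case by blast
qed

text \<open>Stands in for solving the Dirichlet problem: Stone-Weierstrass polynomials agree on the
  circle with real parts of holomorphic polynomials, whose circular means are known exactly.\<close>

lemma harmonic_approximation:
  assumes "continuous_on (sphere 0 r) h" "r > 0" "\<epsilon> > 0"
  obtains p where "\<And>z. z \<in> sphere 0 r \<Longrightarrow> \<bar>h z - Re (poly p z)\<bar> < \<epsilon>"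
proof -
  obtain g where g: "real_polynomial_function g" "\<And>z. z \<in> sphere 0 r \<Longrightarrow> \<bar>h z - g z\<bar> < \<epsilon>"
    using Stone_Weierstrass_real_polynomial_function[OF compact_sphere assms(1,3)] by blast
  obtain p k where pk: "\<And>z. z \<in> sphere 0 r \<Longrightarrow> complex_of_real (g z) * z ^ k = poly p z"
    using real_polynomial_function_Laurent[OF g(1) assms(2)] by blast
  obtain q where q: "\<And>z. z \<in> sphere 0 r \<Longrightarrow> Re (poly p z / z ^ k) = Re (poly q z)"
    using Laurent_Re_poly[OF assms(2), of p k] by blast
  have "g z = Re (poly q z)" if "z \<in> sphere 0 r" for z
  proof -
    have "z \<noteq> 0" using that assms(2) by auto
    then have "complex_of_real (g z) = poly p z / z ^ k" using pk[OF that] by (simp add: field_simps)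
    then show ?thesis using q[OF that] by (metis Re_complex_of_real)
  qed
  then show ?thesis using g(2) that[of q] by auto
qed

section \<open>From local to global mean value inequalities\<close>

theorem local_submean_imp_global:
  fixes h :: "complex \<Rightarrow> real"
  assumes r: "r > 0" and h: "continuous_on (cball 0 r) h"
    and loc: "\<And>z \<epsilon>. z \<in> ball 0 r \<Longrightarrow> \<epsilon> > 0 \<Longrightarrow> \<exists>\<rho>>0. cball z \<rho> \<subseteq> ball 0 r \<and>
                h z \<le> mean (\<lambda>t. h (z + of_real \<rho> * cis t)) + \<epsilon> * \<rho>\<^sup>2"
  shows "h 0 \<le> mean (\<lambda>t. h (of_real r * cis t))"
proof (rule field_le_epsilon)
  fix e :: real assume "e > 0"
  \<comment> \<open>Three losses of \<epsilon> occur: the approximation at the maximum point, the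
    perturbation \<epsilon>' r^2 there, and the approximation under the boundary integral.\<close>
  define \<epsilon> where "\<epsilon> = e / 4"
  define \<epsilon>' where "\<epsilon>' = \<epsilon> / r\<^sup>2"
  have pos: "\<epsilon> > 0" "\<epsilon>' > 0" using \<open>e > 0\<close> r by (auto simp: \<epsilon>_def \<epsilon>'_def)
  have hs: "continuous_on (sphere 0 r) h" by (rule continuous_on_subset[OF h]) auto
  obtain p where p: "\<And>z. z \<in> sphere 0 r \<Longrightarrow> \<bar>h z - Re (poly p z)\<bar> < \<epsilon>"
    using harmonic_approximation[OF hs r pos(1)] by blast
  define k where "k z = h z - Re (poly p z) + \<epsilon>' * (cmod z)\<^sup>2" for z
  have k: "continuous_on (cball 0 r) k"
    unfolding k_def by (intro continuous_intros h)
  obtain z where z: "z \<in> cball 0 r" "\<And>w. w \<in> cball 0 r \<Longrightarrow> k w \<le> k z"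
    using continuous_attains_sup[OF compact_cball _ k] r by auto
  have hol: "poly p holomorphic_on S" for S by (intro holomorphic_intros)
  have "z \<notin> ball 0 r"
  proof
    assume zb: "z \<in> ball 0 r"
    obtain \<rho> where \<rho>: "\<rho> > 0" "cball z \<rho> \<subseteq> ball 0 r"
      "h z \<le> mean (\<lambda>t. h (z + of_real \<rho> * cis t)) + (\<epsilon>' / 2) * \<rho>\<^sup>2"
      using loc[OF zb, of "\<epsilon>' / 2"] pos by auto
    have "z + of_real \<rho> * cis t \<in> cball z \<rho>" for t
      using \<rho>(1) by (simp add: dist_norm norm_mult)
    then have mem: "z + of_real \<rho> * cis t \<in> cball 0 r" for t
      using \<rho>(2) ball_subset_cball by blast
    have ih: "integrable circ (\<lambda>t. h (z + of_real \<rho> * cis t))"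
      by (rule circ_integrable_continuous[OF continuous_on_subset[OF h]]) (use \<rho> in auto)
    note ip = mean_Re_holomorphic[OF hol \<rho>(1), of z]
    note sq = mean_norm_square[OF \<rho>(1), of z]
    have ik: "integrable circ (\<lambda>t. k (z + of_real \<rho> * cis t))"
      unfolding k_def using ih ip(1) sq(1) by (intro Bochner_Integration.integrable_add Bochner_Integration.integrable_diff integrable_mult_right)
    have "mean (\<lambda>t. k (z + of_real \<rho> * cis t)) =
        mean (\<lambda>t. h (z + of_real \<rho> * cis t)) - Re (poly p z) + \<epsilon>' * ((cmod z)\<^sup>2 + \<rho>\<^sup>2)"
      unfolding k_def using ih ip sq by (simp add: mean_def)
    moreover have "mean (\<lambda>t. k (z + of_real \<rho> * cis t)) \<le> mean (\<lambda>t::real. k z)"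
      by (rule mean_mono) (use ik z(2) mem in auto)
    moreover have "\<epsilon>' * \<rho>\<^sup>2 > 0" using pos \<rho> by simp
    ultimately show False using \<rho>(3) by (simp add: k_def algebra_simps)
  qed
  then have zs: "z \<in> sphere 0 r" using z(1) by auto
  then have "k z < \<epsilon> + \<epsilon>" using p[OF zs] r by (auto simp: k_def \<epsilon>'_def)
  then have 1: "h 0 < Re (poly p 0) + 2 * \<epsilon>"
    using z(2)[of 0] r by (simp add: k_def)
  have mem: "of_real r * cis t \<in> sphere 0 r" for t
    using r by (simp add: norm_mult)
  have ih: "integrable circ (\<lambda>t. h (of_real r * cis t))"
    using circ_integrable_continuous[OF hs] r by simp
  have "Re (poly p 0) = mean (\<lambda>t. Re (poly p (of_real r * cis t)))"
    using mean_Re_holomorphic(2)[OF hol r, of 0] by simp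
  also have "\<dots> \<le> mean (\<lambda>t. h (of_real r * cis t) + \<epsilon>)"
    using mean_Re_holomorphic(1)[OF hol r, of 0] ih
  proof (intro mean_mono)
    show "Re (poly p (of_real r * cis t)) \<le> h (of_real r * cis t) + \<epsilon>" for t
      using p[OF mem, of t] by linarith
  qed auto
  also have "\<dots> = mean (\<lambda>t. h (of_real r * cis t)) + \<epsilon>"
    unfolding mean_def using ih circ.prob_space by simp
  finally show "h 0 \<le> mean (\<lambda>t. h (of_real r * cis t)) + e"
    using 1 pos by (simp add: \<epsilon>_def)
qed

section \<open>Functions with the sub-mean value property\<close>

definition usc_on :: "'a::topological_space set \<Rightarrow> ('a \<Rightarrow> 'b::linorder) \<Rightarrow> bool" where
  "usc_on S f \<longleftrightarrow> (\<forall>c. openin (top_of_set S) {x\<in>S. f x < c})"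

lemma usc_on_compose:
  assumes "usc_on S f" "continuous_on T g" "g ` T \<subseteq> S"
  shows "usc_on T (\<lambda>x. f (g x))"
  unfolding usc_on_def
proof
  fix c
  have "openin (top_of_set T) (T \<inter> g -` {x\<in>S. f x < c})"
    by (rule continuous_openin_preimage[OF assms(2), of S]) (use assms(1,3) in \<open>auto simp: usc_on_def\<close>)
  moreover have "T \<inter> g -` {x\<in>S. f x < c} = {x\<in>T. f (g x) < c}"
    using assms(3) by auto
  ultimately show "openin (top_of_set T) {x\<in>T. f (g x) < c}" by simp
qed

lemma usc_on_continuous:
  fixes f :: "'a::topological_space \<Rightarrow> real"
  assumes "continuous_on S f"
  shows "usc_on S f"
  unfolding usc_on_def
proof
  fix c
  from assms have "openin (top_of_set S) (S \<inter> f -` {..<c})"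
    by (rule continuous_openin_preimage_gen) simp
  moreover have "S \<inter> f -` {..<c} = {x\<in>S. f x < c}" by auto
  ultimately show "openin (top_of_set S) {x\<in>S. f x < c}" by simp
qed

lemma usc_on_add:
  fixes f g :: "'a::topological_space \<Rightarrow> real"
  assumes "usc_on S f" "usc_on S g"
  shows "usc_on S (\<lambda>x. f x + g x)"
  unfolding usc_on_def
proof
  fix c
  have "{x\<in>S. f x + g x < c} = (\<Union>a. {x\<in>S. f x < a} \<inter> {x\<in>S. g x < c - a})"
  proof safe
    fix x assume "f x + g x < c"
    then obtain a where "f x < a" "a < c - g x" using dense[of "f x" "c - g x"] by auto
    then show "x \<in> (\<Union>a. {x\<in>S. f x < a} \<inter> {x\<in>S. g x < c - a})" if "x \<in> S"
      using that by (intro UN_I[of a]) auto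
  qed auto
  then show "openin (top_of_set S) {x\<in>S. f x + g x < c}"
    using assms unfolding usc_on_def by (auto intro!: openin_Union)
qed

lemma usc_attains_sup:
  fixes f :: "'a::topological_space \<Rightarrow> real"
  assumes "compact K" "K \<noteq> {}" "usc_on K f"
  shows "\<exists>x\<in>K. \<forall>y\<in>K. f y \<le> f x"
proof (rule ccontr)
  assume no: "\<not> ?thesis"
  have "\<exists>U. open U \<and> {x\<in>K. f x < f y} = K \<inter> U" for y
    using assms(3) unfolding usc_on_def openin_open by blast
  then obtain U where U: "\<And>y. open (U y)" "\<And>y. {x\<in>K. f x < f y} = K \<inter> U y" by metis
  have "K \<subseteq> (\<Union>y\<in>K. U y)"
  proof
    fix x assume "x \<in> K"
    then obtain y where "y \<in> K" "f x < f y" using no by (auto simp: not_le)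
    then show "x \<in> (\<Union>y\<in>K. U y)" using U(2)[of y] \<open>x \<in> K\<close> by blast
  qed
  then obtain F where F: "F \<subseteq> K" "finite F" "K \<subseteq> (\<Union>y\<in>F. U y)"
    using compactE_image[OF assms(1), of K U] U(1) by metis
  then have "F \<noteq> {}" using assms(2) by auto
  then have "Max (f ` F) \<in> f ` F" using F(2) by (intro Max_in) auto
  then obtain m where m: "m \<in> F" "Max (f ` F) = f m" by blast
  then have mmax: "f y \<le> f m" if "y \<in> F" for y
    using F(2) that Max_ge[of "f ` F" "f y"] by simp
  have "m \<in> K" using m(1) F(1) by blast
  then have "m \<in> (\<Union>y\<in>F. U y)" using F(3) by blast
  then obtain y where "y \<in> F" "m \<in> U y" by blast
  then have "f m < f y" using U(2)[of y] m F(1) by blast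
  then show False using mmax[OF \<open>y \<in> F\<close>] by simp
qed

text \<open>The bounds -N and 0 make every mean an integral of a bounded function; they hold for
  truncations of negative functions.\<close>

definition submean :: "complex set \<Rightarrow> real \<Rightarrow> (complex \<Rightarrow> real) \<Rightarrow> bool" where
  "submean S N f \<longleftrightarrow> (\<forall>z\<in>S. - N \<le> f z \<and> f z \<le> 0) \<and> usc_on S f \<and>
    (\<forall>z \<rho>. \<rho> > 0 \<longrightarrow> cball z \<rho> \<subseteq> S \<longrightarrow> f z \<le> mean (\<lambda>t. f (z + of_real \<rho> * cis t)))"

lemma usc_circle_measurable:
  fixes f :: "complex \<Rightarrow> 'b::{linorder_topology, second_countable_topology}"
  assumes "usc_on S f" "cball z \<rho> \<subseteq> S" "\<rho> \<ge> 0"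
  shows "(\<lambda>t. f (z + of_real \<rho> * cis t)) \<in> borel_measurable borel"
proof (rule borel_measurableI_less)
  fix c
  have "usc_on UNIV (\<lambda>t. f (z + of_real \<rho> * cis t))"
    by (rule usc_on_compose[OF assms(1)])
       (use assms(2,3) in \<open>auto intro!: continuous_intros subsetD[OF assms(2)] simp: dist_norm norm_mult\<close>)
  then have "open {t. f (z + of_real \<rho> * cis t) < c}"
    by (simp add: usc_on_def)
  then show "{t \<in> space borel. f (z + of_real \<rho> * cis t) < c} \<in> sets borel" by simp
qed

lemma submean_integrable:
  assumes "submean S N f" "cball z \<rho> \<subseteq> S" "\<rho> \<ge> 0"
  shows "integrable circ (\<lambda>t. f (z + of_real \<rho> * cis t))"
proof (rule circ_integrable_bounded[of _ N])
  show "(\<lambda>t. f (z + of_real \<rho> * cis t)) \<in> borel_measurable borel"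
    using assms usc_circle_measurable unfolding submean_def by blast
  show "norm (f (z + of_real \<rho> * cis t)) \<le> N" for t
  proof -
    have "z + of_real \<rho> * cis t \<in> S"
      using assms(2,3) by (auto intro!: subsetD[OF assms(2)] simp: dist_norm norm_mult)
    then have "- N \<le> f (z + of_real \<rho> * cis t)" "f (z + of_real \<rho> * cis t) \<le> 0"
      using assms(1) unfolding submean_def by blast+
    then show ?thesis by simp
  qed
qed

text \<open>For w in the disc the quotient w / z has positive real part, so the principal logarithm
  is holomorphic there and its real part is log |w| - log |z|.\<close>

lemma mean_ln_cmod:
  assumes "0 < \<rho>" "\<rho> < cmod z"
  shows "integrable circ (\<lambda>t. ln (cmod (z + of_real \<rho> * cis t)))"
    "mean (\<lambda>t. ln (cmod (z + of_real \<rho> * cis t))) = ln (cmod z)"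
proof -
  let ?L = "\<lambda>w. Ln (w / z)"
  have z: "z \<noteq> 0" using assms by auto
  have pos: "Re (w / z) > 0" if "w \<in> cball z \<rho>" for w
  proof -
    have "cmod (w / z - 1) = cmod (w - z) / cmod z"
      using z by (simp add: norm_divide[symmetric] diff_divide_distrib)
    also have "\<dots> < 1" using that assms by (auto simp: dist_norm norm_minus_commute divide_less_eq)
    finally have "\<bar>Re (w / z - 1)\<bar> < 1" using abs_Re_le_cmod order.strict_trans1 by blast
    then show ?thesis by simp
  qed
  have L: "?L holomorphic_on cball z \<rho>"
  proof (intro holomorphic_intros)
    show "w / z \<notin> \<real>\<^sub>\<le>\<^sub>0" if "w \<in> cball z \<rho>" for w
      using pos[OF that] complex_nonpos_Reals_iff by auto
  qed (use z in auto)
  have eq: "ln (cmod w) = ln (cmod z) + Re (?L w)" if "w \<in> cball z \<rho>" for w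
  proof -
    have "w \<noteq> 0" using pos[OF that] by auto
    then show ?thesis using z by (simp add: Re_Ln norm_divide ln_div)
  qed
  have mem: "z + of_real \<rho> * cis t \<in> cball z \<rho>" for t
    using assms by (simp add: dist_norm norm_mult)
  note m = mean_Re_holomorphic[OF L assms(1)]
  show "integrable circ (\<lambda>t. ln (cmod (z + of_real \<rho> * cis t)))"
    unfolding eq[OF mem] using m(1) by simp
  show "mean (\<lambda>t. ln (cmod (z + of_real \<rho> * cis t))) = ln (cmod z)"
    unfolding eq[OF mem] mean_def using m circ.prob_space z by (simp add: mean_def)
qed

text \<open>Comparison with a radial harmonic function, as in the three circles theorem. The term
  \<epsilon> |z|^2 makes the difference strictly subharmonic, so its maximum cannot be interior;
  \<epsilon> = e / R^2 keeps the loss below e.\<close>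

lemma annulus_log_bound:
  assumes f: "submean S N f" and S: "{z. \<delta> \<le> cmod z \<and> cmod z \<le> R} \<subseteq> S" and \<delta>: "0 < \<delta>"
    and bd: "\<And>z. cmod z = \<delta> \<or> cmod z = R \<Longrightarrow> f z \<le> \<alpha> + \<beta> * ln (cmod z)"
    and w: "\<delta> \<le> cmod w" "cmod w \<le> R"
  shows "f w \<le> \<alpha> + \<beta> * ln (cmod w)"
proof (rule field_le_epsilon)
  fix e :: real assume "e > 0"
  have R: "R > 0" using \<delta> w by linarith
  define \<epsilon> where "\<epsilon> = e / R\<^sup>2"
  have \<epsilon>: "\<epsilon> > 0" using \<open>e > 0\<close> R by (simp add: \<epsilon>_def)
  let ?K = "{z. \<delta> \<le> cmod z \<and> cmod z \<le> R}"
  have "?K = cball 0 R - ball 0 \<delta>" by auto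
  then have K: "compact ?K" by (metis compact_cball compact_diff open_ball)
  define k where "k z = f z + (\<epsilon> * (cmod z)\<^sup>2 - \<beta> * ln (cmod z))" for z
  have uf: "usc_on ?K f"
    using usc_on_compose[of S f ?K "\<lambda>x. x"] f S by (auto simp: submean_def)
  have "usc_on ?K k"
    unfolding k_def using \<delta> by (intro usc_on_add[OF uf] usc_on_continuous continuous_intros) auto
  then obtain z where z: "z \<in> ?K" "\<And>y. y \<in> ?K \<Longrightarrow> k y \<le> k z"
    using usc_attains_sup[OF K] w by blast
  have "cmod z = \<delta> \<or> cmod z = R"
  proof (rule ccontr)
    assume no: "\<not> ?thesis"
    define \<rho> where "\<rho> = min (cmod z - \<delta>) (R - cmod z)"
    have \<rho>: "\<rho> > 0" "\<rho> < cmod z" using no z(1) \<delta> by (auto simp: \<rho>_def)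
    have sub: "cball z \<rho> \<subseteq> ?K"
    proof
      fix y assume "y \<in> cball z \<rho>"
      then have "cmod (y - z) \<le> \<rho>" by (simp add: dist_norm norm_minus_commute)
      moreover have "cmod y \<le> cmod z + cmod (y - z)" "cmod z \<le> cmod y + cmod (y - z)"
        using norm_triangle_ineq[of z "y - z"] norm_triangle_ineq[of y "z - y"] by (auto simp: norm_minus_commute)
      ultimately show "y \<in> ?K" by (auto simp: \<rho>_def)
    qed
    have mem: "z + of_real \<rho> * cis t \<in> ?K" for t
      using \<rho> by (intro subsetD[OF sub]) (simp add: dist_norm norm_mult)
    have fi: "integrable circ (\<lambda>t. f (z + of_real \<rho> * cis t))"
      using submean_integrable[OF f, of z \<rho>] sub S \<rho> by auto
    have fm: "f z \<le> mean (\<lambda>t. f (z + of_real \<rho> * cis t))"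
      using f sub S \<rho> unfolding submean_def by (meson order_trans)
    note sq = mean_norm_square[OF \<rho>(1), of z] and il = mean_ln_cmod[OF \<rho>]
    have ki: "integrable circ (\<lambda>t. k (z + of_real \<rho> * cis t))"
      unfolding k_def using fi sq(1) il(1) by (intro Bochner_Integration.integrable_add Bochner_Integration.integrable_diff integrable_mult_right)
    have "mean (\<lambda>t. k (z + of_real \<rho> * cis t)) =
       mean (\<lambda>t. f (z + of_real \<rho> * cis t)) + (\<epsilon> * ((cmod z)\<^sup>2 + \<rho>\<^sup>2) - \<beta> * ln (cmod z))"
      unfolding k_def using fi sq il by (simp add: mean_def)
    moreover have "mean (\<lambda>t. k (z + of_real \<rho> * cis t)) \<le> mean (\<lambda>t::real. k z)"
      by (rule mean_mono) (use ki z(2) mem in auto)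
    moreover have "\<epsilon> * \<rho>\<^sup>2 > 0" using \<epsilon> \<rho> by simp
    ultimately show False using fm by (simp add: k_def algebra_simps)
  qed
  then have "k z \<le> \<alpha> + \<epsilon> * (cmod z)\<^sup>2" using bd[of z] by (simp add: k_def)
  also have "\<epsilon> * (cmod z)\<^sup>2 \<le> \<epsilon> * R\<^sup>2" using z(1) \<epsilon> by (intro mult_left_mono power_mono) auto
  also have "\<epsilon> * R\<^sup>2 = e" using R by (simp add: \<epsilon>_def)
  finally have "k z \<le> \<alpha> + e" by simp
  moreover have "k w \<le> k z" using z(2) w by auto
  moreover have "0 \<le> \<epsilon> * (cmod w)\<^sup>2" using \<epsilon> by simp
  ultimately show "f w \<le> \<alpha> + \<beta> * ln (cmod w) + e" by (simp add: k_def)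
qed

lemma submean_translate:
  assumes "submean S N f"
  shows "submean ((\<lambda>z. z - a) ` S) N (\<lambda>z. f (a + z))"
  unfolding submean_def
proof (intro conjI allI impI ballI)
  let ?T = "(\<lambda>z. z - a) ` S"
  show "- N \<le> f (a + z)" "f (a + z) \<le> 0" if "z \<in> ?T" for z
    using that assms by (auto simp: submean_def)
  show "usc_on ?T (\<lambda>z. f (a + z))"
    by (rule usc_on_compose[of S]) (use assms in \<open>auto simp: submean_def intro!: continuous_intros\<close>)
  fix z \<rho> assume \<rho>: "0 < (\<rho>::real)" "cball z \<rho> \<subseteq> ?T"
  have "cball (a + z) \<rho> \<subseteq> S"
  proof
    fix w assume "w \<in> cball (a + z) \<rho>"
    then have "w - a \<in> cball z \<rho>" by (simp add: dist_norm algebra_simps)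
    then have "w - a \<in> ?T" using \<rho>(2) by blast
    then show "w \<in> S" by auto
  qed
  then have "f (a + z) \<le> mean (\<lambda>t. f (a + z + of_real \<rho> * cis t))"
    using assms \<rho>(1) unfolding submean_def by blast
  then show "f (a + z) \<le> mean (\<lambda>t. f (a + (z + of_real \<rho> * cis t)))" by (simp add: add.assoc)
qed

text \<open>Upper semicontinuity bounds g by nearly g(0) on a small circle of radius \<delta>. The
  barrier S + \<beta> log(|z| / \<delta>) dominates g there and on a far circle, hence between; then
  \<beta> tends to 0.\<close>

theorem submean_Liouville:
  assumes "submean UNIV N f"
  shows "f a = f b"
proof -
  have "f b \<le> f a" for a b
  proof (cases "a = b")
    case False
    define g where "g z = f (a + z)" for z
    have "(\<lambda>z. z - a) ` UNIV = (UNIV :: complex set)" by (metis surj_diff_right)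
    then have g: "submean UNIV N g" using submean_translate[OF assms, of a] unfolding g_def by simp
    then have g0: "\<And>z. g z \<le> 0" by (simp add: submean_def)
    define w where "w = b - a"
    have w: "cmod w > 0" using False by (simp add: w_def)
    have "g w \<le> g 0"
    proof (rule field_le_epsilon)
      fix e :: real assume "e > 0"
      have "open {z. g z < g 0 + e}" using g by (simp add: submean_def usc_on_def)
      then obtain d where d: "d > 0" "ball 0 d \<subseteq> {z. g z < g 0 + e}"
        using \<open>e > 0\<close> openE[of "{z. g z < g 0 + e}" 0] by auto
      define \<delta> where "\<delta> = min (d / 2) (cmod w)"
      have \<delta>: "0 < \<delta>" "\<delta> \<le> cmod w" "\<delta> < d" using d w by (auto simp: \<delta>_def)
      define S where "S = min 0 (g 0 + e)"
      have gS: "g z \<le> S" if "cmod z = \<delta>" for z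
        using subsetD[OF d(2), of z] \<delta> that g0[of z] by (auto simp: S_def)
      have le: "g w \<le> S + \<beta> * ln (cmod w / \<delta>)" if "\<beta> > 0" for \<beta>
      proof -
        \<comment> \<open>On the outer circle nothing but g \<le> 0 is known, so R is taken so large
          that the barrier is nonnegative there.\<close>
        define R where "R = max (cmod w) (\<delta> * exp (- S / \<beta>))"
        have R: "cmod w \<le> R" "\<delta> * exp (- S / \<beta>) \<le> R" "R > 0" using w by (auto simp: R_def less_max_iff_disj)
        have "exp (- S / \<beta>) \<le> R / \<delta>" using R(2) \<delta>(1) by (simp add: field_simps)
        then have "- S / \<beta> \<le> ln (R / \<delta>)" using R(3) \<delta>(1) by (simp add: ln_ge_iff)
        then have "- S \<le> ln (R / \<delta>) * \<beta>" using pos_divide_le_eq[OF that, of "- S"] by simp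
        then have SR: "0 \<le> S - \<beta> * ln \<delta> + \<beta> * ln R"
          using R(3) \<delta>(1) by (simp add: ln_div algebra_simps)
        have "g w \<le> (S - \<beta> * ln \<delta>) + \<beta> * ln (cmod w)"
        proof (rule annulus_log_bound[OF g _ \<delta>(1) _ \<delta>(2) R(1)])
          fix z :: complex assume "cmod z = \<delta> \<or> cmod z = R"
          then show "g z \<le> S - \<beta> * ln \<delta> + \<beta> * ln (cmod z)"
            using gS[of z] g0[of z] SR by fastforce
        qed auto
        then show ?thesis using w \<delta>(1) by (simp add: ln_div algebra_simps)
      qed
      have "g w \<le> S"
      proof (rule field_le_epsilon)
        fix e' :: real assume e': "e' > 0"
        define L where "L = ln (cmod w / \<delta>)"
        have L: "L \<ge> 0" unfolding L_def using \<delta> w by (intro ln_ge_zero) simp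
        have "e' / (L + 1) * L \<le> e'" using L e' by (simp add: field_simps)
        then show "g w \<le> S + e'" using le[of "e' / (L + 1)"] L e' by (simp add: L_def)
      qed
      then show "g w \<le> g 0 + e" by (simp add: S_def)
    qed
    then show ?thesis by (simp add: g_def w_def)
  qed simp
  then show ?thesis by (intro antisym)
qed

text \<open>For x \<le> 0 the maximum is finite, so \<open>real_of_ereal\<close> loses nothing; the
  truncations at all levels together determine x.\<close>

definition trunc :: "real \<Rightarrow> ereal \<Rightarrow> real" where
  "trunc N x = real_of_ereal (max x (ereal (- N)))"

lemma trunc:
  assumes "x \<le> 0" "N \<ge> 0"
  shows "ereal (trunc N x) = max x (ereal (- N))" "- N \<le> trunc N x" "trunc N x \<le> 0"
    "x \<le> ereal (trunc N x)"
  using assms by (cases x; auto simp: trunc_def max_def zero_ereal_def)+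

lemma usc_trunc:
  fixes u :: "'a::topological_space \<Rightarrow> ereal"
  assumes "usc_on S u" "\<And>x. x \<in> S \<Longrightarrow> u x \<le> 0" "N \<ge> 0"
  shows "usc_on S (\<lambda>x. trunc N (u x))"
  unfolding usc_on_def
proof
  fix c
  have "trunc N (u x) < c \<longleftrightarrow> u x < ereal c \<and> - N < c" if "x \<in> S" for x
  proof -
    have "trunc N (u x) < c \<longleftrightarrow> ereal (trunc N (u x)) < ereal c" by simp
    then show ?thesis unfolding trunc(1)[OF assms(2)[OF that] assms(3)] by simp
  qed
  then have "{x\<in>S. trunc N (u x) < c} = (if - N < c then {x\<in>S. u x < ereal c} else {})"
    by auto
  then show "openin (top_of_set S) {x\<in>S. trunc N (u x) < c}"
    using assms(1) by (simp add: usc_on_def)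
qed

text \<open>The barrier is (1 - \<epsilon>) log(|z| / R). Near the pole the spare term \<epsilon>
  log |z| absorbs the unknown constant C, and on the outer circle the barrier is 0; then \<epsilon>
  tends to 0.\<close>

theorem submean_Schwarz:
  fixes U :: "complex \<Rightarrow> ereal"
  assumes sub: "\<And>N. N \<ge> 0 \<Longrightarrow> submean (cball 0 R) N (\<lambda>z. trunc N (U z))"
    and neg: "\<And>z. z \<in> cball 0 R \<Longrightarrow> U z \<le> 0"
    and pole: "\<And>z. 0 < cmod z \<Longrightarrow> cmod z < \<delta>0 \<Longrightarrow> U z \<le> ereal (ln (cmod z) + C)" and "\<delta>0 > 0"
    and w: "0 < cmod w" "cmod w \<le> R"
  shows "U w \<le> ereal (ln (cmod w / R))"
proof -
  have R: "R > 0" using w by linarith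
  have eps: "U w \<le> ereal ((1 - \<epsilon>) * ln (cmod w / R))" if \<epsilon>: "0 < \<epsilon>" "\<epsilon> < 1" for \<epsilon>
  proof -
    define \<beta> where "\<beta> = 1 - \<epsilon>"
    \<comment> \<open>The exponential is the radius at which \<epsilon> ln \<delta> reaches - C -
      \<beta> ln R.\<close>
    define \<delta> where "\<delta> = min (min (\<delta>0 / 2) (cmod w)) (exp ((- C - \<beta> * ln R) / \<epsilon>))"
    have \<delta>: "0 < \<delta>" "\<delta> < \<delta>0" "\<delta> \<le> cmod w" "\<delta> \<le> exp ((- C - \<beta> * ln R) / \<epsilon>)"
      using \<open>\<delta>0 > 0\<close> w by (auto simp: \<delta>_def)
    have "ln \<delta> \<le> (- C - \<beta> * ln R) / \<epsilon>"
      using \<delta>(1,4) by (metis exp_gt_zero ln_exp ln_le_cancel_iff)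
    then have "\<epsilon> * ln \<delta> \<le> - C - \<beta> * ln R" using \<epsilon>(1) by (simp add: field_simps)
    then have d: "ln \<delta> + C \<le> - \<beta> * ln R + \<beta> * ln \<delta>" by (simp add: \<beta>_def algebra_simps)
    \<comment> \<open>The truncation level must not rise above the barrier on the inner
      circle.\<close>
    define N where "N = max 0 (\<beta> * ln R - \<beta> * ln \<delta>)"
    have N: "N \<ge> 0" "- N \<le> - \<beta> * ln R + \<beta> * ln \<delta>" by (auto simp: N_def)
    have "trunc N (U w) \<le> - \<beta> * ln R + \<beta> * ln (cmod w)"
    proof (rule annulus_log_bound[OF sub[OF N(1)] _ \<delta>(1) _ \<delta>(3) w(2)])
      fix z :: complex assume z: "cmod z = \<delta> \<or> cmod z = R"
      have zR: "z \<in> cball 0 R" using z \<delta>(3) w(2) by auto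
      show "trunc N (U z) \<le> - \<beta> * ln R + \<beta> * ln (cmod z)"
      proof (cases "cmod z = R")
        case True
        then show ?thesis using trunc(3)[OF neg[OF zR] N(1)] by simp
      next
        case False
        then have z: "cmod z = \<delta>" using z by simp
        have "ereal (trunc N (U z)) \<le> max (ereal (ln \<delta> + C)) (ereal (- N))"
          unfolding trunc(1)[OF neg[OF zR] N(1)] using pole[of z] z \<delta> by (intro max.mono) auto
        also have "\<dots> \<le> ereal (- \<beta> * ln R + \<beta> * ln \<delta>)" using d N(2) by simp
        finally show ?thesis using z by simp
      qed
    qed auto
    then have "ereal (trunc N (U w)) \<le> ereal ((1 - \<epsilon>) * ln (cmod w / R))"
      using w R by (simp add: \<beta>_def ln_div algebra_simps)
    then show ?thesis using trunc(4)[of "U w" N] neg[of w] w N(1) by (auto intro: order_trans)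
  qed
  define a where "a = ln (cmod w / R)"
  show ?thesis unfolding a_def[symmetric]
  proof (rule ereal_le_epsilon2)
    fix e :: real assume e: "0 < e"
    define \<epsilon> where "\<epsilon> = min (1/2) (e / (\<bar>a\<bar> + 1))"
    have \<epsilon>: "0 < \<epsilon>" "\<epsilon> < 1" "\<epsilon> \<le> e / (\<bar>a\<bar> + 1)" using e by (auto simp: \<epsilon>_def)
    then have "\<epsilon> * (\<bar>a\<bar> + 1) \<le> e" by (simp add: le_divide_eq add_pos_nonneg)
    moreover have "- (\<epsilon> * a) \<le> \<epsilon> * (\<bar>a\<bar> + 1)"
      using \<epsilon>(1) by (metis abs_ge_minus_self add_increasing2 mult_left_mono mult_minus_right less_imp_le zero_le_one)
    ultimately have "(1 - \<epsilon>) * a \<le> a + e" by (simp add: algebra_simps)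
    then show "U w \<le> ereal a + ereal e"
      using eps[OF \<epsilon>(1,2)] unfolding a_def by (auto intro: order_trans)
  qed
qed

section \<open>Negative plurisubharmonic functions\<close>

lemma neg_psh_usc: "neg_psh sc D u \<Longrightarrow> usc_on D u"
  by (simp add: neg_psh_def usc_on_def)

lemma neg_psh_neg: "neg_psh sc D u \<Longrightarrow> x \<in> D \<Longrightarrow> u x \<le> 0"
  by (auto simp: neg_psh_def intro: less_imp_le)

lemma trunc_eqI:
  assumes "x \<le> 0" "y \<le> 0" "\<And>N. N \<ge> 0 \<Longrightarrow> trunc N x = trunc N y"
  shows "x = y"
proof (rule ccontr)
  assume "x \<noteq> y"
  then obtain c where c: "(x < ereal c \<and> ereal c < y) \<or> (y < ereal c \<and> ereal c < x)"
    using ereal_dense2 by (metis neqE)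
  then have "ereal c < 0"
    using less_le_trans[OF _ assms(1), of "ereal c"] less_le_trans[OF _ assms(2), of "ereal c"] by blast
  then have "c \<le> 0" by simp
  then have "max x (ereal c) = max y (ereal c)"
    using assms(3)[of "- c"] trunc(1)[OF assms(1), of "- c"] trunc(1)[OF assms(2), of "- c"] by simp
  then show False using c by (auto simp: max_def split: if_splits)
qed

lemma trunc_measurable:
  assumes [measurable]: "U \<in> borel_measurable borel"
  shows "(\<lambda>t. trunc N (U t)) \<in> borel_measurable borel"
  unfolding trunc_def by measurable

lemma trunc_integrable:
  assumes "U \<in> borel_measurable borel" "\<And>t. U t \<le> 0" "N \<ge> 0"
  shows "integrable circ (\<lambda>t. trunc N (U t))"
proof (rule circ_integrable_bounded[of _ N])
  show "norm (trunc N (U t)) \<le> N" for t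
    using trunc(2,3)[OF assms(2,3), of t] by simp
qed (rule trunc_measurable[OF assms(1)])

lemma nn_integral_trunc:
  assumes "U \<in> borel_measurable borel" "\<And>t. U t \<le> 0" "N \<ge> 0"
  shows "(\<integral>\<^sup>+t. ennreal (- trunc N (U t)) \<partial>circ) = ennreal (- mean (\<lambda>t. trunc N (U t)))"
proof -
  have "(\<integral>\<^sup>+t. ennreal (- trunc N (U t)) \<partial>circ) = ennreal (integral\<^sup>L circ (\<lambda>t. - trunc N (U t)))"
    by (rule nn_integral_eq_integral) (use trunc_integrable[OF assms] trunc(3)[OF assms(2,3)] in auto)
  then show ?thesis by (simp add: mean_def)
qed

text \<open>Truncation only raises values, so the integral of the negatives decreases while x is
  kept if x \<ge> -N. For smaller x the left side is the least value -N.\<close>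

lemma trunc_mean_le:
  assumes U[measurable]: "U \<in> borel_measurable borel" and neg: "\<And>t. U t \<le> 0" "x \<le> 0" and N: "N \<ge> 0"
    and int: "(\<integral>\<^sup>+t\<in>{0..2*pi}. e2ennreal (- U t) \<partial>lborel) \<le> ennreal (2*pi) * e2ennreal (- x)"
  shows "trunc N x \<le> mean (\<lambda>t. trunc N (U t))"
proof (cases "x \<ge> ereal (- N)")
  case False
  then have "ereal (trunc N x) = ereal (- N)" unfolding trunc(1)[OF neg(2) N] by (auto simp: max_def)
  then have "trunc N x = mean (\<lambda>t::real. - N)" by simp
  also have "\<dots> \<le> mean (\<lambda>t. trunc N (U t))"
    by (rule mean_mono) (use trunc_integrable[OF U neg(1) N] trunc(2)[OF neg(1) N] in auto)
  finally show ?thesis .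
next
  case True
  then obtain v where v: "x = ereal v" using neg(2) by (cases x) auto
  then have v2: "trunc N x = v" "v \<le> 0" using True neg(2) by (auto simp: trunc_def max_def)
  have "ennreal (2*pi) * (\<integral>\<^sup>+t. e2ennreal (- U t) \<partial>circ) \<le> ennreal (2*pi) * e2ennreal (- x)"
    using int by (subst (asm) nn_integral_circ) measurable
  then have le: "(\<integral>\<^sup>+t. e2ennreal (- U t) \<partial>circ) \<le> e2ennreal (- x)"
    by (subst (asm) ennreal_mult_le_mult_iff) auto
  have "ennreal (- mean (\<lambda>t. trunc N (U t))) = (\<integral>\<^sup>+t. ennreal (- trunc N (U t)) \<partial>circ)"
    by (rule nn_integral_trunc[OF U neg(1) N, symmetric])
  also have "\<dots> \<le> (\<integral>\<^sup>+t. e2ennreal (- U t) \<partial>circ)"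
  proof (rule nn_integral_mono)
    fix t
    have "ereal (- trunc N (U t)) \<le> - U t"
      using trunc(4)[OF neg(1) N, of t] by (metis ereal_minus_le_minus uminus_ereal.simps(1))
    then show "ennreal (- trunc N (U t)) \<le> e2ennreal (- U t)"
      unfolding ennreal.rep_eq[symmetric] by (metis e2ennreal_ereal e2ennreal_mono)
  qed
  also note le
  also have "e2ennreal (- x) = ennreal (- v)" by (simp add: v)
  finally have "- mean (\<lambda>t. trunc N (U t)) \<le> - v"
    using v2(2) by (subst (asm) ennreal_le_iff) auto
  then show ?thesis using v2 by simp
qed

text \<open>Converse passage by monotone convergence: the negated truncations increase to -U, also
  where U is -\<infinity>.\<close>

lemma trunc_mean_imp_nn_integral:
  assumes U[measurable]: "U \<in> borel_measurable borel" and neg: "\<And>t. U t \<le> 0" "x \<le> 0"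
    and le: "\<And>N::nat. trunc (real N) x \<le> mean (\<lambda>t. trunc (real N) (U t))"
  shows "(\<integral>\<^sup>+t\<in>{0..2*pi}. e2ennreal (- U t) \<partial>lborel) \<le> ennreal (2*pi) * e2ennreal (- x)"
proof -
  define h where "h N t = ennreal (- trunc (real N) (U t))" for N :: nat and t
  have bound: "ennreal (- trunc (real N) y) \<le> e2ennreal (- y)" if "y \<le> 0" for N y
  proof -
    have "ereal (- trunc N y) \<le> - y"
      using trunc(4)[OF that, of N] by (metis ereal_minus_le_minus uminus_ereal.simps(1) of_nat_0_le_iff)
    then show ?thesis by (metis e2ennreal_ereal e2ennreal_mono)
  qed
  have [measurable]: "h N \<in> borel_measurable circ" for N
    unfolding h_def using trunc_measurable[OF U, of N] by measurable
  have "incseq h"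
  proof (intro incseq_SucI le_funI)
    fix N t
    have "ereal (trunc (real (Suc N)) (U t)) \<le> ereal (trunc (real N) (U t))"
      unfolding trunc(1)[OF neg(1) of_nat_0_le_iff] by (intro max.mono) auto
    then show "h N t \<le> h (Suc N) t" unfolding h_def by (intro ennreal_leI) simp
  qed
  have "(\<integral>\<^sup>+t. e2ennreal (- U t) \<partial>circ) \<le> (\<integral>\<^sup>+t. (SUP N. h N t) \<partial>circ)"
  proof (rule nn_integral_mono)
    fix t
    show "e2ennreal (- U t) \<le> (SUP N. h N t)"
    proof (cases "U t")
      case (real r)
      obtain N :: nat where N: "- r \<le> real N" using real_arch_simple by blast
      have "h N t = ennreal (- r)"
        using N neg(1)[of t] real by (simp add: h_def trunc_def max_def)
      then have "e2ennreal (- U t) = h N t" using real by simp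
      then show ?thesis by (metis SUP_upper UNIV_I)
    next
      case MInf
      then have "h N t = of_nat N" for N
        by (simp add: h_def trunc_def max_def ennreal_of_nat_eq_real_of_nat)
      then show ?thesis by (simp add: ennreal_SUP_of_nat_eq_top)
    qed (use neg(1)[of t] in auto)
  qed
  also have "\<dots> = (SUP N. \<integral>\<^sup>+t. h N t \<partial>circ)"
    by (rule nn_integral_monotone_convergence_SUP[OF \<open>incseq h\<close>]) simp
  also have "\<dots> \<le> e2ennreal (- x)"
  proof (rule SUP_least)
    fix N :: nat
    have "(\<integral>\<^sup>+t. h N t \<partial>circ) = ennreal (- mean (\<lambda>t. trunc (real N) (U t)))"
      unfolding h_def by (rule nn_integral_trunc[OF U neg(1)]) simp
    also have "\<dots> \<le> ennreal (- trunc (real N) x)" using le[of N] by (intro ennreal_leI) simp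
    also have "\<dots> \<le> e2ennreal (- x)" by (rule bound[OF neg(2)])
    finally show "(\<integral>\<^sup>+t. h N t \<partial>circ) \<le> e2ennreal (- x)" .
  qed
  finally have "(\<integral>\<^sup>+t. e2ennreal (- U t) \<partial>circ) \<le> e2ennreal (- x)" .
  then show ?thesis
    by (subst nn_integral_circ) (auto intro: mult_left_mono)
qed

text \<open>Reduces several variables to one: a disc inside S, moved to its own centre, is an affine
  disc as in \<open>neg_psh\<close>.\<close>

lemma neg_psh_submean:
  assumes u: "neg_psh sc D u" and sc: "bounded_bilinear sc"
    and S: "\<And>z. z \<in> S \<Longrightarrow> a + sc z b \<in> D" and N: "N \<ge> 0"
  shows "submean S N (\<lambda>z. trunc N (u (a + sc z b)))"
  unfolding submean_def
proof (intro conjI ballI allI impI)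
  interpret bounded_bilinear sc by fact
  have cont: "continuous_on T (\<lambda>z. a + sc z b)" for T
    by (intro continuous_intros continuous_on)
  note neg = neg_psh_neg[OF u]
  show "- N \<le> trunc N (u (a + sc z b))" "trunc N (u (a + sc z b)) \<le> 0" if "z \<in> S" for z
    using trunc(2,3)[OF neg[OF S[OF that]] N] by auto
  have usc: "usc_on S (\<lambda>z. u (a + sc z b))"
    by (rule usc_on_compose[OF neg_psh_usc[OF u] cont]) (use S in auto)
  then show "usc_on S (\<lambda>z. trunc N (u (a + sc z b)))"
    by (rule usc_trunc) (use neg S N in auto)
  fix z \<rho> assume \<rho>: "0 < (\<rho>::real)" "cball z \<rho> \<subseteq> S"
  have split: "a + sc (z + of_real \<rho> * cis t) b = (a + sc z b) + sc (of_real \<rho> * cis t) b" for t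
    by (simp add: add_left add.assoc)
  have mem: "z + of_real \<rho> * cis t \<in> S" for t
    using \<rho> by (intro subsetD[OF \<rho>(2)]) (simp add: dist_norm norm_mult)
  have disc: "a + sc z b + sc w b \<in> D" if "cmod w \<le> \<rho>" for w
  proof -
    have "z + w \<in> S" using that by (intro subsetD[OF \<rho>(2)]) (simp add: dist_norm)
    from S[OF this] show ?thesis by (simp add: add_left add.assoc)
  qed
  show "trunc N (u (a + sc z b)) \<le> mean (\<lambda>t. trunc N (u (a + sc (z + of_real \<rho> * cis t) b)))"
  proof (rule trunc_mean_le[OF _ _ _ N])
    show "(\<lambda>t. u (a + sc (z + of_real \<rho> * cis t) b)) \<in> borel_measurable borel"
      by (rule usc_circle_measurable[OF usc \<rho>(2)]) (use \<rho> in simp)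
    show "u (a + sc (z + of_real \<rho> * cis t) b) \<le> 0" for t
      by (rule neg[OF S[OF mem]])
    show "u (a + sc z b) \<le> 0" using disc[of 0] \<rho> neg by (simp add: zero_left)
    show "(\<integral>\<^sup>+t\<in>{0..2*pi}. e2ennreal (- u (a + sc (z + of_real \<rho> * cis t) b)) \<partial>lborel)
        \<le> ennreal (2*pi) * e2ennreal (- u (a + sc z b))"
      unfolding split using u \<rho>(1) disc unfolding neg_psh_def by blast
  qed
qed

theorem neg_psh_Liouville:
  assumes u: "neg_psh sc D u" and sc: "bounded_bilinear sc"
    and D: "\<And>z. a + sc z b \<in> D"
  shows "u (a + sc z b) = u (a + sc w b)"
proof (rule trunc_eqI)
  show "u (a + sc z b) \<le> 0" "u (a + sc w b) \<le> 0" using neg_psh_neg[OF u] D by auto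
  show "trunc N (u (a + sc z b)) = trunc N (u (a + sc w b))" if "N \<ge> 0" for N
    by (rule submean_Liouville[OF neg_psh_submean[OF u sc D that]])
qed

section \<open>Logarithmic poles and the Schwarz lemma for competitors\<close>

definition log_pole :: "'a::real_normed_vector \<Rightarrow> ('a \<Rightarrow> ereal) \<Rightarrow> bool" where
  "log_pole p u \<longleftrightarrow> (\<exists>C::real. \<forall>\<^sub>F w in at p. u w \<le> ereal (ln (norm (w - p)) + C))"

lemma green_alt: "green sc D p z = Sup {u z | u. neg_psh sc D u \<and> log_pole p u}"
  by (simp add: green_def log_pole_def)

lemma log_pole_line:
  assumes "log_pole p u" and sc: "\<And>z. norm (sc z b) = cmod z * norm b" and b: "b \<noteq> 0"
  obtains \<delta> C where "\<delta> > 0" "\<And>z. 0 < cmod z \<Longrightarrow> cmod z < \<delta> \<Longrightarrow> u (p + sc z b) \<le> ereal (ln (cmod z) + C)"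
proof -
  obtain C d where d: "d > 0" "\<And>w. w \<noteq> p \<Longrightarrow> dist w p < d \<Longrightarrow> u w \<le> ereal (ln (norm (w - p)) + C)"
    using assms(1) unfolding log_pole_def eventually_at by auto
  show ?thesis
  proof (rule that[of "d / norm b" "ln (norm b) + C"])
    show "d / norm b > 0" using d b by simp
    fix z assume z: "0 < cmod z" "cmod z < d / norm b"
    then have n: "norm (sc z b) < d" "norm (sc z b) > 0"
      using b sc[of z] by (auto simp: field_simps)
    then have "u (p + sc z b) \<le> ereal (ln (norm (sc z b)) + C)"
      using d(2)[of "p + sc z b"] by (auto simp: dist_norm)
    then show "u (p + sc z b) \<le> ereal (ln (cmod z) + (ln (norm b) + C))"
      using sc[of z] z b by (simp add: ln_mult add.assoc)
  qed
qed

text \<open>The pole condition concerns a punctured neighbourhood. On a circle of small radius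
  around p in a complex line, u is below -N, and the mean value inequality carries this bound to the
  centre.\<close>

lemma neg_psh_pole_value:
  fixes p :: "'a::euclidean_space"
  assumes u: "neg_psh sc D u" and sc: "bounded_bilinear sc"
    and norm_sc: "\<And>z b. norm (sc z b) = cmod z * norm b"
    and pole: "log_pole p u" and R: "R > 0" "cball p R \<subseteq> D"
  shows "u p = - \<infinity>"
proof -
  interpret bounded_bilinear sc by fact
  obtain b :: 'a where b: "b \<in> Basis" using nonempty_Basis by blast
  then have nb: "norm b = 1" "b \<noteq> 0" by auto
  obtain \<delta> C where \<delta>: "\<delta> > 0" "\<And>z. 0 < cmod z \<Longrightarrow> cmod z < \<delta> \<Longrightarrow> u (p + sc z b) \<le> ereal (ln (cmod z) + C)"
    by (rule log_pole_line[where sc=sc and b=b and p=p and u=u]) (use pole norm_sc nb in auto)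
  have S: "p + sc z b \<in> D" if "z \<in> cball 0 R" for z
    using that norm_sc[of z b] nb by (intro subsetD[OF R(2)]) (simp add: dist_norm)
  have "p \<in> D" using R by auto
  then have pD: "u p \<le> 0" by (rule neg_psh_neg[OF u])
  have le: "u p \<le> ereal (- N)" if N: "N \<ge> 0" for N
  proof -
    define \<rho> where "\<rho> = min (min R (\<delta> / 2)) (exp (- N - C))"
    have \<rho>: "0 < \<rho>" "\<rho> \<le> R" "\<rho> < \<delta>" "\<rho> \<le> exp (- N - C)" using R \<delta> by (auto simp: \<rho>_def)
    have l: "ln \<rho> + C \<le> - N" using \<rho>(1,4) by (smt (verit) exp_gt_zero ln_exp ln_le_cancel_iff)
    have sm: "submean (cball 0 R) N (\<lambda>z. trunc N (u (p + sc z b)))"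
      by (rule neg_psh_submean[OF u sc S N])
    have sub: "cball 0 \<rho> \<subseteq> cball (0::complex) R" using \<rho> by auto
    have "trunc N (u (p + sc 0 b)) \<le> mean (\<lambda>t. trunc N (u (p + sc (0 + of_real \<rho> * cis t) b)))"
      using sm sub \<rho>(1) unfolding submean_def by blast
    also have "\<dots> \<le> mean (\<lambda>t::real. - N)"
    proof (rule mean_mono)
      show "integrable circ (\<lambda>t. trunc N (u (p + sc (0 + of_real \<rho> * cis t) b)))"
        by (rule submean_integrable[OF sm sub]) (use \<rho> in simp)
      fix t
      have "cmod (of_real \<rho> * cis t) = \<rho>" using \<rho> by (simp add: norm_mult)
      then have "u (p + sc (0 + of_real \<rho> * cis t) b) \<le> ereal (ln \<rho> + C)"
        using \<delta>(2)[of "of_real \<rho> * cis t"] \<rho> by simp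
      also have "\<dots> \<le> ereal (- N)" using l by simp
      finally have m: "u (p + sc (0 + of_real \<rho> * cis t) b) \<le> ereal (- N)" .
      then show "trunc N (u (p + sc (0 + of_real \<rho> * cis t) b)) \<le> - N"
        by (simp add: trunc_def max_def)
    qed simp
    finally have "ereal (trunc N (u p)) \<le> ereal (- N)" by (simp add: zero_left)
    then show ?thesis using trunc(4)[OF pD N] by (rule order_trans[rotated])
  qed
  show ?thesis
  proof (cases "u p")
    case (real r)
    then show ?thesis using le[of "\<bar>r\<bar> + 1"] by simp
  qed (use pD in auto)
qed

text \<open>With w as direction of the line, the point p + w has parameter 1 and the available disc
  has radius R / |w|.\<close>

theorem neg_psh_Schwarz:
  assumes u: "neg_psh sc D u" and sc: "bounded_bilinear sc"
    and norm_sc: "\<And>z b. norm (sc z b) = cmod z * norm b" and sc1: "\<And>b. sc 1 b = b"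
    and pole: "log_pole p u" and R: "R > 0" "cball p R \<subseteq> D" and w: "w \<noteq> 0" "norm w \<le> R"
  shows "u (p + w) \<le> ereal (ln (norm w / R))"
proof -
  obtain \<delta> C where \<delta>: "\<delta> > 0" "\<And>z. 0 < cmod z \<Longrightarrow> cmod z < \<delta> \<Longrightarrow> u (p + sc z w) \<le> ereal (ln (cmod z) + C)"
    by (rule log_pole_line[where sc=sc and b=w and p=p and u=u]) (use pole norm_sc w in auto)
  define r where "r = R / norm w"
  have r: "1 \<le> r" using w by (simp add: r_def)
  have S: "p + sc z w \<in> D" if "z \<in> cball 0 r" for z
    using that norm_sc[of z w] w by (intro subsetD[OF R(2)]) (simp add: dist_norm r_def field_simps)
  have "u (p + sc 1 w) \<le> ereal (ln (cmod 1 / r))"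
  proof (rule submean_Schwarz[OF neg_psh_submean[OF u sc S] _ \<delta>(2,1)])
    show "u (p + sc z w) \<le> 0" if "z \<in> cball 0 r" for z
      by (rule neg_psh_neg[OF u S[OF that]])
  qed (use r in auto)
  then show ?thesis by (simp add: sc1 r_def)
qed

text \<open>The separate bound B > 0 admits q = p, where the logarithm of the distance would be
  meaningless and the pole value takes over.\<close>

lemma green_upper:
  fixes p :: "'a::euclidean_space"
  assumes sc: "bounded_bilinear sc"
    and norm_sc: "\<And>z b. norm (sc z b) = cmod z * norm b" and sc1: "\<And>b. sc 1 b = b"
    and R: "R > 0" "cball p R \<subseteq> D" and q: "norm (q - p) \<le> R" and B: "norm (q - p) \<le> B" "0 < B"
  shows "green sc D p q \<le> ereal (ln (B / R))"
  unfolding green_alt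
proof (rule Sup_least)
  fix y assume "y \<in> {u q | u. neg_psh sc D u \<and> log_pole p u}"
  then obtain u where u: "y = u q" "neg_psh sc D u" "log_pole p u" by blast
  show "y \<le> ereal (ln (B / R))"
  proof (cases "q = p")
    case True
    then show ?thesis using neg_psh_pole_value[OF u(2) sc norm_sc u(3) R] u(1) by simp
  next
    case False
    then have "y \<le> ereal (ln (norm (q - p) / R))"
      using neg_psh_Schwarz[OF u(2) sc norm_sc sc1 u(3) R, of "q - p"] q u(1) by simp
    also have "\<dots> \<le> ereal (ln (B / R))"
      using False B R(1) by (simp add: divide_right_mono)
    finally show ?thesis .
  qed
qed

section \<open>Logarithms of moduli of polynomials\<close>

text \<open>The value at 0 is set by hand because \<open>ln\<close> is real-valued.\<close>

definition log_mod :: "real \<Rightarrow> real \<Rightarrow> complex \<Rightarrow> ereal" where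
  "log_mod c C y = (if y = 0 then - \<infinity> else ereal (c * ln (cmod y) - C))"

lemma usc_log_mod:
  assumes "c > 0"
  shows "usc_on UNIV (log_mod c C)"
  unfolding usc_on_def
proof
  fix y :: ereal
  have "open {z. log_mod c C z < y}"
  proof (cases y)
    case (real v)
    have "{z. log_mod c C z < y} = {z. cmod z < exp ((v + C) / c)}"
    proof (intro Collect_cong)
      fix z
      show "log_mod c C z < y \<longleftrightarrow> cmod z < exp ((v + C) / c)"
      proof (cases "z = 0")
        case False
        then have "cmod z < exp ((v + C) / c) \<longleftrightarrow> ln (cmod z) < (v + C) / c"
          by (metis exp_less_cancel_iff exp_ln zero_less_norm_iff)
        then show ?thesis using assms real False by (auto simp: log_mod_def field_simps)
      qed (use real in \<open>simp add: log_mod_def\<close>)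
    qed
    moreover have "open {z. cmod z < exp ((v + C) / c)}"
      by (intro open_Collect_less continuous_intros)
    ultimately show ?thesis by simp
  next
    case PInf
    then have "{z. log_mod c C z < y} = UNIV" by (auto simp: log_mod_def)
    then show ?thesis by simp
  qed simp
  then show "openin (top_of_set UNIV) {z \<in> UNIV. log_mod c C z < y}" by simp
qed

text \<open>The truncation is the continuous function c log max(|p|, const) - C, so a local
  inequality is enough. Where it takes its least value -N this is clear; elsewhere p has a
  holomorphic logarithm nearby, and c log |p| - C is a harmonic minorant that agrees with the
  truncation at the centre.\<close>

lemma log_poly_submean:
  fixes p :: "complex poly"
  assumes c: "c > 0" and r: "r > 0"
    and neg: "\<And>z. z \<in> cball 0 r \<Longrightarrow> log_mod c C (poly p z) \<le> 0"
  shows "(\<integral>\<^sup>+t\<in>{0..2*pi}. e2ennreal (- log_mod c C (poly p (of_real r * cis t))) \<partial>lborel)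
    \<le> ennreal (2*pi) * e2ennreal (- log_mod c C (poly p 0))"
proof -
  define U where "U z = log_mod c C (poly p z)" for z
  have U: "U z = (if poly p z = 0 then - \<infinity> else ereal (c * ln (cmod (poly p z)) - C))" for z
    by (simp add: U_def log_mod_def)
  have trU: "trunc N (U z) = c * ln (max (cmod (poly p z)) (exp ((C - N) / c))) - C" for N z
  proof (cases "poly p z = 0")
    case True
    then show ?thesis using c by (simp add: U trunc_def max_def)
  next
    case False
    have "- N \<le> c * ln (cmod (poly p z)) - C \<longleftrightarrow> (C - N) / c \<le> ln (cmod (poly p z))"
      using c by (auto simp: field_simps)
    also have "\<dots> \<longleftrightarrow> exp ((C - N) / c) \<le> cmod (poly p z)"
      using False by (simp add: ln_ge_iff)
    finally show ?thesis using False c by (auto simp: U trunc_def max_def)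
  qed
  have cont: "continuous_on T (\<lambda>z. trunc N (U z))" for N T
    unfolding trU by (intro continuous_intros) (auto simp: max_def not_le intro: less_trans)
  have mem: "of_real r * cis t \<in> cball 0 r" for t using r by (simp add: norm_mult)
  have step: "trunc N (U 0) \<le> mean (\<lambda>t. trunc N (U (of_real r * cis t)))" for N
  proof (rule local_submean_imp_global[OF r cont])
    fix z :: complex and \<epsilon> assume z: "z \<in> ball 0 r" and \<epsilon>: "(\<epsilon>::real) > 0"
    have ge: "- N \<le> trunc N (U w)" for w by (auto simp: U trunc_def max_def)
    obtain d where d: "d > 0" "cball z d \<subseteq> ball 0 r"
      using open_contains_cball[THEN iffD1, OF open_ball, rule_format, OF z] by blast
    have int: "integrable circ (\<lambda>t. trunc N (U (z + of_real \<rho> * cis t)))" if "\<rho> > 0" for \<rho>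
      by (rule circ_integrable_continuous[OF cont]) (use that in simp)
    show "\<exists>\<rho>>0. cball z \<rho> \<subseteq> ball 0 r \<and>
        trunc N (U z) \<le> mean (\<lambda>t. trunc N (U (z + of_real \<rho> * cis t))) + \<epsilon> * \<rho>\<^sup>2"
    proof (cases "poly p z = 0")
      case True
      then have "trunc N (U z) = mean (\<lambda>t::real. - N)" by (simp add: U trunc_def max_def)
      also have "\<dots> \<le> mean (\<lambda>t. trunc N (U (z + of_real d * cis t)))"
        by (rule mean_mono) (use int[OF d(1)] ge in auto)
      finally show ?thesis using d \<epsilon> by (intro exI[of _ d]) (simp add: add_increasing2)
    next
      case False
      have "continuous_on UNIV (\<lambda>w. poly p w / poly p z)" by (intro continuous_intros) (use False in auto)
      then have "open {w. poly p w / poly p z \<in> ball 1 1}"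
        using open_vimage[of "ball 1 1" "\<lambda>w. poly p w / poly p z"] by (simp add: vimage_def)
      moreover have "z \<in> {w. poly p w / poly p z \<in> ball 1 1}" using False by simp
      ultimately obtain d' where d': "d' > 0" "cball z d' \<subseteq> {w. poly p w / poly p z \<in> ball 1 1}"
        using open_contains_cball by meson
      define \<rho> where "\<rho> = min d d'"
      have \<rho>: "\<rho> > 0" "cball z \<rho> \<subseteq> ball 0 r" using d d' by (auto simp: \<rho>_def)
      have near: "cmod (poly p w / poly p z - 1) < 1" if "w \<in> cball z \<rho>" for w
      proof -
        have "w \<in> cball z d'" using that by (simp add: \<rho>_def)
        then have "poly p w / poly p z \<in> ball 1 1" using d'(2) by blast
        then show ?thesis by (simp add: dist_norm norm_minus_commute)
      qed
      have pos: "Re (poly p w / poly p z) > 0" if "w \<in> cball z \<rho>" for w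
        using near[OF that] abs_Re_le_cmod[of "poly p w / poly p z - 1"] by simp
      let ?L = "\<lambda>w. Ln (poly p w / poly p z)"
      have L: "?L holomorphic_on cball z \<rho>"
      proof (intro holomorphic_intros)
        show "poly p w / poly p z \<notin> \<real>\<^sub>\<le>\<^sub>0" if "w \<in> cball z \<rho>" for w
          using pos[OF that] complex_nonpos_Reals_iff by auto
      qed (use False in auto)
      have nz: "poly p w \<noteq> 0" if "w \<in> cball z \<rho>" for w using pos[OF that] by auto
      have eq: "ln (cmod (poly p w)) = ln (cmod (poly p z)) + Re (?L w)" if "w \<in> cball z \<rho>" for w
        using nz[OF that] False by (simp add: Re_Ln norm_divide ln_div)
      have memz: "z + of_real \<rho> * cis t \<in> cball z \<rho>" for t
        using \<rho> by (simp add: dist_norm norm_mult)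
      note m = mean_Re_holomorphic[OF L \<rho>(1)]
      have lower: "c * ln (cmod (poly p w)) - C \<le> trunc N (U w)" if "w \<in> cball z \<rho>" for w
        using nz[OF that] by (simp add: U trunc_def max_def)
      have I: "integrable circ (\<lambda>t. (c * ln (cmod (poly p z)) - C) + c * Re (?L (z + of_real \<rho> * cis t)))"
        by (rule mean_affine(1)[OF m(1)])
      have "trunc N (U z) \<le> mean (\<lambda>t. trunc N (U (z + of_real \<rho> * cis t)))"
      proof (cases "trunc N (U z) = - N")
        case True
        then have "trunc N (U z) = mean (\<lambda>t::real. - N)" by simp
        also have "\<dots> \<le> mean (\<lambda>t. trunc N (U (z + of_real \<rho> * cis t)))"
          by (rule mean_mono) (use int[OF \<rho>(1)] ge in auto)
        finally show ?thesis .
      next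
        case ne: False
        then have "trunc N (U z) = c * ln (cmod (poly p z)) - C"
          using False by (auto simp: U trunc_def max_def split: if_splits)
        also have "\<dots> = mean (\<lambda>t. (c * ln (cmod (poly p z)) - C) + c * Re (?L (z + of_real \<rho> * cis t)))"
          unfolding mean_affine(2)[OF m(1)] m(2) using False by simp
        also have "\<dots> \<le> mean (\<lambda>t. trunc N (U (z + of_real \<rho> * cis t)))"
        proof (rule mean_mono[OF I int[OF \<rho>(1)]])
          fix t
          show "(c * ln (cmod (poly p z)) - C) + c * Re (?L (z + of_real \<rho> * cis t))
              \<le> trunc N (U (z + of_real \<rho> * cis t))"
            using lower[OF memz[of t]] unfolding eq[OF memz[of t]] by (simp add: algebra_simps)
        qed
        finally show ?thesis .
      qed
      then show ?thesis using \<rho> \<epsilon> by (intro exI[of _ \<rho>]) (simp add: add_increasing2)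
    qed
  qed
  have usc: "usc_on (cball 0 r) U"
    unfolding U_def by (rule usc_on_compose[OF usc_log_mod[OF c]]) (auto intro!: continuous_intros)
  have "(\<integral>\<^sup>+t\<in>{0..2*pi}. e2ennreal (- U (of_real r * cis t)) \<partial>lborel) \<le> ennreal (2*pi) * e2ennreal (- U 0)"
  proof (rule trunc_mean_imp_nn_integral)
    show "(\<lambda>t. U (of_real r * cis t)) \<in> borel_measurable borel"
      using usc_circle_measurable[OF usc, of 0 r] r by simp
    show "U (of_real r * cis t) \<le> 0" for t unfolding U_def by (rule neg[OF mem])
    show "U 0 \<le> 0" unfolding U_def by (rule neg) (use r in simp)
  qed (rule step)
  then show ?thesis unfolding U_def .
qed

section \<open>Plurisubharmonicity along polynomial curves\<close>

lemma norm_smult_vec: "norm (c *s x) = cmod c * norm (x :: complex^'n)"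
  by (simp add: norm_vec_def norm_mult L2_set_right_distrib)

lemma bounded_bilinear_smult: "bounded_bilinear ((*s) :: complex \<Rightarrow> complex^'n \<Rightarrow> complex^'n)"
proof
  show "\<exists>K. \<forall>a b. norm (a *s (b :: complex^'n)) \<le> norm a * norm b * K"
    by (rule exI[of _ 1]) (simp add: norm_smult_vec)
qed (simp_all add: vec_eq_iff algebra_simps)

lemma polynomial_curve_remainder:
  fixes P :: "'n::finite \<Rightarrow> complex poly"
  obtains a :: "complex^'n" and S where
    "\<And>w. (\<chi> i. poly (P i) (z + w)) = (\<chi> i. poly (P i) z) + w *s a + (\<chi> i. w\<^sup>2 * poly (S i) w)"
proof -
  have "\<exists>q s. \<forall>w. poly (P i) (z + w) = poly (P i) z + w * q + w\<^sup>2 * poly s w" for i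
  proof -
    define Q where "Q = pcompose (P i) [:z, 1:]"
    obtain q0 Q' where Q: "Q = pCons q0 Q'" by (cases Q)
    obtain q1 s where Q': "Q' = pCons q1 s" by (cases Q')
    have e: "poly (P i) (z + w) = poly Q w" for w by (simp add: Q_def poly_pcompose)
    have "poly (P i) z = q0" using e[of 0] by (simp add: Q)
    moreover have "poly Q w = q0 + w * q1 + w\<^sup>2 * poly s w" for w
      by (simp add: Q Q' algebra_simps power2_eq_square)
    ultimately have "poly (P i) (z + w) = poly (P i) z + w * q1 + w\<^sup>2 * poly s w" for w
      unfolding e by simp
    then show ?thesis by blast
  qed
  then obtain q s where "\<And>i w. poly (P i) (z + w) = poly (P i) z + w * q i + w\<^sup>2 * poly (s i) w"
    by metis
  then have "(\<chi> i. poly (P i) (z + w)) = (\<chi> i. poly (P i) z) + w *s (\<chi> i. q i) + (\<chi> i. w\<^sup>2 * poly (s i) w)" for w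
    by (simp add: vec_eq_iff)
  then show ?thesis by (rule that)
qed

text \<open>The inner product is the real part of a holomorphic function of w that vanishes at
  0.\<close>

lemma mean_inner_remainder:
  fixes v :: "complex^'n"
  assumes "\<rho> > 0"
  shows "integrable circ (\<lambda>t. v \<bullet> (\<chi> i. (of_real \<rho> * cis t)\<^sup>2 * poly (S i) (of_real \<rho> * cis t)))"
    "mean (\<lambda>t. v \<bullet> (\<chi> i. (of_real \<rho> * cis t)\<^sup>2 * poly (S i) (of_real \<rho> * cis t))) = 0"
proof -
  let ?f = "\<lambda>w. \<Sum>i\<in>UNIV. cnj (v $ i) * (w\<^sup>2 * poly (S i) w)"
  have eq: "v \<bullet> (\<chi> i. (of_real \<rho> * cis t)\<^sup>2 * poly (S i) (of_real \<rho> * cis t))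
      = Re (?f (0 + of_real \<rho> * cis t))" for t
    unfolding inner_vec_def Re_sum by (intro sum.cong) (simp_all add: inner_complex_def)
  have h: "?f holomorphic_on cball 0 \<rho>" by (intro holomorphic_intros)
  note m = mean_Re_holomorphic[OF h assms]
  show "integrable circ (\<lambda>t. v \<bullet> (\<chi> i. (of_real \<rho> * cis t)\<^sup>2 * poly (S i) (of_real \<rho> * cis t)))"
    unfolding eq by (rule m(1))
  show "mean (\<lambda>t. v \<bullet> (\<chi> i. (of_real \<rho> * cis t)\<^sup>2 * poly (S i) (of_real \<rho> * cis t))) = 0"
    unfolding eq m(2) by simp
qed

lemma remainder_bound:
  fixes S :: "'n::finite \<Rightarrow> complex poly"
  obtains K where "K > 0" "\<And>w. cmod w \<le> 1 \<Longrightarrow> norm (\<chi> i. w\<^sup>2 * poly (S i) w) \<le> K * (cmod w)\<^sup>2"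
proof -
  have cont: "continuous_on (cball 0 1) (\<lambda>w. \<chi> i. poly (S i) w)" by (intro continuous_intros)
  then obtain K where K: "K > 0" "\<forall>x\<in>(\<lambda>w. \<chi> i. poly (S i) w) ` cball 0 1. norm x \<le> K"
    using compact_imp_bounded[OF compact_continuous_image[OF cont compact_cball]] unfolding bounded_pos by blast
  show ?thesis
  proof (rule that[OF K(1)])
    fix w :: complex assume w: "cmod w \<le> 1"
    have "(\<chi> i. w\<^sup>2 * poly (S i) w) = w\<^sup>2 *s (\<chi> i. poly (S i) w)" by (simp add: vec_eq_iff)
    then have "norm (\<chi> i. w\<^sup>2 * poly (S i) w) = (cmod w)\<^sup>2 * norm (\<chi> i. poly (S i) w)"
      by (simp add: norm_smult_vec norm_power)
    also have "\<dots> \<le> (cmod w)\<^sup>2 * K" using K(2) w by (intro mult_left_mono) auto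
    finally show "norm (\<chi> i. w\<^sup>2 * poly (S i) w) \<le> K * (cmod w)\<^sup>2" by (simp add: mult.commute)
  qed
qed

text \<open>The truncated function is replaced by its sup-convolution with a paraboloid. This is
  continuous and keeps the sub-mean value inequality on complex lines; since the second order
  remainder of the curve has mean zero on small circles, the inequality survives along the curve
  up to an error of fourth order in the radius.\<close>
lemma sup_convolution_step:
  fixes u :: "complex^'n \<Rightarrow> ereal" and P :: "'n \<Rightarrow> complex poly"
  defines "\<phi> \<equiv> \<lambda>z. \<chi> i. poly (P i) z"
  assumes u: "neg_psh (*s) D u" and r: "r > 0" and N: "N \<ge> 0"
    and \<eta>: "\<eta> > 0" "(\<Union>x\<in>\<phi> ` cball 0 r. cball x \<eta>) \<subseteq> D" and k: "k > 0" "k * (\<eta> / 2)\<^sup>2 \<ge> N"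
  defines "Y \<equiv> (\<Union>x\<in>\<phi> ` cball 0 r. cball x \<eta>)"
  defines "h \<equiv> \<lambda>z. SUP y\<in>Y. trunc N (u y) - k * (norm (y - \<phi> z))\<^sup>2"
  shows "continuous_on (cball 0 r) h" "\<And>z. z \<in> cball 0 r \<Longrightarrow> trunc N (u (\<phi> z)) \<le> h z"
    "h 0 \<le> mean (\<lambda>t. h (of_real r * cis t))"
proof -
  define f where "f y = trunc N (u y)" for y
  have f: "- N \<le> f y" "f y \<le> 0" if "y \<in> Y" for y
    unfolding f_def using trunc(2,3)[OF neg_psh_neg[OF u] N] that \<eta>(2) unfolding Y_def by blast+
  have h: "h z = (SUP y\<in>Y. f y - k * (norm (y - \<phi> z))\<^sup>2)" for z by (simp add: h_def f_def)
  have \<phi>c: "continuous_on T \<phi>" for T unfolding \<phi>_def by (intro continuous_intros)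
  have inY: "\<phi> z \<in> Y" if "z \<in> cball 0 r" for z
    unfolding Y_def using that \<eta>(1) by (intro UN_I[of "\<phi> z"]) auto
  have "0 \<in> cball (0::complex) r" using r by simp
  then have Yne: "Y \<noteq> {}" using inY by blast
  have nonpos: "f y - k * (norm (y - \<phi> z))\<^sup>2 \<le> 0" if "y \<in> Y" for y z
  proof -
    have "0 \<le> k * (norm (y - \<phi> z))\<^sup>2" using k(1) by simp
    then show ?thesis using f(2)[OF that] by linarith
  qed
  have bdd: "bdd_above ((\<lambda>y. f y - k * (norm (y - \<phi> z))\<^sup>2) ` Y)" for z
    by (rule bdd_aboveI2[of _ _ 0]) (rule nonpos)
  have upper: "f y - k * (norm (y - \<phi> z))\<^sup>2 \<le> h z" if "y \<in> Y" for y z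
    unfolding h by (rule cSUP_upper[OF that bdd])
  show ge: "trunc N (u (\<phi> z)) \<le> h z" if "z \<in> cball 0 r" for z
    using upper[OF inY[OF that], of z] by (simp add: f_def)
  have hN: "- N \<le> h z" if "z \<in> cball 0 r" for z
    using ge[OF that] f(1)[OF inY[OF that]] by (simp add: f_def)
  obtain B where B: "\<And>z. z \<in> cball 0 r \<Longrightarrow> norm (\<phi> z) \<le> B"
    using compact_imp_bounded[OF compact_continuous_image[OF \<phi>c compact_cball]] unfolding bounded_iff by blast
  have YB: "norm y \<le> B + \<eta>" if y: "y \<in> Y" for y
  proof -
    obtain z where z: "z \<in> cball 0 r" "norm (y - \<phi> z) \<le> \<eta>"
      using y unfolding Y_def by (auto simp: dist_norm norm_minus_commute)
    then show ?thesis using B[OF z(1)] norm_triangle_ineq[of "\<phi> z" "y - \<phi> z"] by simp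
  qed
  \<comment> \<open>A difference of squares is difference times sum, and the two distances from y
    add up to at most 4 B + 2 \<eta>.\<close>
  define L where "L = k * (4 * B + 2 * \<eta>)"
  have lip: "h z \<le> h z' + L * norm (\<phi> z - \<phi> z')" if z: "z \<in> cball 0 r" "z' \<in> cball 0 r" for z z' :: complex
  proof -
    have "f y - k * (norm (y - \<phi> z))\<^sup>2 \<le> h z' + L * norm (\<phi> z - \<phi> z')" if y: "y \<in> Y" for y
    proof -
      have 1: "norm (y - \<phi> z') - norm (y - \<phi> z) \<le> norm (\<phi> z - \<phi> z')"
        using norm_triangle_ineq[of "y - \<phi> z" "\<phi> z - \<phi> z'"] by simp
      have 2: "norm (y - \<phi> z') + norm (y - \<phi> z) \<le> 4 * B + 2 * \<eta>"
        using norm_triangle_ineq4[of y "\<phi> z"] norm_triangle_ineq4[of y "\<phi> z'"] B[OF z(1)] B[OF z(2)] YB[OF y] by simp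
      have "(norm (y - \<phi> z'))\<^sup>2 - (norm (y - \<phi> z))\<^sup>2 = (norm (y - \<phi> z') - norm (y - \<phi> z)) * (norm (y - \<phi> z') + norm (y - \<phi> z))"
        by (simp add: power2_eq_square algebra_simps)
      also have "\<dots> \<le> norm (\<phi> z - \<phi> z') * (norm (y - \<phi> z') + norm (y - \<phi> z))"
        using 1 by (intro mult_right_mono) auto
      also have "\<dots> \<le> norm (\<phi> z - \<phi> z') * (4 * B + 2 * \<eta>)"
        using 2 by (intro mult_left_mono) auto
      finally have "k * ((norm (y - \<phi> z'))\<^sup>2 - (norm (y - \<phi> z))\<^sup>2) \<le> k * (norm (\<phi> z - \<phi> z') * (4 * B + 2 * \<eta>))"
        using k(1) by (intro mult_left_mono) auto
      then show ?thesis using upper[OF y, of z'] by (simp add: L_def algebra_simps)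
    qed
    then show ?thesis unfolding h[of z] by (rule cSUP_least[OF Yne])
  qed
  show hc: "continuous_on (cball 0 r) h"
    unfolding continuous_on_iff
  proof (intro ballI allI impI)
    fix z :: complex and e assume z: "z \<in> cball 0 r" and e: "(e::real) > 0"
    have L: "\<bar>L\<bar> + 1 > 0" by simp
    obtain d where d: "d > 0" "\<And>z'. z' \<in> cball 0 r \<Longrightarrow> dist z' z < d \<Longrightarrow> dist (\<phi> z') (\<phi> z) < e / (\<bar>L\<bar> + 1)"
      using \<phi>c[of "cball 0 r"] z e L unfolding continuous_on_iff by (metis divide_pos_pos)
    have "dist (h z') (h z) < e" if z': "z' \<in> cball 0 r" "dist z' z < d" for z' :: complex
    proof -
      have "norm (\<phi> z' - \<phi> z) * (\<bar>L\<bar> + 1) < e"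
        using d(2)[OF z'] L by (simp add: dist_norm pos_less_divide_eq)
      moreover have "L * norm (\<phi> z' - \<phi> z) \<le> norm (\<phi> z' - \<phi> z) * (\<bar>L\<bar> + 1)"
        using mult_right_mono[of L "\<bar>L\<bar> + 1" "norm (\<phi> z' - \<phi> z)"] by (simp add: mult.commute)
      ultimately show ?thesis
        using lip[OF z'(1) z] lip[OF z z'(1)] by (simp add: dist_real_def norm_minus_commute abs_less_iff)
    qed
    then show "\<exists>d>0. \<forall>x'\<in>cball 0 r. dist x' z < d \<longrightarrow> dist (h x') (h z) < e" using d(1) by blast
  qed
  show "h 0 \<le> mean (\<lambda>t. h (of_real r * cis t))"
  proof (rule local_submean_imp_global[OF r hc])
    fix z :: complex and \<epsilon> assume z: "z \<in> ball 0 r" and \<epsilon>: "(\<epsilon>::real) > 0"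
    obtain a :: "complex^'n" and S where rem: "\<And>w. \<phi> (z + w) = \<phi> z + w *s a + (\<chi> i. w\<^sup>2 * poly (S i) w)"
      unfolding \<phi>_def by (rule polynomial_curve_remainder[of P z]) blast
    obtain K where K: "K > 0" "\<And>w. cmod w \<le> 1 \<Longrightarrow> norm (\<chi> i. w\<^sup>2 * poly (S i) w) \<le> K * (cmod w)\<^sup>2"
      using remainder_bound[of S] by blast
    obtain d where d: "d > 0" "cball z d \<subseteq> ball 0 r"
      using open_contains_cball[THEN iffD1, OF open_ball, rule_format, OF z] by blast
    \<comment> \<open>The four bounds keep the circle inside the disc, make the remainder estimate
      valid, keep y + w a within \<eta> of \<phi>(z) for y within \<eta> / 2 of it, and push the
      error k K^2 \<rho>^4 below \<epsilon> \<rho>^2.\<close>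
    define \<rho> where "\<rho> = min (min d 1) (min (\<eta> / (2 * (norm a + 1))) (sqrt (\<epsilon> / (k * K\<^sup>2))))"
    have na: "norm a + 1 > 0" by (simp add: add_nonneg_pos)
    have \<rho>: "\<rho> > 0" "\<rho> \<le> d" "\<rho> \<le> 1" "\<rho> \<le> \<eta> / (2 * (norm a + 1))" "\<rho> \<le> sqrt (\<epsilon> / (k * K\<^sup>2))"
      using d K(1) k(1) \<epsilon> \<eta>(1) na by (auto simp: \<rho>_def)
    have "\<rho> * (2 * (norm a + 1)) \<le> \<eta>" using \<rho>(4) na by (subst (asm) pos_le_divide_eq) auto
    then have \<rho>a: "\<rho> * norm a \<le> \<eta> / 2" using \<rho>(1) by (simp add: algebra_simps)
    have "\<rho>\<^sup>2 \<le> (sqrt (\<epsilon> / (k * K\<^sup>2)))\<^sup>2" using \<rho>(1,5) by (intro power_mono) auto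
    also have "\<dots> = \<epsilon> / (k * K\<^sup>2)" using \<epsilon> k(1) K(1) by simp
    finally have "\<rho>\<^sup>2 * (k * K\<^sup>2) \<le> \<epsilon>"
      using k(1) K(1) by (subst (asm) pos_le_divide_eq) auto
    then have "\<rho>\<^sup>2 * (\<rho>\<^sup>2 * (k * K\<^sup>2)) \<le> \<rho>\<^sup>2 * \<epsilon>" by (intro mult_left_mono) auto
    then have err: "k * (K * \<rho>\<^sup>2)\<^sup>2 \<le> \<epsilon> * \<rho>\<^sup>2" by (simp add: power_mult_distrib power2_eq_square mult_ac)
    have sub: "cball z \<rho> \<subseteq> ball 0 r" using d(2) \<rho>(2) by auto
    have zr: "z \<in> cball 0 r" using z by auto
    have cw: "cmod (of_real \<rho> * cis t) = \<rho>" for t using \<rho>(1) by (simp add: norm_mult)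
    have "z + of_real \<rho> * cis t \<in> cball z \<rho>" for t using \<rho>(1) by (simp add: dist_norm norm_mult)
    then have mem: "z + of_real \<rho> * cis t \<in> cball 0 r" for t using sub ball_subset_cball by blast
    have hi: "integrable circ (\<lambda>t. h (z + of_real \<rho> * cis t))"
    proof (rule circ_integrable_continuous[OF continuous_on_subset[OF hc]])
      have "sphere z \<rho> \<subseteq> cball z \<rho>" by auto
      then show "sphere z \<rho> \<subseteq> cball 0 r" using sub ball_subset_cball by blast
    qed (use \<rho> in simp)
    have "f y - k * (norm (y - \<phi> z))\<^sup>2 \<le> mean (\<lambda>t. h (z + of_real \<rho> * cis t)) + \<epsilon> * \<rho>\<^sup>2" if y: "y \<in> Y" for y
    proof (cases "norm (y - \<phi> z) > \<eta> / 2")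
      \<comment> \<open>A point this far away pays a penalty of at least N, so it contributes at
        most -N, which is a lower bound of h.\<close>
      case True
      then have "k * (\<eta> / 2)\<^sup>2 \<le> k * (norm (y - \<phi> z))\<^sup>2"
        using \<eta>(1) k(1) by (intro mult_left_mono power_mono) auto
      then have "f y - k * (norm (y - \<phi> z))\<^sup>2 \<le> mean (\<lambda>t::real. - N)" using f(2)[OF y] k(2) by simp
      also have "\<dots> \<le> mean (\<lambda>t. h (z + of_real \<rho> * cis t))"
        by (rule mean_mono) (use hi hN[OF mem] in auto)
      also have "\<dots> \<le> mean (\<lambda>t. h (z + of_real \<rho> * cis t)) + \<epsilon> * \<rho>\<^sup>2" using \<epsilon> by simp
      finally show ?thesis .
    next
      case False
      have disc: "y + w *s a \<in> Y" if "cmod w \<le> \<rho>" for w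
      proof -
        have "norm ((y + w *s a) - \<phi> z) \<le> norm (y - \<phi> z) + cmod w * norm a"
          using norm_triangle_ineq[of "y - \<phi> z" "w *s a"] by (simp add: norm_smult_vec algebra_simps)
        also have "cmod w * norm a \<le> \<rho> * norm a" using that by (intro mult_right_mono) auto
        finally have "norm ((y + w *s a) - \<phi> z) \<le> \<eta>" using \<rho>a False by simp
        then show ?thesis unfolding Y_def using zr by (intro UN_I[of "\<phi> z"]) (auto simp: dist_norm norm_minus_commute)
      qed
      have sm: "submean (cball 0 \<rho>) N (\<lambda>w. f (y + w *s a))"
        unfolding f_def
      proof (rule neg_psh_submean[OF u bounded_bilinear_smult _ N])
        show "y + w *s a \<in> D" if "w \<in> cball 0 \<rho>" for w
          using subsetD[OF \<eta>(2)[folded Y_def] disc[of w]] that by simp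
      qed
      define R where "R t = (\<chi> i. (of_real \<rho> * cis t)\<^sup>2 * poly (S i) (of_real \<rho> * cis t))" for t
      have RK: "norm (R t) \<le> K * \<rho>\<^sup>2" for t
        using K(2)[of "of_real \<rho> * cis t"] cw[of t] \<rho>(3) by (simp add: R_def)
      define v where "v = y - \<phi> z"
      have vi: "integrable circ (\<lambda>t. v \<bullet> R t)" "mean (\<lambda>t. v \<bullet> R t) = 0"
        unfolding R_def using mean_inner_remainder[OF \<rho>(1), of v S] by auto
      have fi: "integrable circ (\<lambda>t. f (y + (of_real \<rho> * cis t) *s a))"
        using submean_integrable[OF sm, of 0 \<rho>] \<rho>(1) by simp
      have fm: "f y \<le> mean (\<lambda>t. f (y + (of_real \<rho> * cis t) *s a))"
      proof -
        have "f (y + 0 *s a) \<le> mean (\<lambda>t. f (y + (0 + of_real \<rho> * cis t) *s a))"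
          using sm \<rho>(1) unfolding submean_def by blast
        then show ?thesis by simp
      qed
      \<comment> \<open>The constant part of -k |v - R|^2 after replacing |R|^2 by its bound; the
        cross term 2 k (v \<bullet> R) has mean zero.\<close>
      define c where "c = - (k * (norm v)\<^sup>2) - k * (K * \<rho>\<^sup>2)\<^sup>2"
      have ci: "integrable circ (\<lambda>t. c + (2 * k) * (v \<bullet> R t))" by (rule mean_affine(1)[OF vi(1)])
      have "mean (\<lambda>t. f (y + (of_real \<rho> * cis t) *s a) + (c + (2 * k) * (v \<bullet> R t)))
          = mean (\<lambda>t. f (y + (of_real \<rho> * cis t) *s a)) + mean (\<lambda>t. c + (2 * k) * (v \<bullet> R t))"
        unfolding mean_def by (rule Bochner_Integration.integral_add[OF fi ci])
      also have "mean (\<lambda>t. c + (2 * k) * (v \<bullet> R t)) = c" using mean_affine(2)[OF vi(1)] vi(2) by simp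
      finally have eq: "mean (\<lambda>t. f (y + (of_real \<rho> * cis t) *s a) + (c + (2 * k) * (v \<bullet> R t)))
          = mean (\<lambda>t. f (y + (of_real \<rho> * cis t) *s a)) + c" .
      have "mean (\<lambda>t. f (y + (of_real \<rho> * cis t) *s a) + (c + (2 * k) * (v \<bullet> R t)))
          \<le> mean (\<lambda>t. h (z + of_real \<rho> * cis t))"
      proof (rule mean_mono[OF Bochner_Integration.integrable_add[OF fi ci] hi])
        fix t
        let ?w = "of_real \<rho> * cis t"
        have yw: "y + ?w *s a \<in> Y" by (rule disc) (simp add: cw)
        have "(y + ?w *s a) - \<phi> (z + ?w) = v - R t"
          unfolding rem v_def R_def by simp
        then have "f (y + ?w *s a) - k * (norm (v - R t))\<^sup>2 \<le> h (z + ?w)"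
          using upper[OF yw, of "z + ?w"] by simp
        moreover have "(norm (v - R t))\<^sup>2 = (norm v)\<^sup>2 - 2 * (v \<bullet> R t) + (norm (R t))\<^sup>2"
          by (simp add: power2_norm_eq_inner inner_diff_left inner_diff_right inner_commute)
        moreover have "k * (norm (R t))\<^sup>2 \<le> k * (K * \<rho>\<^sup>2)\<^sup>2"
          using RK[of t] k(1) by (intro mult_left_mono power_mono) auto
        ultimately show "f (y + ?w *s a) + (c + (2 * k) * (v \<bullet> R t)) \<le> h (z + ?w)"
          by (simp add: c_def algebra_simps)
      qed
      then show ?thesis using eq fm err by (simp add: c_def v_def)
    qed
    then have "h z \<le> mean (\<lambda>t. h (z + of_real \<rho> * cis t)) + \<epsilon> * \<rho>\<^sup>2"
      unfolding h[of z] by (rule cSUP_least[OF Yne])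
    then show "\<exists>\<rho>>0. cball z \<rho> \<subseteq> ball 0 r \<and> h z \<le> mean (\<lambda>t. h (z + of_real \<rho> * cis t)) + \<epsilon> * \<rho>\<^sup>2"
      using \<rho>(1) sub by blast
  qed
qed

text \<open>As the paraboloids sharpen, the sup-convolutions converge pointwise to the truncation by
  upper semicontinuity. They stay between -N and 0, so dominated convergence carries the inequality
  to the truncations, and from there to u.\<close>

theorem neg_psh_polynomial_curve:
  fixes u :: "complex^'n \<Rightarrow> ereal" and P :: "'n \<Rightarrow> complex poly"
  assumes u: "neg_psh (*s) D u" and D: "open D" and r: "r > 0"
    and \<phi>D: "\<And>z. z \<in> cball 0 r \<Longrightarrow> (\<chi> i. poly (P i) z) \<in> D"
  shows "(\<integral>\<^sup>+t\<in>{0..2*pi}. e2ennreal (- u (\<chi> i. poly (P i) (of_real r * cis t))) \<partial>lborel)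
    \<le> ennreal (2*pi) * e2ennreal (- u (\<chi> i. poly (P i) 0))"
proof -
  define \<phi> where "\<phi> z = (\<chi> i. poly (P i) z)" for z
  have \<phi>c: "continuous_on T \<phi>" for T unfolding \<phi>_def by (intro continuous_intros)
  have inD: "\<phi> z \<in> D" if "z \<in> cball 0 r" for z using \<phi>D[OF that] by (simp add: \<phi>_def)
  have "compact (\<phi> ` cball 0 r)" by (rule compact_continuous_image[OF \<phi>c compact_cball])
  then obtain \<eta> where \<eta>: "\<eta> > 0" "(\<Union>x\<in>\<phi> ` cball 0 r. cball x \<eta>) \<subseteq> D"
    using compact_subset_open_imp_cball_epsilon_subset[OF _ D] inD by blast
  define Y where "Y = (\<Union>x\<in>\<phi> ` cball 0 r. cball x \<eta>)"
  have mem: "of_real r * cis t \<in> cball 0 r" for t using r by (simp add: norm_mult)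
  have usc: "usc_on (cball 0 r) (\<lambda>z. u (\<phi> z))"
    by (rule usc_on_compose[OF neg_psh_usc[OF u] \<phi>c]) (use inD in auto)
  have meas: "(\<lambda>t. u (\<phi> (of_real r * cis t))) \<in> borel_measurable borel"
    using usc_circle_measurable[OF usc, of 0 r] r by simp
  have neg: "u (\<phi> z) \<le> 0" if "z \<in> cball 0 r" for z by (rule neg_psh_neg[OF u inD[OF that]])
  have "trunc N (u (\<phi> 0)) \<le> mean (\<lambda>t. trunc N (u (\<phi> (of_real r * cis t))))" if N: "N \<ge> 0" for N
  proof -
    \<comment> \<open>The least steepness at which the penalty at distance \<eta> / 2 already
      exceeds N; the added 1 makes it positive when N = 0.\<close>
    define k0 where "k0 = N / (\<eta> / 2)\<^sup>2 + 1"
    define k where "k j = k0 + real j" for j :: nat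
    have "k0 > 0" using N \<eta> by (simp add: k0_def add_nonneg_pos)
    have kN: "k j > 0" "k j * (\<eta> / 2)\<^sup>2 \<ge> N" for j
    proof -
      show "k j > 0" using \<open>k0 > 0\<close> by (simp add: k_def)
      have "N = N / (\<eta> / 2)\<^sup>2 * (\<eta> / 2)\<^sup>2" using \<eta>(1) by simp
      also have "\<dots> \<le> k j * (\<eta> / 2)\<^sup>2" by (intro mult_right_mono) (simp_all add: k_def k0_def)
      finally show "k j * (\<eta> / 2)\<^sup>2 \<ge> N" .
    qed
    define h where "h j z = (SUP y\<in>Y. trunc N (u y) - k j * (norm (y - \<phi> z))\<^sup>2)" for j z
    have hj: "continuous_on (cball 0 r) (h j)" "\<And>z. z \<in> cball 0 r \<Longrightarrow> trunc N (u (\<phi> z)) \<le> h j z"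
      "h j 0 \<le> mean (\<lambda>t. h j (of_real r * cis t))" for j
      using sup_convolution_step[OF u r N \<eta>(1), of P "k j"] \<eta>(2) kN[of j]
      unfolding h_def Y_def \<phi>_def by auto
    have Yf: "- N \<le> trunc N (u y)" "trunc N (u y) \<le> 0" if "y \<in> Y" for y
      using trunc(2,3)[OF neg_psh_neg[OF u] N] that \<eta>(2) unfolding Y_def by blast+
    have inY: "\<phi> z \<in> Y" if "z \<in> cball 0 r" for z
      unfolding Y_def using that \<eta>(1) by (intro UN_I[of "\<phi> z"]) auto
    have h0: "h j z \<le> 0" if "z \<in> cball 0 r" for j z
      unfolding h_def
    proof (rule cSUP_least)
      show "Y \<noteq> {}" using inY[OF that] by blast
      fix y assume "y \<in> Y"
      moreover have "0 \<le> k j * (norm (y - \<phi> z))\<^sup>2" using kN(1)[of j] by simp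
      ultimately show "trunc N (u y) - k j * (norm (y - \<phi> z))\<^sup>2 \<le> 0" using Yf(2)[of y] by linarith
    qed
    have lim: "(\<lambda>j. h j z) \<longlonglongrightarrow> trunc N (u (\<phi> z))" if z: "z \<in> cball 0 r" for z
    proof (rule LIMSEQ_I)
      fix e :: real assume e: "e > 0"
      have "usc_on D (\<lambda>y. trunc N (u y))"
        by (rule usc_trunc[OF neg_psh_usc[OF u] neg_psh_neg[OF u] N])
      then have "openin (top_of_set D) {y\<in>D. trunc N (u y) < trunc N (u (\<phi> z)) + e / 2}"
        by (simp add: usc_on_def)
      then have "open {y\<in>D. trunc N (u y) < trunc N (u (\<phi> z)) + e / 2}"
        using D by (simp add: openin_open_eq)
      moreover have "\<phi> z \<in> {y\<in>D. trunc N (u y) < trunc N (u (\<phi> z)) + e / 2}"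
        using inD[OF z] e by simp
      ultimately obtain \<nu> where \<nu>: "\<nu> > 0" "ball (\<phi> z) \<nu> \<subseteq> {y\<in>D. trunc N (u y) < trunc N (u (\<phi> z)) + e / 2}"
        by (rule openE)
      \<comment> \<open>From this index on the penalty outside the \<nu>-ball is at least N, the
        full oscillation of the truncation.\<close>
      obtain j0 :: nat where j0: "N / \<nu>\<^sup>2 \<le> real j0" using real_arch_simple by blast
      have "norm (h j z - trunc N (u (\<phi> z))) < e" if "j \<ge> j0" for j
      proof -
        have "h j z \<le> trunc N (u (\<phi> z)) + e / 2"
          unfolding h_def
        proof (rule cSUP_least)
          show "Y \<noteq> {}" using inY[OF z] by blast
          fix y assume y: "y \<in> Y"
          show "trunc N (u y) - k j * (norm (y - \<phi> z))\<^sup>2 \<le> trunc N (u (\<phi> z)) + e / 2"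
          proof (cases "y \<in> ball (\<phi> z) \<nu>")
            case True
            then have "trunc N (u y) < trunc N (u (\<phi> z)) + e / 2" using \<nu>(2) by blast
            moreover have "0 \<le> k j * (norm (y - \<phi> z))\<^sup>2" using kN(1)[of j] by simp
            ultimately show ?thesis by linarith
          next
            case False
            then have "\<nu> \<le> norm (y - \<phi> z)" by (simp add: dist_norm norm_minus_commute)
            then have "\<nu>\<^sup>2 \<le> (norm (y - \<phi> z))\<^sup>2" using \<nu>(1) by (intro power_mono) auto
            moreover have "N / \<nu>\<^sup>2 \<le> k j" using j0 that \<open>k0 > 0\<close> by (simp add: k_def)
            ultimately have "N / \<nu>\<^sup>2 * \<nu>\<^sup>2 \<le> k j * (norm (y - \<phi> z))\<^sup>2"
              using kN(1)[of j] by (intro mult_mono) auto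
            then have "N \<le> k j * (norm (y - \<phi> z))\<^sup>2" using \<nu>(1) by simp
            then show ?thesis using Yf(2)[OF y] Yf(1)[OF inY[OF z]] e by linarith
          qed
        qed
        then show ?thesis using hj(2)[OF z, of j] e by (simp add: abs_less_iff)
      qed
      then show "\<exists>no. \<forall>n\<ge>no. norm (h n z - trunc N (u (\<phi> z))) < e" by blast
    qed
    have hb: "\<bar>h j (of_real r * cis t)\<bar> \<le> N" for j t
      using h0[OF mem, of j t] hj(2)[OF mem, of t j] Yf(1)[OF inY[OF mem], of t] by simp
    have hm: "integrable circ (\<lambda>t. h j (of_real r * cis t))" for j
    proof -
      have "continuous_on (sphere 0 r) (h j)" by (rule continuous_on_subset[OF hj(1)]) auto
      then show ?thesis using circ_integrable_continuous[of 0 r "h j"] r by simp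
    qed
    have "(\<lambda>j. mean (\<lambda>t. h j (of_real r * cis t))) \<longlonglongrightarrow> mean (\<lambda>t. trunc N (u (\<phi> (of_real r * cis t))))"
      unfolding mean_def
    proof (rule integral_dominated_convergence[where w = "\<lambda>_. N"])
      show "(\<lambda>t. trunc N (u (\<phi> (of_real r * cis t)))) \<in> borel_measurable circ"
        using trunc_measurable[OF meas] by (simp add: measurable_def)
      show "(\<lambda>t. h j (of_real r * cis t)) \<in> borel_measurable circ" for j
        using hm[of j] by (rule borel_measurable_integrable)
      show "AE t in circ. (\<lambda>j. h j (of_real r * cis t)) \<longlonglongrightarrow> trunc N (u (\<phi> (of_real r * cis t)))"
        by (rule AE_I2) (rule lim[OF mem])
      show "AE t in circ. norm (h j (of_real r * cis t)) \<le> N" for j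
        using hb by (intro AE_I2) simp
    qed simp
    moreover have "trunc N (u (\<phi> 0)) \<le> mean (\<lambda>t. h j (of_real r * cis t))" for j
      using hj(2)[of 0 j] hj(3)[of j] r by simp
    ultimately show ?thesis by (intro LIMSEQ_le_const) auto
  qed
  then have "(\<integral>\<^sup>+t\<in>{0..2*pi}. e2ennreal (- u (\<phi> (of_real r * cis t))) \<partial>lborel)
    \<le> ennreal (2*pi) * e2ennreal (- u (\<phi> 0))"
    using neg mem r by (intro trunc_mean_imp_nn_integral[OF meas]) auto
  then show ?thesis by (simp add: \<phi>_def)
qed

section \<open>Functions depending polynomially on a parameter\<close>

text \<open>Instantiated below with the polynomials in one variable, the continuous functions and the
  functions that are Lipschitz at a given point.\<close>
locale function_algebra =
  fixes F :: "('x \<Rightarrow> complex) set"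
  assumes const: "(\<lambda>_. c) \<in> F"
    and add: "f \<in> F \<Longrightarrow> g \<in> F \<Longrightarrow> (\<lambda>x. f x + g x) \<in> F"
    and mult: "f \<in> F \<Longrightarrow> g \<in> F \<Longrightarrow> (\<lambda>x. f x * g x) \<in> F"
begin

lemma uminus: "f \<in> F \<Longrightarrow> (\<lambda>x. - f x) \<in> F"
  using mult[OF const[of "-1"]] by simp

lemma sum: "(\<And>i. i \<in> I \<Longrightarrow> f i \<in> F) \<Longrightarrow> (\<lambda>x. \<Sum>i\<in>I. f i x) \<in> F"
  by (induction I rule: infinite_finite_induct) (auto intro: const add)

lemma prod: "(\<And>i. i \<in> I \<Longrightarrow> f i \<in> F) \<Longrightarrow> (\<lambda>x. \<Prod>i\<in>I. f i x) \<in> F"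
  by (induction I rule: infinite_finite_induct) (auto intro: const mult)

definition mat_in :: "('x \<Rightarrow> complex^'n^'n) \<Rightarrow> bool" where
  "mat_in A \<longleftrightarrow> (\<forall>i j. (\<lambda>x. A x $ i $ j) \<in> F)"

lemma mat_in_const: "mat_in (\<lambda>_. A)"
  by (simp add: mat_in_def const)

lemma mat_in_add: "mat_in A \<Longrightarrow> mat_in B \<Longrightarrow> mat_in (\<lambda>x. A x + B x)"
  by (simp add: mat_in_def add)

lemma mat_in_mult: "mat_in A \<Longrightarrow> mat_in B \<Longrightarrow> mat_in (\<lambda>x. A x ** B x)"
  unfolding mat_in_def matrix_matrix_mult_def vec_lambda_beta by (intro allI sum mult) auto

lemma mat_in_mscale: "f \<in> F \<Longrightarrow> mat_in A \<Longrightarrow> mat_in (\<lambda>x. mscale (f x) (A x))"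
  unfolding mat_in_def mscale_def vec_lambda_beta by (intro allI mult) auto

lemma det_in: "mat_in A \<Longrightarrow> (\<lambda>x. det (A x)) \<in> F"
  unfolding mat_in_def det_def by (intro sum mult const prod) auto

lemma trace_in: "mat_in A \<Longrightarrow> (\<lambda>x. trace (A x)) \<in> F"
  unfolding mat_in_def trace_def by (intro sum) auto

lemma pm_in: "mat_in A \<Longrightarrow> mat_in (\<lambda>x. pm (A x) p)"
  by (induction p) (simp_all add: mat_in_const mat_in_add mat_in_mult)

text \<open>\<open>charpoly\<close> is a determinant over polynomials, so the Leibniz formula is
  read coefficientwise, with convolutions for the products.\<close>

lemma charpoly_coeff_in:
  assumes "mat_in (A :: 'x \<Rightarrow> complex^'n^'n)"
  shows "(\<lambda>x. coeff (charpoly (A x)) k) \<in> F"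
proof -
  have P: "(\<lambda>x. coeff (\<Prod>i\<in>I. Q i x) k) \<in> F" if "\<And>i k. i \<in> I \<Longrightarrow> (\<lambda>x. coeff (Q i x) k) \<in> F"
    for I :: "'n set" and Q :: "'n \<Rightarrow> 'x \<Rightarrow> complex poly" and k
    using that
  proof (induction I arbitrary: k rule: infinite_finite_induct)
    case (insert i I)
    have "(\<lambda>x. \<Sum>l\<le>k. coeff (Q i x) l * coeff (\<Prod>i\<in>I. Q i x) (k - l)) \<in> F"
      by (intro sum mult insert.IH insert.prems) auto
    then show ?case using insert.hyps by (simp add: coeff_mult)
  qed (simp_all add: const)
  have entry: "(\<lambda>x. coeff ((if i = j then [:0, 1:] else 0) - [:A x $ i $ j:]) k) \<in> F" for i j k
  proof (cases k)
    case 0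
    have "(\<lambda>x. - (A x $ i $ j)) \<in> F" using assms by (intro uminus) (auto simp: mat_in_def)
    then show ?thesis using 0 by (cases "i = j") simp_all
  next
    case (Suc l)
    then show ?thesis by (cases "i = j") (simp_all add: const)
  qed
  have "coeff (charpoly (A x)) k = (\<Sum>p\<in>{p. p permutes (UNIV::'n set)}. of_int (sign p) *
      coeff (\<Prod>i\<in>UNIV. (if i = p i then [:0, 1:] else 0) - [:A x $ i $ p i:]) k)" for x
    unfolding charpoly_def det_def coeff_sum vec_lambda_beta
  proof (rule sum.cong[OF refl])
    fix p
    show "coeff (of_int (sign p) * (\<Prod>i\<in>UNIV. (if i = p i then [:0, 1:] else 0) - [:A x $ i $ p i:])) k =
       of_int (sign p) * coeff (\<Prod>i\<in>UNIV. (if i = p i then [:0, 1:] else 0) - [:A x $ i $ p i:]) k"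
      by (simp add: of_int_poly)
  qed
  moreover have "(\<lambda>x. \<Sum>p\<in>{p. p permutes (UNIV::'n set)}. of_int (sign p) *
      coeff (\<Prod>i\<in>UNIV. (if i = p i then [:0, 1:] else 0) - [:A x $ i $ p i:]) k) \<in> F"
    by (intro sum mult const P entry)
  ultimately show ?thesis by simp
qed

lemma sigma_in: "mat_in A \<Longrightarrow> (\<lambda>x. sigma (A x) $ i) \<in> F"
  unfolding sigma_def sigma_coeff_def vec_lambda_beta by (intro mult const charpoly_coeff_in)

lemma companion_in:
  fixes s :: "'x \<Rightarrow> complex^'n"
  assumes "\<And>i. (\<lambda>x. s x $ i) \<in> F"
  shows "mat_in (\<lambda>x. companion (s x))"
  unfolding mat_in_def
proof (intro allI)
  fix i j :: 'n
  have "idx_enum i - 1 < CARD('n)" using idx_enum_range[of i] by simp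
  then obtain l :: 'n where l: "idx_enum i - 1 = CARD('n) - idx_enum l" by (rule below_index)
  have "(\<lambda>x. - ((-1) ^ idx_enum l * s x $ l)) \<in> F" by (intro uminus mult const assms)
  then show "(\<lambda>x. companion (s x) $ i $ j) \<in> F"
    unfolding companion_def vec_lambda_beta l coeff_sympoly_below
    by (cases "idx_enum j = CARD('n)") (simp_all add: const)
qed

end

interpretation poly_fun: function_algebra "range (poly :: complex poly \<Rightarrow> complex \<Rightarrow> complex)"
proof
  show "(\<lambda>_. c) \<in> range poly" for c :: complex
    by (rule range_eqI[of _ _ "[:c:]"]) auto
  fix f g :: "complex \<Rightarrow> complex"
  assume "f \<in> range poly" "g \<in> range poly"
  then obtain p q where "f = poly p" "g = poly q" by blast
  then have "(\<lambda>x. f x + g x) = poly (p + q)" "(\<lambda>x. f x * g x) = poly (p * q)" by auto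
  then show "(\<lambda>x. f x + g x) \<in> range poly" "(\<lambda>x. f x * g x) \<in> range poly" by blast+
qed

lemma poly_fun_line: "poly_fun.mat_in (\<lambda>z. A + mscale z B)"
proof (intro poly_fun.mat_in_add poly_fun.mat_in_mscale poly_fun.mat_in_const)
  show "(\<lambda>z::complex. z) \<in> range poly" by (rule range_eqI[of _ _ "[:0, 1:]"]) auto
qed

interpretation cont_fun: function_algebra "{f :: 'a::topological_space \<Rightarrow> complex. continuous_on UNIV f}"
  by standard (auto intro!: continuous_intros)

text \<open>A Lipschitz bound against the fixed point p only: this is what carries a logarithmic
  pole through a composition, and it is stable under products.\<close>

definition lipschitz_at :: "'a::real_normed_vector \<Rightarrow> ('a \<Rightarrow> 'b::real_normed_vector) \<Rightarrow> bool" where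
  "lipschitz_at p f \<longleftrightarrow> (\<exists>K>0. \<forall>\<^sub>F w in at p. norm (f w - f p) \<le> K * norm (w - p))"

lemma lipschitz_atI:
  assumes "\<forall>\<^sub>F w in at p. norm (f w - f p) \<le> K * norm (w - p)"
  shows "lipschitz_at p f"
  unfolding lipschitz_at_def
proof (intro exI[of _ "\<bar>K\<bar> + 1"] conjI)
  show "\<forall>\<^sub>F w in at p. norm (f w - f p) \<le> (\<bar>K\<bar> + 1) * norm (w - p)"
    using assms
  proof eventually_elim
    case (elim w)
    have "K * norm (w - p) \<le> (\<bar>K\<bar> + 1) * norm (w - p)" by (intro mult_right_mono) auto
    with elim show ?case by linarith
  qed
qed simp

interpretation lip_fun: function_algebra "{f :: 'a::real_normed_vector \<Rightarrow> complex. lipschitz_at p f}" for p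
proof
  show "(\<lambda>_. c) \<in> {f :: 'a \<Rightarrow> complex. lipschitz_at p f}" for c
    by (auto intro: lipschitz_atI[of _ _ 0])
  fix f g :: "'a \<Rightarrow> complex"
  assume "f \<in> {f. lipschitz_at p f}" "g \<in> {f. lipschitz_at p f}"
  then obtain K L where K: "K > 0" "\<forall>\<^sub>F w in at p. norm (f w - f p) \<le> K * norm (w - p)"
    and L: "L > 0" "\<forall>\<^sub>F w in at p. norm (g w - g p) \<le> L * norm (w - p)"
    unfolding lipschitz_at_def by blast
  have "\<forall>\<^sub>F w in at p. norm (f w + g w - (f p + g p)) \<le> (K + L) * norm (w - p)"
    using K(2) L(2)
  proof eventually_elim
    case (elim w)
    have "norm (f w + g w - (f p + g p)) \<le> norm (f w - f p) + norm (g w - g p)"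
      using norm_triangle_ineq[of "f w - f p" "g w - g p"] by (simp add: algebra_simps)
    then show ?case using elim by (simp add: algebra_simps)
  qed
  then show "(\<lambda>x. f x + g x) \<in> {f. lipschitz_at p f}" by (auto intro: lipschitz_atI)
  have "\<forall>\<^sub>F w in at p. norm (w - p) < 1"
    unfolding eventually_at by (rule exI[of _ 1]) (auto simp: dist_norm)
  then have "\<forall>\<^sub>F w in at p. norm (f w * g w - f p * g p) \<le> (K * (norm (g p) + L) + norm (f p) * L) * norm (w - p)"
    using K(2) L(2)
  proof eventually_elim
    case (elim w)
    have "L * norm (w - p) \<le> L * 1" using elim(1) L(1) by (intro mult_left_mono) auto
    then have gw: "norm (g w) \<le> norm (g p) + L"
      using norm_triangle_ineq[of "g p" "g w - g p"] elim(3) by simp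
    have "f w * g w - f p * g p = (f w - f p) * g w + f p * (g w - g p)" by (simp add: algebra_simps)
    then have "norm (f w * g w - f p * g p) \<le> norm (f w - f p) * norm (g w) + norm (f p) * norm (g w - g p)"
      by (metis norm_mult norm_triangle_ineq)
    also have "\<dots> \<le> (K * norm (w - p)) * (norm (g p) + L) + norm (f p) * (L * norm (w - p))"
      using elim(2,3) gw K(1) L(1) by (intro add_mono mult_mono) auto
    finally show ?case by (simp add: algebra_simps)
  qed
  then show "(\<lambda>x. f x * g x) \<in> {f. lipschitz_at p f}" by (auto intro: lipschitz_atI)
qed

lemma norm_vec_le_sum: "norm (x :: 'a::real_normed_vector^'n) \<le> (\<Sum>i\<in>UNIV. norm (x $ i))"
  unfolding norm_vec_def by (rule L2_set_le_sum) simp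

lemma lipschitz_at_vec:
  fixes f :: "'a::real_normed_vector \<Rightarrow> 'b::real_normed_vector^'n"
  assumes "\<And>i. lipschitz_at p (\<lambda>x. f x $ i)"
  shows "lipschitz_at p f"
proof -
  have "\<forall>i. \<exists>K>0. \<forall>\<^sub>F w in at p. norm (f w $ i - f p $ i) \<le> K * norm (w - p)"
    using assms unfolding lipschitz_at_def by blast
  then obtain K where K: "\<And>i. \<forall>\<^sub>F w in at p. norm (f w $ i - f p $ i) \<le> K i * norm (w - p)"
    by metis
  have "\<forall>\<^sub>F w in at p. \<forall>i. norm (f w $ i - f p $ i) \<le> K i * norm (w - p)"
    using K by (simp add: eventually_all_finite)
  then have "\<forall>\<^sub>F w in at p. norm (f w - f p) \<le> (\<Sum>i\<in>UNIV. K i) * norm (w - p)"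
  proof eventually_elim
    case (elim w)
    have "norm (f w - f p) \<le> (\<Sum>i\<in>UNIV. norm ((f w - f p) $ i))" by (rule norm_vec_le_sum)
    also have "\<dots> \<le> (\<Sum>i\<in>UNIV. K i * norm (w - p))" using elim by (intro sum_mono) simp
    finally show ?case by (simp add: sum_distrib_right)
  qed
  then show ?thesis by (rule lipschitz_atI)
qed

lemma lipschitz_at_mat: "lip_fun.mat_in p A \<Longrightarrow> lipschitz_at p A"
  by (intro lipschitz_at_vec) (simp add: lip_fun.mat_in_def)

lemma lip_fun_id: "lip_fun.mat_in p (\<lambda>A::complex^'n^'n. A)"
  unfolding lip_fun.mat_in_def
proof (intro allI CollectI lipschitz_atI)
  fix i j :: 'n
  have "norm (w $ i $ j - p $ i $ j) \<le> 1 * norm (w - p)" for w :: "complex^'n^'n"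
    using Finite_Cartesian_Product.norm_nth_le[of "(w - p) $ i" j]
      Finite_Cartesian_Product.norm_nth_le[of "w - p" i] by simp
  then show "\<forall>\<^sub>F w in at p. norm (w $ i $ j - p $ i $ j) \<le> 1 * norm (w - p)"
    by (rule always_eventually[OF allI])
qed

lemma cont_fun_id: "cont_fun.mat_in (\<lambda>A::complex^'n^'n. A)"
  unfolding cont_fun.mat_in_def by (intro allI CollectI continuous_intros)

lemma lipschitz_at_sigma: "lipschitz_at p (sigma :: complex^'n^'n \<Rightarrow> complex^'n)"
  by (rule lipschitz_at_vec) (use lip_fun.sigma_in[OF lip_fun_id] in auto)

lemma lip_fun_section:
  fixes P Q :: "complex^'n^'n"
  shows "lip_fun.mat_in p (\<lambda>s::complex^'n. P ** companion s ** Q)"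
proof (intro lip_fun.mat_in_mult lip_fun.mat_in_const lip_fun.companion_in CollectI lipschitz_atI)
  fix i :: 'n
  show "\<forall>\<^sub>F w in at p. norm (w $ i - p $ i) \<le> 1 * norm (w - p)"
    by (rule always_eventually[OF allI]) (metis Finite_Cartesian_Product.norm_nth_le mult_1 vector_minus_component)
qed

lemma continuous_on_mat:
  assumes "cont_fun.mat_in (A :: 'a::topological_space \<Rightarrow> complex^'n^'n)"
  shows "continuous_on S A"
proof -
  have "continuous_on S (\<lambda>x. \<chi> i j. A x $ i $ j)"
    using assms unfolding cont_fun.mat_in_def
    by (intro continuous_on_vec_lambda) (auto intro: continuous_on_subset)
  then show ?thesis by (simp add: vec_lambda_eta)
qed

lemma cont_fun_section:
  fixes P Q :: "complex^'n^'n"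
  shows "cont_fun.mat_in (\<lambda>s::complex^'n. P ** companion s ** Q)"
  by (intro cont_fun.mat_in_mult cont_fun.mat_in_const cont_fun.companion_in CollectI continuous_intros)

lemma continuous_sigma: "continuous_on S (sigma :: complex^'n^'n \<Rightarrow> complex^'n)"
proof -
  have "continuous_on S (\<lambda>A::complex^'n^'n. \<chi> i. sigma A $ i)"
    using cont_fun.sigma_in[OF cont_fun_id]
    by (intro continuous_on_vec_lambda) (auto intro: continuous_on_subset)
  then show ?thesis by (simp add: vec_lambda_eta)
qed

lemma sigma_line:
  fixes A B :: "complex^'n^'n"
  obtains P where "\<And>z. sigma (A + mscale z B) = (\<chi> i. poly (P i) z)"
proof -
  have "\<exists>p. \<forall>z. sigma (A + mscale z B) $ i = poly p z" for i
  proof -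
    obtain p where "(\<lambda>z. sigma (A + mscale z B) $ i) = poly p"
      using poly_fun.sigma_in[OF poly_fun_line, of A B i] by (rule imageE)
    then show ?thesis by (metis fun_cong)
  qed
  then obtain P where "\<And>i z. sigma (A + mscale z B) $ i = poly (P i) z" by metis
  then show ?thesis by (intro that[of P]) (simp add: vec_eq_iff)
qed

section \<open>The domains\<close>

lemma mscale_vec: "mscale c A = (\<chi> i. c *s (A $ i))"
  by (simp add: mscale_def vec_eq_iff)

lemma norm_mscale: "norm (mscale c A) = cmod c * norm (A :: complex^'n^'n)"
proof -
  have "norm (mscale c A) = L2_set (\<lambda>i. cmod c * norm (A $ i)) UNIV"
    unfolding norm_vec_def[of "mscale c A"] by (simp add: mscale_vec norm_smult_vec)
  then show ?thesis by (simp add: L2_set_right_distrib norm_vec_def[of A])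
qed

lemma bounded_bilinear_mscale: "bounded_bilinear (mscale :: complex \<Rightarrow> complex^'n^'n \<Rightarrow> complex^'n^'n)"
proof
  show "\<exists>K. \<forall>a b. norm (mscale a (b :: complex^'n^'n)) \<le> norm a * norm b * K"
    by (rule exI[of _ 1]) (simp add: norm_mscale)
qed (simp_all add: mscale_def vec_eq_iff algebra_simps)

text \<open>Nonzero w stand for the inverses of possible eigenvalues of modulus at least 1. The
  condition now ranges over a compact disc, so the tube lemma yields openness of the spectral
  ball.\<close>

lemma spectral_ball_det:
  "A \<in> spectral_ball \<longleftrightarrow> (\<forall>w\<in>cball 0 1. det (mat 1 - mscale w A) \<noteq> 0)"
  for A :: "complex^'n^'n"
proof -
  have eq: "det (mat 1 - mscale w A) = w ^ CARD('n) * poly (charpoly A) (inverse w)" if "w \<noteq> 0" for w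
  proof -
    have "mat 1 - mscale w A = mat w ** (mat (inverse w) - A)"
      using that by (simp add: matrix_diff_ldistrib mat_mult_left[of w A] flip: mat_mult)
    moreover have "det (mat w :: complex^'n^'n) = w ^ CARD('n)"
      by (subst det_diagonal) (simp_all add: mat_def)
    ultimately show ?thesis by (simp add: det_mul poly_charpoly)
  qed
  have zero: "mat 1 - mscale 0 A = mat 1" by (simp add: mscale_def vec_eq_iff)
  show ?thesis
    unfolding spectral_ball_iff
  proof (intro iffI ballI allI impI)
    fix w :: complex
    assume A: "\<forall>\<mu>. poly (charpoly A) \<mu> = 0 \<longrightarrow> cmod \<mu> < 1" and w: "w \<in> cball 0 1"
    show "det (mat 1 - mscale w A) \<noteq> 0"
    proof (cases "w = 0")
      case False
      have "1 \<le> cmod (inverse w)" using w False by (simp add: norm_inverse one_le_inverse)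
      then have "poly (charpoly A) (inverse w) \<noteq> 0" using A by force
      then show ?thesis using False by (simp add: eq)
    qed (use zero in simp)
  next
    fix \<mu> assume A: "\<forall>w\<in>cball 0 1. det (mat 1 - mscale w A) \<noteq> 0" and \<mu>: "poly (charpoly A) \<mu> = 0"
    show "cmod \<mu> < 1"
    proof (rule ccontr)
      assume "\<not> cmod \<mu> < 1"
      then have "\<mu> \<noteq> 0" "inverse \<mu> \<in> cball 0 1" by (auto simp: norm_inverse inverse_le_1_iff)
      then show False using A \<mu> eq[of "inverse \<mu>"] by auto
    qed
  qed
qed

lemma open_spectral_ball: "open (spectral_ball :: (complex^'n^'n) set)"
proof -
  let ?g = "\<lambda>x::(complex^'n^'n) \<times> complex. det (mat 1 + mscale (- snd x) (fst x))"
  have "cont_fun.mat_in (\<lambda>x::(complex^'n^'n) \<times> complex. mat 1 + mscale (- snd x) (fst x))"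
    by (intro cont_fun.mat_in_add cont_fun.mat_in_const cont_fun.mat_in_mscale)
       (auto simp: cont_fun.mat_in_def intro!: continuous_intros)
  then have "continuous_on UNIV ?g" using cont_fun.det_in by blast
  then have W: "open {x. ?g x \<noteq> 0}" by (intro open_Collect_neq continuous_on_const)
  have eq: "mat 1 + mscale (- w) A = mat 1 - mscale w A" for w and A :: "complex^'n^'n"
    by (simp add: mscale_def vec_eq_iff)
  have sub: "{A} \<times> cball 0 1 \<subseteq> {x. ?g x \<noteq> 0} \<longleftrightarrow> A \<in> spectral_ball" for A
    unfolding spectral_ball_det by (auto simp: eq)
  show ?thesis
  proof (subst open_subopen, intro ballI)
    fix A :: "complex^'n^'n" assume "A \<in> spectral_ball"
    then obtain X where X: "A \<in> X" "open X" "X \<times> cball 0 1 \<subseteq> {x. ?g x \<noteq> 0}"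
      using Elementary_Topology.tube_lemma[OF compact_cball W, of A 0 1] sub[of A] by blast
    have "X \<subseteq> spectral_ball"
    proof
      fix B assume "B \<in> X"
      then have "{B} \<times> cball 0 1 \<subseteq> {x. ?g x \<noteq> 0}" using X(3) by blast
      then show "B \<in> spectral_ball" using sub by blast
    qed
    then show "\<exists>T. open T \<and> A \<in> T \<and> T \<subseteq> spectral_ball" using X by blast
  qed
qed

lemma open_symm_polydisk: "open (symm_polydisk :: (complex^'n) set)"
proof -
  have "continuous_on UNIV (companion :: complex^'n \<Rightarrow> complex^'n^'n)"
    using continuous_on_mat[OF cont_fun_section[of "mat 1" "mat 1"]] by simp
  then have "open (companion -` (spectral_ball :: (complex^'n^'n) set))"
    by (rule open_vimage[OF open_spectral_ball])
  moreover have "companion -` (spectral_ball :: (complex^'n^'n) set) = symm_polydisk"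
    using symm_polydisk_iff by blast
  ultimately show ?thesis by simp
qed

lemma sigma_in_symm_polydisk: "A \<in> spectral_ball \<Longrightarrow> sigma A \<in> symm_polydisk"
  by (simp add: symm_polydisk_def)

section \<open>Comparing Green functions\<close>

lemma green_ge: "neg_psh sc D u \<Longrightarrow> log_pole p u \<Longrightarrow> u z \<le> green sc D p z"
  unfolding green_alt by (rule Sup_upper) blast

text \<open>For g(w) different from q the Lipschitz bound and monotonicity of the logarithm suffice.
  A non-injective g may also hit q near p, and there the value -\<infinity> is used.\<close>

lemma log_pole_compose:
  assumes v: "log_pole q v" "v q = - \<infinity>" and g: "lipschitz_at p g" "g p = q"
  shows "log_pole p (\<lambda>w. v (g w))"
proof -
  obtain K where K: "K > 0" "\<forall>\<^sub>F w in at p. norm (g w - q) \<le> K * norm (w - p)"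
    using g unfolding lipschitz_at_def by blast
  obtain C d where d: "d > 0" "\<And>w. w \<noteq> q \<Longrightarrow> dist w q < d \<Longrightarrow> v w \<le> ereal (ln (norm (w - q)) + C)"
    using v(1) unfolding log_pole_def eventually_at by auto
  have "\<forall>\<^sub>F w in at p. dist w p < d / K"
    unfolding eventually_at by (rule exI[of _ "d / K"]) (use d K in auto)
  moreover have "\<forall>\<^sub>F w in at p. w \<noteq> p" by (simp add: eventually_at_filter)
  ultimately have "\<forall>\<^sub>F w in at p. v (g w) \<le> ereal (ln (norm (w - p)) + (ln K + C))"
    using K(2)
  proof eventually_elim
    case (elim w)
    show ?case
    proof (cases "g w = q")
      case False
      have "K * norm (w - p) < d" using elim(1) K(1) by (simp add: dist_norm field_simps)
      then have "dist (g w) q < d" using elim(3) by (simp add: dist_norm)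
      then have "v (g w) \<le> ereal (ln (norm (g w - q)) + C)" by (rule d(2)[OF False])
      also have "ln (norm (g w - q)) \<le> ln (K * norm (w - p))"
        using False elim(3) by (intro ln_mono) auto
      also have "ln (K * norm (w - p)) = ln K + ln (norm (w - p))"
        using K(1) elim(2) by (simp add: ln_mult)
      finally show ?thesis by (simp add: algebra_simps)
    qed (simp add: v(2))
  qed
  then show ?thesis unfolding log_pole_def by blast
qed

lemma open_pole_value:
  fixes p :: "'a::euclidean_space"
  assumes "neg_psh sc D u" "bounded_bilinear sc" "\<And>z b. norm (sc z b) = cmod z * norm b"
    "log_pole p u" "open D" "p \<in> D"
  shows "u p = - \<infinity>"
proof -
  obtain R where "R > 0" "cball p R \<subseteq> D" using assms(5,6) open_contains_cball by blast
  then show ?thesis using neg_psh_pole_value[OF assms(1-4)] by blast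
qed

lemma neg_psh_sigma:
  assumes u: "neg_psh (*s) symm_polydisk u"
  shows "neg_psh mscale spectral_ball (\<lambda>M. u (sigma (M :: complex^'n^'n)))"
  unfolding neg_psh_def
proof (intro conjI ballI allI impI)
  fix M :: "complex^'n^'n" assume "M \<in> spectral_ball"
  then show "u (sigma M) < 0" using u sigma_in_symm_polydisk unfolding neg_psh_def by blast
next
  fix c
  have "usc_on spectral_ball (\<lambda>M :: complex^'n^'n. u (sigma M))"
    by (rule usc_on_compose[OF neg_psh_usc[OF u] continuous_sigma]) (auto intro: sigma_in_symm_polydisk)
  then show "openin (top_of_set spectral_ball) {M :: complex^'n^'n \<in> spectral_ball. u (sigma M) < c}"
    by (simp add: usc_on_def)
next
  fix A B :: "complex^'n^'n" and r :: real
  assume r: "r > 0" and disc: "\<forall>z. cmod z \<le> r \<longrightarrow> A + mscale z B \<in> spectral_ball"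
  obtain P where P: "\<And>z. sigma (A + mscale z B) = (\<chi> i. poly (P i) z)" using sigma_line[of A B] by blast
  have "A = A + mscale 0 B" by (simp add: mscale_def vec_eq_iff)
  then have P0: "sigma A = (\<chi> i. poly (P i) 0)" using P[of 0] by simp
  have "(\<chi> i. poly (P i) z) \<in> symm_polydisk" if "z \<in> cball 0 r" for z
    unfolding P[symmetric] using disc that by (intro sigma_in_symm_polydisk) simp
  from neg_psh_polynomial_curve[OF u open_symm_polydisk r this]
  show "(\<integral>\<^sup>+t\<in>{0..2*pi}. e2ennreal (- u (sigma (A + mscale (of_real r * cis t) B))) \<partial>lborel)
     \<le> ennreal (2*pi) * e2ennreal (- u (sigma A))"
    unfolding P P0 .
qed

lemma neg_psh_fibre:
  fixes A B :: "complex^'n^'n"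
  assumes v: "neg_psh mscale spectral_ball v" and AB: "charpoly A = charpoly B" and A: "A \<in> spectral_ball"
  shows "v A = v B"
proof -
  \<comment> \<open>\<open>fibre_constant\<close> asks for a function on all matrices. The value 0
    outside the ball is harmless, since a line in a fibre lies either entirely inside the ball or
    entirely outside.\<close>
  define f where "f M = (if M \<in> spectral_ball then v M else 0)" for M :: "complex^'n^'n"
  have "f (M + N) = f M" if line: "\<And>z. charpoly (M + mscale z N) = charpoly M" for M N
  proof (cases "M \<in> spectral_ball")
    case True
    have "M + mscale z N \<in> spectral_ball" for z using spectral_ball_cong[OF line[of z]] True by simp
    from neg_psh_Liouville[OF v bounded_bilinear_mscale this, of 1 0]
    have "v (M + N) = v M" by (simp add: bounded_bilinear.zero_left[OF bounded_bilinear_mscale])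
    moreover have "M + N \<in> spectral_ball" using spectral_ball_cong[OF line[of 1]] True by simp
    ultimately show ?thesis using True by (simp add: f_def)
  next
    case False
    then show ?thesis using spectral_ball_cong[OF line[of 1]] by (simp add: f_def)
  qed
  from fibre_constant[of f, OF this AB] show ?thesis
    using A spectral_ball_cong[OF AB] by (simp add: f_def)
qed

lemma neg_psh_section:
  fixes P Q :: "complex^'n^'n"
  assumes v: "neg_psh mscale spectral_ball v" and PQ: "P ** Q = mat 1" "Q ** P = mat 1"
  shows "neg_psh (*s) symm_polydisk (\<lambda>s. v (P ** companion s ** Q))"
proof -
  have S: "P ** companion s ** Q \<in> spectral_ball \<longleftrightarrow> s \<in> symm_polydisk" for s
    unfolding symm_polydisk_iff by (rule spectral_ball_cong) (rule charpoly_similar[OF PQ(2,1)])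
  show ?thesis
    unfolding neg_psh_def
  proof (intro conjI ballI allI impI)
    fix s :: "complex^'n" assume "s \<in> symm_polydisk"
    then show "v (P ** companion s ** Q) < 0" using v S unfolding neg_psh_def by blast
  next
    fix c
    have "usc_on symm_polydisk (\<lambda>s. v (P ** companion s ** Q))"
      by (rule usc_on_compose[OF neg_psh_usc[OF v] continuous_on_mat[OF cont_fun_section]]) (use S in auto)
    then show "openin (top_of_set symm_polydisk) {s \<in> symm_polydisk. v (P ** companion s ** Q) < c}"
      by (simp add: usc_on_def)
  next
    fix a b :: "complex^'n" and r :: real
    assume r: "r > 0" and disc: "\<forall>z. cmod z \<le> r \<longrightarrow> a + z *s b \<in> symm_polydisk"
    define A where "A = P ** companion a ** Q"
    define B where "B = P ** (companion (a + b) - companion a) ** Q"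
    have line: "P ** companion (a + z *s b) ** Q = A + mscale z B" for z
      unfolding A_def B_def
      by (subst companion_affine) (simp add: matrix_add_ldistrib matrix_add_rdistrib mscale_mult)
    have "\<forall>z. cmod z \<le> r \<longrightarrow> A + mscale z B \<in> spectral_ball"
      unfolding line[symmetric] S using disc .
    then show "(\<integral>\<^sup>+t\<in>{0..2*pi}. e2ennreal (- v (P ** companion (a + (of_real r * cis t) *s b) ** Q)) \<partial>lborel)
     \<le> ennreal (2*pi) * e2ennreal (- v (P ** companion a ** Q))"
      unfolding line using v r unfolding neg_psh_def A_def[symmetric] by blast
  qed
qed

theorem green_cyclic:
  fixes V M :: "complex^'n^'n"
  assumes V: "V \<in> spectral_ball" and M: "M \<in> spectral_ball" and cyc: "cyclic_matrix V"
  shows "green mscale spectral_ball V M = green (*s) symm_polydisk (sigma V) (sigma M)"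
proof (rule antisym)
  obtain P Q :: "complex^'n^'n" where PQ: "P ** Q = mat 1" "Q ** P = mat 1" "V = P ** companion (sigma V) ** Q"
    by (rule cyclic_similar_companion[OF cyc])
  show "green mscale spectral_ball V M \<le> green (*s) symm_polydisk (sigma V) (sigma M)"
    unfolding green_alt[of mscale]
  proof (rule Sup_least)
    fix y assume "y \<in> {v M | v. neg_psh mscale spectral_ball v \<and> log_pole V v}"
    then obtain v where v: "y = v M" "neg_psh mscale spectral_ball v" "log_pole V v" by blast
    have vV: "v V = - \<infinity>"
      by (rule open_pole_value[OF v(2) bounded_bilinear_mscale norm_mscale v(3) open_spectral_ball V])
    have "charpoly M = charpoly (P ** companion (sigma M) ** Q)"
      by (simp add: charpoly_similar[OF PQ(2,1)] charpoly_companion sympoly_sigma)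
    then have "y = v (P ** companion (sigma M) ** Q)"
      unfolding v(1) by (rule neg_psh_fibre[OF v(2) _ M])
    also have "\<dots> \<le> green (*s) symm_polydisk (sigma V) (sigma M)"
    proof (rule green_ge[OF neg_psh_section[OF v(2) PQ(1,2)]])
      show "log_pole (sigma V) (\<lambda>s. v (P ** companion s ** Q))"
        by (rule log_pole_compose[OF v(3) vV lipschitz_at_mat[OF lip_fun_section] PQ(3)[symmetric]])
    qed
    finally show "y \<le> green (*s) symm_polydisk (sigma V) (sigma M)" .
  qed
  show "green (*s) symm_polydisk (sigma V) (sigma M) \<le> green mscale spectral_ball V M"
    unfolding green_alt[of "(*s)"]
  proof (rule Sup_least)
    fix y assume "y \<in> {u (sigma M) | u. neg_psh (*s) symm_polydisk u \<and> log_pole (sigma V) u}"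
    then obtain u where u: "y = u (sigma M)" "neg_psh (*s) symm_polydisk u" "log_pole (sigma V) u" by blast
    have "u (sigma V) = - \<infinity>"
      by (rule open_pole_value[OF u(2) bounded_bilinear_smult norm_smult_vec u(3) open_symm_polydisk
            sigma_in_symm_polydisk[OF V]])
    then have "log_pole V (\<lambda>A. u (sigma A))"
      by (rule log_pole_compose[OF u(3) _ lipschitz_at_sigma refl])
    from green_ge[OF neg_psh_sigma[OF u(2)] this, of M]
    show "y \<le> green mscale spectral_ball V M" by (simp add: u(1))
  qed
qed

section \<open>Derogatory matrices\<close>

text \<open>The factorisation of t^n - 1, whose roots are simple, homogenised by t = s / z.\<close>

lemma prod_roots_of_unity:
  fixes s z :: complex
  assumes n: "n > 0"
  shows "(\<Prod>k<n. s - z * cis (2 * pi * real k / real n)) = s ^ n - z ^ n"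
proof (cases "z = 0")
  case False
  let ?p = "monom 1 n - 1 :: complex poly"
  have "coeff ?p n = 1" using n by simp
  then have "n \<le> degree ?p" by (intro le_degree) simp
  moreover have "degree ?p \<le> n" using n by (intro degree_le) auto
  ultimately have deg: "degree ?p = n" by simp
  then have lc: "lead_coeff ?p = 1" using n by (simp add: coeff_monom)
  have "rsquarefree ?p"
    unfolding rsquarefree_roots
    using n by (auto simp: poly_monom pderiv_diff pderiv_monom power_0_left)
  from complex_poly_decompose_rsquarefree[OF this]
  have p: "(\<Prod>w | poly ?p w = 0. [:-w, 1:]) = ?p" unfolding lc by simp
  have "(\<Prod>k<n. x - cis (2 * pi * real k / real n)) = x ^ n - 1" for x
  proof -
    have "(\<Prod>k<n. x - cis (2 * pi * real k / real n)) = (\<Prod>w | w ^ n = 1. x - w)"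
      by (rule prod.reindex_bij_betw[OF Complex.bij_betw_roots_unity[OF n]])
    also have "\<dots> = poly (\<Prod>w | poly ?p w = 0. [:-w, 1:]) x"
      by (simp add: poly_prod poly_monom)
    also have "\<dots> = x ^ n - 1" unfolding p by (simp add: poly_monom)
    finally show ?thesis .
  qed
  from this[of "s / z"] have "z ^ n * (\<Prod>k<n. s / z - cis (2 * pi * real k / real n)) = z ^ n * ((s / z) ^ n - 1)"
    by simp
  also have "z ^ n * (\<Prod>k<n. s / z - cis (2 * pi * real k / real n)) = (\<Prod>k<n. z * (s / z - cis (2 * pi * real k / real n)))"
    by (simp add: prod.distrib)
  also have "\<dots> = (\<Prod>k<n. s - z * cis (2 * pi * real k / real n))"
    using False by (simp add: right_diff_distrib)
  also have "z ^ n * ((s / z) ^ n - 1) = s ^ n - z ^ n"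
    using False by (simp add: power_divide right_diff_distrib)
  finally show ?thesis .
qed (use n in \<open>simp add: power_0_left\<close>)

text \<open>q(M) is Lipschitz at V and vanishes there, so each further factor gains one power of |M
  - V|. Entrywise bounds cost a factor n per product.\<close>

lemma pm_power_bound:
  fixes V :: "complex^'n^'n"
  assumes q: "pm V q = 0"
  shows "\<exists>K>0. \<forall>\<^sub>F M in at V. \<forall>i j. cmod (pm M (q ^ k) $ i $ j) \<le> K * norm (M - V) ^ k"
proof (induction k)
  case 0
  show ?case by (rule exI[of _ 1]) (simp add: mat_def)
next
  case (Suc k)
  then obtain K where K: "K > 0" "\<forall>\<^sub>F M in at V. \<forall>i j. cmod (pm M (q ^ k) $ i $ j) \<le> K * norm (M - V) ^ k"
    by blast
  have "lip_fun.mat_in V (\<lambda>M. pm M q)" by (rule lip_fun.pm_in[OF lip_fun_id])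
  then have "lipschitz_at V (\<lambda>M. pm M q)" by (rule lipschitz_at_mat)
  then obtain L where L: "L > 0" "\<forall>\<^sub>F M in at V. norm (pm M q) \<le> L * norm (M - V)"
    unfolding lipschitz_at_def q by auto
  have "\<forall>\<^sub>F M in at V. \<forall>i j. cmod (pm M (q ^ Suc k) $ i $ j) \<le> (real CARD('n) * (L * K)) * norm (M - V) ^ Suc k"
    using K(2) L(2)
  proof eventually_elim
    case (elim M)
    show ?case
    proof (intro allI)
      fix i j
      have "pm M (q ^ Suc k) $ i $ j = (\<Sum>l\<in>UNIV. pm M q $ i $ l * pm M (q ^ k) $ l $ j)"
        by (simp add: pm_mult matrix_matrix_mult_def)
      also have "cmod \<dots> \<le> (\<Sum>l\<in>(UNIV::'n set). (L * norm (M - V)) * (K * norm (M - V) ^ k))"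
      proof (rule sum_norm_le)
        fix l
        have "cmod (pm M q $ i $ l) \<le> norm (pm M q)"
          using Finite_Cartesian_Product.norm_nth_le[of "pm M q $ i" l]
            Finite_Cartesian_Product.norm_nth_le[of "pm M q" i] by simp
        then have "cmod (pm M q $ i $ l) \<le> L * norm (M - V)" using elim(2) by simp
        then show "cmod (pm M q $ i $ l * pm M (q ^ k) $ l $ j) \<le> (L * norm (M - V)) * (K * norm (M - V) ^ k)"
          unfolding norm_mult using elim(1) L(1) by (intro mult_mono) auto
      qed
      finally show "cmod (pm M (q ^ Suc k) $ i $ j) \<le> (real CARD('n) * (L * K)) * norm (M - V) ^ Suc k"
        by (simp add: mult_ac)
    qed
  qed
  moreover have "real CARD('n) * (L * K) > 0" using K(1) L(1) by simp
  ultimately show ?case by blast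
qed

text \<open>The competitor is log |tr q(M)^n| / n up to a constant: since q annihilates V, the trace is of size
  |M - V|^n near V, and it is bounded on the spectral ball because it depends on the eigenvalues only.\<close>
lemma green_lower:
  fixes V :: "complex^'n^'n"
  assumes V: "V \<in> spectral_ball" and q: "pm V q = 0" and n: "n > 0"
  obtains C where "\<And>M. log_mod (1 / real n) C (trace (pm M (q ^ n))) \<le> green mscale spectral_ball V M"
proof -
  define F where "F M = trace (pm M (q ^ n))" for M :: "complex^'n^'n"
  have "continuous_on (cball 0 1) (poly q)" by (intro continuous_intros)
  then have "bounded (poly q ` cball 0 1)" by (intro compact_imp_bounded compact_continuous_image) auto
  then obtain B where B: "B > 0" "\<And>z. cmod z \<le> 1 \<Longrightarrow> cmod (poly q z) \<le> B"
    unfolding bounded_pos by auto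
  define b where "b = real CARD('n) * B ^ n"
  have b: "b > 0" using B by (simp add: b_def)
  have Fb: "cmod (F M) \<le> b" if M: "M \<in> spectral_ball" for M
  proof -
    obtain P Q T :: "complex^'n^'n" where *: "P ** Q = mat 1" "Q ** P = mat 1" "M = P ** T ** Q"
      and T: "\<And>i j. idx_enum i > idx_enum j \<Longrightarrow> T$i$j = 0"
      by (rule triangularisation[of M 0]) (rule that)
    have cp: "charpoly M = (\<Prod>i\<in>UNIV. [:- T$i$i, 1:])"
      unfolding *(3) charpoly_similar[OF *(2,1)] by (rule charpoly_triangular_idx) (rule T)
    have "F M = (\<Sum>i\<in>UNIV. poly (q ^ n) (T$i$i))"
      unfolding F_def *(3) by (rule trace_pm[OF *(1,2) T])
    also have "cmod \<dots> \<le> (\<Sum>i\<in>(UNIV::'n set). B ^ n)"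
    proof (rule sum_norm_le)
      fix i :: 'n
      have "poly (charpoly M) (T$i$i) = 0" unfolding cp by (auto simp: poly_prod)
      then have "cmod (T$i$i) \<le> 1" using M unfolding spectral_ball_iff by (simp add: less_imp_le)
      then show "cmod (poly (q ^ n) (T$i$i)) \<le> B ^ n"
        using B(2) by (simp add: norm_power power_mono)
    qed
    finally show ?thesis by (simp add: b_def)
  qed
  define c where "c = 1 / real n"
  have c: "c > 0" using n by (simp add: c_def)
  \<comment> \<open>The summand 1 makes the competitor strictly negative, as \<open>neg_psh\<close>
    demands.\<close>
  define C where "C = c * ln b + 1"
  define u where "u M = log_mod c C (F M)" for M
  have uneg: "u M < 0" if "M \<in> spectral_ball" for M
  proof (cases "F M = 0")
    case False
    then have "ln (cmod (F M)) \<le> ln b" using Fb[OF that] by (intro ln_mono) auto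
    then have "c * ln (cmod (F M)) \<le> c * ln b" using c by (intro mult_left_mono) auto
    then show ?thesis using False by (simp add: u_def log_mod_def C_def)
  qed (simp add: u_def log_mod_def)
  have "neg_psh mscale spectral_ball u"
    unfolding neg_psh_def
  proof (intro conjI ballI allI impI)
    fix a
    have "continuous_on UNIV F"
      unfolding F_def using cont_fun.trace_in[OF cont_fun.pm_in[OF cont_fun_id]] by blast
    then have "usc_on spectral_ball u"
      unfolding u_def by (intro usc_on_compose[OF usc_log_mod[OF c]]) (auto intro: continuous_on_subset)
    then show "openin (top_of_set spectral_ball) {x \<in> spectral_ball. u x < a}" by (simp add: usc_on_def)
  next
    fix A D :: "complex^'n^'n" and r :: real
    assume r: "r > 0" and disc: "\<forall>z. cmod z \<le> r \<longrightarrow> A + mscale z D \<in> spectral_ball"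
    obtain p where "(\<lambda>z. F (A + mscale z D)) = poly p"
      using poly_fun.trace_in[OF poly_fun.pm_in[OF poly_fun_line], of A D "q ^ n"] unfolding F_def
      by (rule imageE)
    then have p: "F (A + mscale z D) = poly p z" for z by (rule fun_cong)
    have "A = A + mscale 0 D" by (simp add: mscale_def vec_eq_iff)
    then have p0: "F A = poly p 0" using p[of 0] by simp
    have "log_mod c C (poly p z) \<le> 0" if "z \<in> cball 0 r" for z
      using uneg[of "A + mscale z D"] disc that unfolding u_def p by (simp add: less_imp_le)
    from log_poly_submean[OF c r this]
    show "(\<integral>\<^sup>+t\<in>{0..2*pi}. e2ennreal (- u (A + mscale (of_real r * cis t) D)) \<partial>lborel)
     \<le> ennreal (2*pi) * e2ennreal (- u A)"
      unfolding u_def p p0 .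
  qed (rule uneg)
  moreover have "log_pole V u"
  proof -
    obtain K where K: "K > 0" "\<forall>\<^sub>F M in at V. \<forall>i j. cmod (pm M (q ^ n) $ i $ j) \<le> K * norm (M - V) ^ n"
      using pm_power_bound[OF q] by blast
    have "\<forall>\<^sub>F M in at V. M \<noteq> V" by (simp add: eventually_at_filter)
    with K(2) have "\<forall>\<^sub>F M in at V. u M \<le> ereal (ln (norm (M - V)) + (c * ln (real CARD('n) * K) - C))"
    proof eventually_elim
      case (elim M)
      show ?case
      proof (cases "F M = 0")
        case False
        have "cmod (F M) \<le> (\<Sum>i\<in>(UNIV::'n set). K * norm (M - V) ^ n)"
          unfolding F_def trace_def by (rule sum_norm_le) (use elim in auto)
        then have "cmod (F M) \<le> (real CARD('n) * K) * norm (M - V) ^ n" by simp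
        then have "ln (cmod (F M)) \<le> ln ((real CARD('n) * K) * norm (M - V) ^ n)"
          using False by (intro ln_mono) auto
        also have "\<dots> = ln (real CARD('n) * K) + real n * ln (norm (M - V))"
          using K(1) elim(2) by (simp add: ln_mult ln_realpow)
        finally have "c * ln (cmod (F M)) \<le> c * (ln (real CARD('n) * K) + real n * ln (norm (M - V)))"
          using c by (intro mult_left_mono) auto
        also have "\<dots> = c * ln (real CARD('n) * K) + ln (norm (M - V))"
          using n by (simp add: c_def distrib_left)
        finally show ?thesis using False by (simp add: u_def log_mod_def)
      qed (simp add: u_def log_mod_def)
    qed
    then show ?thesis unfolding log_pole_def by blast
  qed
  ultimately have "u M \<le> green mscale spectral_ball V M" for M by (rule green_ge)
  then show ?thesis by (intro that[of C]) (simp add: u_def F_def c_def)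
qed

theorem green_noncyclic:
  fixes V :: "complex^'n^'n"
  assumes V: "V \<in> spectral_ball" and nc: "\<not> cyclic_matrix V"
  obtains \<mu> X where "is_eigenvalue V \<mu>" "nil_index V \<mu> < alg_mult V \<mu>" "X \<noteq> 0"
    "\<exists>C::real. \<forall>\<^sub>F \<zeta> in at (0::complex). ereal (real (nil_index V \<mu>) * ln (cmod \<zeta>) - C)
        \<le> green mscale spectral_ball V (V + mscale \<zeta> X)"
    "\<exists>C::real. \<forall>\<^sub>F \<zeta> in at (0::complex). green (*s) symm_polydisk (sigma V) (sigma (V + mscale \<zeta> X))
        \<le> ereal (real (alg_mult V \<mu>) * ln (cmod \<zeta>) + C)"
proof -
  obtain \<mu> where \<mu>: "is_eigenvalue V \<mu>" "nil_index V \<mu> < alg_mult V \<mu>"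
    by (rule noncyclic_eigenvalue[OF nc])
  define n where "n = alg_mult V \<mu>"
  define m where "m = nil_index V \<mu>"
  have n: "n > 0" "n \<le> CARD('n)" using \<mu>(2) alg_mult_le[of V \<mu>] by (auto simp: n_def)
  \<comment> \<open>With m = 0 the generalized eigenspace would be trivial, against n > 0.
    Positivity ensures that q below vanishes at \<mu>.\<close>
  have m: "m > 0"
  proof (rule ccontr)
    assume "\<not> m > 0"
    then have "x = 0" if "x \<in> gen_eigenspace V \<mu>" for x
      using nil_index_kills[OF that] by (simp add: m_def)
    then have "gen_eigenspace V \<mu> \<subseteq> vec.span {}" by auto
    then have "vec.dim (gen_eigenspace V \<mu>) \<le> card ({} :: (complex^'n) set)" by (rule vec.dim_le_card) simp
    then show False using n(1) unfolding n_def alg_mult_def card.empty by linarith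
  qed
  obtain P Q T :: "complex^'n^'n" where PQ: "P ** Q = mat 1" "Q ** P = mat 1" "V = P ** T ** Q"
    and T: "\<And>i j. idx_enum i > idx_enum j \<Longrightarrow> T$i$j = 0"
    and T\<mu>: "\<And>j. idx_enum j \<le> alg_mult V \<mu> \<Longrightarrow> T$j$j = \<mu>"
    by (rule triangularisation[of V \<mu>]) (rule that)
  define J where "J = {j::'n. idx_enum j \<le> n}"
  \<comment> \<open>On J the number \<open>idx_enum j - 1\<close> runs through 0, ..., n - 1, so
    each n-th root of unity occurs exactly once.\<close>
  define \<omega> where "\<omega> j = cis (2 * pi * real (idx_enum j - 1) / real n)" for j :: 'n
  have \<omega>n: "\<omega> j ^ n = 1" for j
  proof -
    have "real n * (2 * pi * real (idx_enum j - 1) / real n) = 2 * pi * real (idx_enum j - 1)" using n by simp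
    then show ?thesis unfolding \<omega>_def Complex.DeMoivre by (simp add: cis_multiple_2pi)
  qed
  define D where "D = diag_mat (\<lambda>j. if j \<in> J then \<omega> j else 0)"
  define X where "X = P ** D ** Q"
  have line: "V + mscale \<zeta> X = P ** (T + mscale \<zeta> D) ** Q" for \<zeta>
    unfolding X_def PQ(3) by (simp add: matrix_add_ldistrib matrix_add_rdistrib mscale_mult)
  define d where "d \<zeta> j = (if j \<in> J then \<mu> + \<zeta> * \<omega> j else T$j$j)" for \<zeta> j
  have TD: "idx_enum i > idx_enum j \<Longrightarrow> (T + mscale \<zeta> D) $ i $ j = 0"
    "(T + mscale \<zeta> D) $ j $ j = d \<zeta> j" for i j \<zeta>
    using T T\<mu> by (auto simp: D_def diag_mat_def mscale_def d_def J_def n_def)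
  have bij: "bij_betw (\<lambda>j. idx_enum j - 1) J {..<n}"
    unfolding bij_betw_def
  proof
    show "inj_on (\<lambda>j. idx_enum j - 1) J"
    proof (rule inj_onI)
      fix i j :: 'n assume "idx_enum i - 1 = idx_enum j - 1"
      then have "idx_enum i = idx_enum j"
        using idx_enum_range(1)[of i] idx_enum_range(1)[of j] by linarith
      then show "i = j" by (rule injD[OF idx_enum_inj])
    qed
    show "(\<lambda>j. idx_enum j - 1) ` J = {..<n}"
    proof safe
      fix j assume "j \<in> J"
      then show "idx_enum j - 1 < n" using idx_enum_range(1)[of j] n(1) by (auto simp: J_def)
    next
      fix k assume k: "k < n"
      then have "1 \<le> Suc k" "Suc k \<le> CARD('n)" using n(2) by auto
      then obtain j :: 'n where j: "idx_enum j = Suc k" by (rule idx_enum_surj)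
      then show "k \<in> (\<lambda>j. idx_enum j - 1) ` J" using k by (intro image_eqI[of _ _ j]) (auto simp: J_def)
    qed
  qed
  have cJ: "card J = n" unfolding J_def by (rule card_idx_enum_le[OF n(2)])
  then have Jne: "J \<noteq> {}" using n(1) by auto
  have X0: "X \<noteq> 0"
  proof
    assume "X = 0"
    have "Q ** X ** P = D"
      unfolding X_def by (simp add: matrix_mul_assoc PQ(2)) (simp add: PQ(2) flip: matrix_mul_assoc)
    then have "D = 0" using \<open>X = 0\<close> by simp
    obtain j where "j \<in> J" using Jne by blast
    then have "D $ j $ j = \<omega> j" by (simp add: D_def diag_mat_def)
    then show False using \<open>D = 0\<close> by (simp add: \<omega>_def)
  qed
  define h where "h = (\<Prod>j\<in>-J. [:- (T$j$j), 1:])"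
  \<comment> \<open>Only the constant term of the perturbed block moves, since the lower elementary
    symmetric functions of the n-th roots of unity vanish. Hence sigma moves by \<zeta>^n times a
    fixed vector built from h.\<close>
  have cp: "charpoly (V + mscale \<zeta> X) = ([:- \<mu>, 1:] ^ n - [:\<zeta> ^ n:]) * h" for \<zeta>
  proof -
    have "charpoly (V + mscale \<zeta> X) = (\<Prod>j\<in>UNIV. [:- d \<zeta> j, 1:])"
      unfolding line charpoly_similar[OF PQ(2,1)]
      by (subst charpoly_triangular_idx) (simp_all add: TD del: vector_add_component)
    also have "\<dots> = (\<Prod>j\<in>J. [:- d \<zeta> j, 1:]) * (\<Prod>j\<in>-J. [:- d \<zeta> j, 1:])"
      by (subst prod.union_disjoint[symmetric]) auto
    also have "(\<Prod>j\<in>-J. [:- d \<zeta> j, 1:]) = h"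
      unfolding h_def by (rule prod.cong) (auto simp: d_def)
    also have "(\<Prod>j\<in>J. [:- d \<zeta> j, 1:]) = [:- \<mu>, 1:] ^ n - [:\<zeta> ^ n:]"
    proof -
      have "poly (\<Prod>j\<in>J. [:- d \<zeta> j, 1:]) t = poly ([:- \<mu>, 1:] ^ n - [:\<zeta> ^ n:]) t" for t
      proof -
        have "poly (\<Prod>j\<in>J. [:- d \<zeta> j, 1:]) t = (\<Prod>j\<in>J. (t - \<mu>) - \<zeta> * \<omega> j)"
          unfolding poly_prod by (rule prod.cong) (auto simp: d_def)
        also have "\<dots> = (\<Prod>k<n. (t - \<mu>) - \<zeta> * cis (2 * pi * real k / real n))"
          unfolding \<omega>_def by (rule prod.reindex_bij_betw[OF bij])
        also have "\<dots> = (t - \<mu>) ^ n - \<zeta> ^ n" by (rule prod_roots_of_unity[OF n(1)])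
        finally show ?thesis by (simp add: poly_power)
      qed
      then show ?thesis by (simp add: poly_eq_poly_eq_iff[symmetric] fun_eq_iff)
    qed
    finally show ?thesis .
  qed
  have V0: "V + mscale 0 X = V" by (simp add: mscale_def vec_eq_iff)
  have cpV: "charpoly V = [:- \<mu>, 1:] ^ n * h"
    using cp[of 0] n(1) unfolding V0 by (simp add: power_0_left)
  have upper: "\<exists>C::real. \<forall>\<^sub>F \<zeta> in at (0::complex). green (*s) symm_polydisk (sigma V) (sigma (V + mscale \<zeta> X))
        \<le> ereal (real n * ln (cmod \<zeta>) + C)"
  proof -
    obtain R where R: "R > 0" "cball (sigma V) R \<subseteq> symm_polydisk"
      using open_contains_cball[THEN iffD1, OF open_symm_polydisk, rule_format, OF sigma_in_symm_polydisk[OF V]] by blast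
    \<comment> \<open>The summand 1 keeps K positive without inspecting the coefficients of
      h.\<close>
    define K where "K = 1 + (\<Sum>i\<in>(UNIV::'n set). cmod (coeff h (CARD('n) - idx_enum i)))"
    have K: "K > 0" unfolding K_def by (intro add_pos_nonneg sum_nonneg) auto
    have diff: "norm (sigma (V + mscale \<zeta> X) - sigma V) \<le> K * cmod \<zeta> ^ n" for \<zeta>
    proof -
      have "charpoly (V + mscale \<zeta> X) = charpoly V - smult (\<zeta> ^ n) h"
        unfolding cp cpV by (simp add: left_diff_distrib)
      then have "(sigma (V + mscale \<zeta> X) - sigma V) $ i =
          - ((-1) ^ idx_enum i * (\<zeta> ^ n * coeff h (CARD('n) - idx_enum i)))" for i
        by (simp add: sigma_def sigma_coeff_def right_diff_distrib)
      then have c: "cmod ((sigma (V + mscale \<zeta> X) - sigma V) $ i) = cmod (coeff h (CARD('n) - idx_enum i)) * cmod \<zeta> ^ n" for i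
        by (simp add: norm_mult norm_power mult.commute)
      have "norm (sigma (V + mscale \<zeta> X) - sigma V) \<le> (\<Sum>i\<in>UNIV. cmod ((sigma (V + mscale \<zeta> X) - sigma V) $ i))"
        by (rule norm_vec_le_sum)
      also have "\<dots> = (\<Sum>i\<in>(UNIV::'n set). cmod (coeff h (CARD('n) - idx_enum i))) * cmod \<zeta> ^ n"
        unfolding c by (rule sum_distrib_right[symmetric])
      also have "\<dots> \<le> K * cmod \<zeta> ^ n" unfolding K_def by (intro mult_right_mono) auto
      finally show ?thesis .
    qed
    have "\<forall>\<^sub>F \<zeta> in at (0::complex). \<zeta> \<noteq> 0" by (simp add: eventually_at_filter)
    moreover have "\<forall>\<^sub>F \<zeta> in at (0::complex). dist \<zeta> 0 < min 1 (R / K)"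
      unfolding eventually_at by (rule exI[of _ "min 1 (R / K)"]) (use R K in auto)
    ultimately have "\<forall>\<^sub>F \<zeta> in at (0::complex). green (*s) symm_polydisk (sigma V) (sigma (V + mscale \<zeta> X))
        \<le> ereal (real n * ln (cmod \<zeta>) + (ln K - ln R))"
    proof eventually_elim
      case (elim \<zeta>)
      have "cmod \<zeta> ^ n \<le> cmod \<zeta>" using elim(2) power_decreasing[of 1 n "cmod \<zeta>"] n(1) by simp
      also have "\<dots> \<le> R / K" using elim(2) by simp
      finally have KR: "K * cmod \<zeta> ^ n \<le> R" using K by (simp add: field_simps)
      have pos: "K * cmod \<zeta> ^ n > 0" using K elim(1) by simp
      have "green (*s) symm_polydisk (sigma V) (sigma (V + mscale \<zeta> X)) \<le> ereal (ln ((K * cmod \<zeta> ^ n) / R))"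
        by (rule green_upper[OF bounded_bilinear_smult norm_smult_vec _ R order_trans[OF diff KR] diff pos]) simp
      also have "ln ((K * cmod \<zeta> ^ n) / R) = real n * ln (cmod \<zeta>) + (ln K - ln R)"
        using K R(1) elim(1) by (simp add: ln_div ln_mult ln_realpow)
      finally show ?case .
    qed
    then show ?thesis by blast
  qed
  have lower: "\<exists>C::real. \<forall>\<^sub>F \<zeta> in at (0::complex). ereal (real m * ln (cmod \<zeta>) - C)
        \<le> green mscale spectral_ball V (V + mscale \<zeta> X)"
  proof -
    \<comment> \<open>By \<open>pm_all_eigenvalues\<close>, g(V) maps everything into the
      generalized eigenspace of \<mu>, on which (V - \<mu>)^m vanishes; so q annihilates V.\<close>
    define g where "g = (\<Prod>\<nu>\<in>eigenvalues V - {\<mu>}. [:- \<nu>, 1:] ^ CARD('n))"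
    define q where "q = [:- \<mu>, 1:] ^ m * g"
    have \<mu>V: "\<mu> \<in> eigenvalues V" using \<mu>(1) by (simp add: is_eigenvalue_iff)
    have "pm V q *v x = 0" for x
    proof -
      have "[:- \<mu>, 1:] ^ CARD('n) * g = (\<Prod>\<nu>\<in>eigenvalues V. [:- \<nu>, 1:] ^ CARD('n))"
        unfolding g_def by (rule prod.remove[OF finite_eigenvalues \<mu>V, symmetric])
      then have "pm V ([:- \<mu>, 1:] ^ CARD('n)) *v (pm V g *v x) = 0"
        by (simp only: pm_mult_vec[symmetric] pm_all_eigenvalues matrix_vector_mult_0)
      then have "pm V g *v x \<in> gen_eigenspace V \<mu>" by (simp add: gen_eigenspace_alt)
      then show ?thesis unfolding q_def pm_mult_vec m_def by (rule nil_index_kills)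
    qed
    then have qV: "pm V q = 0" by (simp add: matrix_eq)
    obtain C where C: "\<And>M. log_mod (1 / real n) C (trace (pm M (q ^ n))) \<le> green mscale spectral_ball V M"
      by (rule green_lower[OF V qV n(1)]) (rule that)
    \<comment> \<open>What remains of the trace after \<zeta>^(mn) is split off. At \<zeta> = 0 all
      n summands equal g(\<mu>)^n, so G(0) is nonzero and log |G| stays bounded near 0.\<close>
    define G where "G \<zeta> = (\<Sum>j\<in>J. poly g (\<mu> + \<zeta> * \<omega> j) ^ n)" for \<zeta>
    have F: "trace (pm (V + mscale \<zeta> X) (q ^ n)) = \<zeta> ^ (m * n) * G \<zeta>" for \<zeta>
    proof -
      have "trace (pm (V + mscale \<zeta> X) (q ^ n)) = (\<Sum>j\<in>UNIV. poly (q ^ n) (d \<zeta> j))"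
        unfolding line by (subst trace_pm[OF PQ(1,2)]) (simp_all add: TD del: vector_add_component)
      also have "\<dots> = (\<Sum>j\<in>J. poly (q ^ n) (d \<zeta> j))"
      proof (rule sum.mono_neutral_right)
        show "\<forall>j\<in>UNIV - J. poly (q ^ n) (d \<zeta> j) = 0"
        proof
          \<comment> \<open>The unperturbed diagonal entries are roots of h, hence eigenvalues of V:
            g vanishes there, or the entry is \<mu> and the factor (t - \<mu>)^m does.\<close>
          fix j assume j: "j \<in> UNIV - J"
          then have "poly h (T$j$j) = 0" by (auto simp: h_def poly_prod)
          then have "T$j$j \<in> eigenvalues V" by (simp add: cpV)
          then have "poly q (T$j$j) = 0"
            using m finite_eigenvalues[of V] by (cases "T$j$j = \<mu>") (auto simp: q_def g_def poly_prod)
          then show "poly (q ^ n) (d \<zeta> j) = 0" using j n(1) by (simp add: d_def)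
        qed
      qed auto
      also have "\<dots> = (\<Sum>j\<in>J. \<zeta> ^ (m * n) * poly g (\<mu> + \<zeta> * \<omega> j) ^ n)"
      proof (rule sum.cong[OF refl])
        fix j assume "j \<in> J"
        have "(\<omega> j ^ m) ^ n = 1" using \<omega>n[of j] by (metis power_mult mult.commute power_one)
        then show "poly (q ^ n) (d \<zeta> j) = \<zeta> ^ (m * n) * poly g (\<mu> + \<zeta> * \<omega> j) ^ n"
          using \<open>j \<in> J\<close> by (simp add: d_def q_def power_mult_distrib power_mult)
      qed
      finally show ?thesis by (simp add: G_def sum_distrib_left)
    qed
    have "poly g \<mu> \<noteq> 0" using finite_eigenvalues[of V] by (auto simp: g_def poly_prod)
    moreover have "G 0 = of_nat n * poly g \<mu> ^ n"
      by (simp add: G_def cJ)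
    ultimately have G0: "G 0 \<noteq> 0" using n(1) by simp
    have "isCont G 0" unfolding G_def by (intro continuous_intros)
    then have "((\<lambda>\<zeta>. cmod (G \<zeta>)) \<longlongrightarrow> cmod (G 0)) (at 0)"
      unfolding isCont_def by (rule tendsto_norm)
    then have "\<forall>\<^sub>F \<zeta> in at 0. cmod (G 0) / 2 < cmod (G \<zeta>)"
      by (rule order_tendstoD(1)) (use G0 in simp)
    moreover have "\<forall>\<^sub>F \<zeta> in at (0::complex). \<zeta> \<noteq> 0" by (simp add: eventually_at_filter)
    ultimately have "\<forall>\<^sub>F \<zeta> in at (0::complex). ereal (real m * ln (cmod \<zeta>) - (C - ln (cmod (G 0) / 2) / real n))
        \<le> green mscale spectral_ball V (V + mscale \<zeta> X)"
    proof eventually_elim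
      case (elim \<zeta>)
      have G: "G \<zeta> \<noteq> 0" using elim(1) by auto
      have "ln (cmod (G 0) / 2) \<le> ln (cmod (G \<zeta>))" using elim(1) G0 by (intro ln_mono) auto
      then have "ln (cmod (G 0) / 2) / real n \<le> ln (cmod (G \<zeta>)) / real n" by (intro divide_right_mono) auto
      moreover have "ln (cmod (\<zeta> ^ (m * n) * G \<zeta>)) = real (m * n) * ln (cmod \<zeta>) + ln (cmod (G \<zeta>))"
        using G elim(2) by (simp add: norm_mult norm_power ln_mult ln_realpow)
      then have "1 / real n * ln (cmod (\<zeta> ^ (m * n) * G \<zeta>)) = real m * ln (cmod \<zeta>) + ln (cmod (G \<zeta>)) / real n"
        using n(1) by (simp add: add_divide_distrib)
      ultimately have "ereal (real m * ln (cmod \<zeta>) - (C - ln (cmod (G 0) / 2) / real n))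
          \<le> log_mod (1 / real n) C (\<zeta> ^ (m * n) * G \<zeta>)"
        using G elim(2) by (simp add: log_mod_def)
      also have "\<dots> \<le> green mscale spectral_ball V (V + mscale \<zeta> X)"
        using C[of "V + mscale \<zeta> X"] unfolding F .
      finally show ?case .
    qed
    then show ?thesis by blast
  qed
  show ?thesis
    by (rule that[OF \<mu> X0 lower[unfolded m_def] upper[unfolded n_def]])
qed

theorem theorem1p1:
  fixes V :: "complex^'n^'n"
  assumes "CARD('n) \<ge> 2"
    and "V \<in> spectral_ball"
  shows "(cyclic_matrix V \<longrightarrow>
           (\<forall>M\<in>spectral_ball.
              green mscale spectral_ball V M = green (*s) symm_polydisk (sigma V) (sigma M)))
       \<and> (\<not> cyclic_matrix V \<longrightarrow>
           (\<exists>\<mu> X. is_eigenvalue V \<mu> \<and> nil_index V \<mu> < alg_mult V \<mu> \<and> X \<noteq> 0 \<and>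
              (\<exists>C::real. \<forall>\<^sub>F \<zeta> in at (0::complex).
                 ereal (real (nil_index V \<mu>) * ln (cmod \<zeta>) - C)
                   \<le> green mscale spectral_ball V (V + mscale \<zeta> X)) \<and>
              (\<exists>C::real. \<forall>\<^sub>F \<zeta> in at (0::complex).
                 green (*s) symm_polydisk (sigma V) (sigma (V + mscale \<zeta> X))
                   \<le> ereal (real (alg_mult V \<mu>) * ln (cmod \<zeta>) + C))))"
proof (intro conjI impI ballI)
  show "green mscale spectral_ball V M = green (*s) symm_polydisk (sigma V) (sigma M)"
    if "cyclic_matrix V" "M \<in> spectral_ball" for M
    by (rule green_cyclic[OF assms(2) that(2,1)])
next
  assume nc: "\<not> cyclic_matrix V"
  show "\<exists>\<mu> X. is_eigenvalue V \<mu> \<and> nil_index V \<mu> < alg_mult V \<mu> \<and> X \<noteq> 0 \<and>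
              (\<exists>C::real. \<forall>\<^sub>F \<zeta> in at (0::complex).
                 ereal (real (nil_index V \<mu>) * ln (cmod \<zeta>) - C)
                   \<le> green mscale spectral_ball V (V + mscale \<zeta> X)) \<and>
              (\<exists>C::real. \<forall>\<^sub>F \<zeta> in at (0::complex).
                 green (*s) symm_polydisk (sigma V) (sigma (V + mscale \<zeta> X))
                   \<le> ereal (real (alg_mult V \<mu>) * ln (cmod \<zeta>) + C))"
    by (rule green_noncyclic[OF assms(2) nc]) (rule exI, rule exI, (rule conjI, assumption)+, assumption)
qed

end
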